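(* Let $k\ge3$, $m\ge1$ and $0<\alpha<1$. Among all $k$-uniform hypertrees with $m$ hyperedges, the first hypertree in $S_\alpha$-order is the hyperpath $P_m^{(k)}$.
   Context: Hypergraphs are finite; $k$-uniform means every hyperedge has exactly $k$ vertices; a hypertree is a connected hypergraph without cycles. The hyperpath $P_m^{(k)}$ is obtained from the path graph with $m$ edges by inserting $k-2$ new vertices (of degree one) into each edge. For a $k$-uniform hypergraph $\mathcal{H}$ on $[n]$, $\mathcal{A}(\mathcal{H})$ is the $k$-order $n$-dimensional tensor with entry $\frac1{(k-1)!}$ at $(i_1,\dots,i_k)$ if $\{i_1,\dots,i_k\}\in E(\mathcal{H})$ and $0$ otherwise; $\mathcal{D}(\mathcal{H})$ is the diagonal tensor of vertex degrees; $\mathcal{A}_\alpha(\mathcal{H})=\alpha\mathcal{D}(\mathcal{H})+(1-\alpha)\mathcal{A}(\mathcal{H})$. For a tensor $\mathcal{T}$, $\mathrm{Tr}_d(\mathcal{T})$ is the sum of the $d$-th powers of all $n(k-1)^{n-1}$ eigenvalues of $\mathcal{T}$ (roots of its characteristic polynomial, with multiplicity); in particular $\mathrm{Tr}_0(\mathcal{T})=n(k-1)^{n-1}$, and for $d\ge1$ $$\mathrm{Tr}_{d}(\mathcal{T})=(k-1)^{n-1}\sum_{d_1+\cdots+d_n=d}\ \prod_{i=1}^{n}\frac{1}{(d_i(k-1))!}\Big(\sum_{\gamma\in[n]^{k-1}}(\mathcal{T})_{i\gamma}\frac{\partial}{\partial a_{i\gamma}}\Big)^{d_i}\mathrm{tr}\big(A^{d(k-1)}\big),$$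 with $A=(a_{ij})$ an $n\times n$ matrix of indeterminates, $d_i\ge0$ integers, $\frac{\partial}{\partial a_{i\gamma}}=\frac{\partial}{\partial a_{i i_2}}\cdots\frac{\partial}{\partial a_{i i_k}}$ for $\gamma=i_2\cdots i_k$. $S_\alpha$-order: for $k$-uniform hypergraphs $\mathcal{H}_1,\mathcal{H}_2$ with $n$ vertices, $\mathcal{H}_1\prec_\alpha\mathcal{H}_2$ if there is $d\in\{1,\dots,n(k-1)^{n-1}-1\}$ with $\mathrm{Tr}_t(\mathcal{A}_\alpha(\mathcal{H}_1))=\mathrm{Tr}_t(\mathcal{A}_\alpha(\mathcal{H}_2))$ for $t=0,\dots,d-1$ and $\mathrm{Tr}_d(\mathcal{A}_\alpha(\mathcal{H}_1))<\mathrm{Tr}_d(\mathcal{A}_\alpha(\mathcal{H}_2))$. "$X$ is the first hypertree in a class" means $X$ is in the class and $X\prec_\alpha\mathcal{H}$ for every $\mathcal{H}$ in the class not isomorphic to $X$. *)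

theory Defs
  imports Complex_Main "HOL-Library.Poly_Mapping" "Jordan_Normal_Form.Matrix"
begin

section \<open>Hypergraphs\<close>

text \<open>A hypergraph \<open>H\<close> has the vertex set \<open>{..<nverts H}\<close>, i.e. \<open>[n]\<close> numbered from 0.\<close>

record hypergraph =
  nverts :: nat
  hyperedges :: "nat set set"

definition verts :: "hypergraph \<Rightarrow> nat set" where
  "verts H = {..<nverts H}"

definition uniform :: "nat \<Rightarrow> hypergraph \<Rightarrow> bool" where
  "uniform k H \<longleftrightarrow> (\<forall>e\<in>hyperedges H. e \<subseteq> verts H \<and> card e = k)"

definition adj :: "hypergraph \<Rightarrow> (nat \<times> nat) set" where
  "adj H = {(u, v). \<exists>e\<in>hyperedges H. u \<in> e \<and> v \<in> e}"

definition connected_hg :: "hypergraph \<Rightarrow> bool" where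
  "connected_hg H \<longleftrightarrow> (\<forall>u\<in>verts H. \<forall>v\<in>verts H. (u, v) \<in> (adj H)\<^sup>*)"

text \<open>A cycle is a closed alternating sequence
  \<open>v\<^sub>0 e\<^sub>0 v\<^sub>1 e\<^sub>1 \<dots> v\<^sub>l\<^sub>-\<^sub>1 e\<^sub>l\<^sub>-\<^sub>1 v\<^sub>0\<close> with \<open>l \<ge> 2\<close>, pairwise distinct vertices
  and pairwise distinct hyperedges (Berge cycle).  For \<open>l = 2\<close> these are two hyperedges
  sharing at least two vertices.\<close>

definition is_cycle :: "hypergraph \<Rightarrow> nat list \<Rightarrow> nat set list \<Rightarrow> bool" where
  "is_cycle H vs es \<longleftrightarrow>
     length vs = length es \<and> length es \<ge> 2 \<and> distinct vs \<and> distinct es \<and>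
     set es \<subseteq> hyperedges H \<and>
     (\<forall>i<length es. vs ! i \<in> es ! i \<and> vs ! (Suc i mod length es) \<in> es ! i)"

definition hypertree :: "hypergraph \<Rightarrow> bool" where
  "hypertree H \<longleftrightarrow> connected_hg H \<and> (\<nexists>vs es. is_cycle H vs es)"

definition hypertrees :: "nat \<Rightarrow> nat \<Rightarrow> hypergraph set" where
  "hypertrees k m = {H. uniform k H \<and> hypertree H \<and> card (hyperedges H) = m}"

text \<open>The vertices \<open>j (k - 1)\<close>, \<open>j = 0, \<dots>, m\<close>, are those of the underlying path graph; the
  \<open>k - 2\<close> vertices strictly between \<open>j (k - 1)\<close> and \<open>(j + 1) (k - 1)\<close> are the ones inserted
  into its \<open>j\<close>-th edge.\<close>

definition hyperpath :: "nat \<Rightarrow> nat \<Rightarrow> hypergraph" where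
  "hyperpath k m = \<lparr> nverts = m * (k - 1) + 1,
                     hyperedges = (\<lambda>j. {j * (k - 1)..(j + 1) * (k - 1)}) ` {..<m} \<rparr>"

definition isomorphic :: "hypergraph \<Rightarrow> hypergraph \<Rightarrow> bool" where
  "isomorphic G H \<longleftrightarrow>
     (\<exists>f. bij_betw f (verts G) (verts H) \<and> (\<lambda>e. f ` e) ` hyperedges G = hyperedges H)"

section \<open>Tensors\<close>

text \<open>A tensor of order \<open>k\<close> and dimension \<open>n\<close> is given by its entries at the index lists
  \<open>[i\<^sub>1, \<dots>, i\<^sub>k]\<close> of length \<open>k\<close> over \<open>{..<n}\<close>; \<open>k\<close> and \<open>n\<close> are passed separately.\<close>

type_synonym tensor = "nat list \<Rightarrow> real"

definition degree :: "hypergraph \<Rightarrow> nat \<Rightarrow> nat" where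
  "degree H v = card {e \<in> hyperedges H. v \<in> e}"

definition adj_tensor :: "nat \<Rightarrow> hypergraph \<Rightarrow> tensor" where
  "adj_tensor k H is =
     (if length is = k \<and> set is \<in> hyperedges H then 1 / fact (k - 1) else 0)"

definition degree_tensor :: "nat \<Rightarrow> hypergraph \<Rightarrow> tensor" where
  "degree_tensor k H is = (if is = replicate k (hd is) then real (degree H (hd is)) else 0)"

definition alpha_tensor :: "real \<Rightarrow> nat \<Rightarrow> hypergraph \<Rightarrow> tensor" where
  "alpha_tensor \<alpha> k H is = \<alpha> * degree_tensor k H is + (1 - \<alpha>) * adj_tensor k H is"

section \<open>Traces of tensors\<close>

text \<open>Polynomials over the reals in the indeterminates \<open>a\<^sub>i\<^sub>j\<close>: the key type is that of
  monomials (exponent vectors), and multiplication is that of the monoid algebra.\<close>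

type_synonym apoly = "(nat \<times> nat \<Rightarrow>\<^sub>0 nat) \<Rightarrow>\<^sub>0 real"

definition indet :: "nat \<times> nat \<Rightarrow> apoly" where
  "indet v = Poly_Mapping.single (Poly_Mapping.single v 1) 1"

definition const :: "real \<Rightarrow> apoly" where
  "const c = Poly_Mapping.single 0 c"

text \<open>Formal partial derivative.  The exponent subtraction truncates at 0, but only on monomials
  without the indeterminate \<open>v\<close>, whose contribution is 0.\<close>

definition pderiv_wrt :: "nat \<times> nat \<Rightarrow> apoly \<Rightarrow> apoly" where
  "pderiv_wrt v p =
     (\<Sum>\<mu>\<in>Poly_Mapping.keys p. Poly_Mapping.single (\<mu> - Poly_Mapping.single v 1)
        (real (Poly_Mapping.lookup \<mu> v) * Poly_Mapping.lookup p \<mu>))"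

text \<open>\<open>\<partial>/\<partial>a\<^sub>i\<^sub>\<gamma>\<close> for \<open>\<gamma> = [i\<^sub>2, \<dots>, i\<^sub>k]\<close>\<close>

definition pderiv_multi :: "nat \<Rightarrow> nat list \<Rightarrow> apoly \<Rightarrow> apoly" where
  "pderiv_multi i \<gamma> = foldr (\<lambda>j. pderiv_wrt (i, j)) \<gamma>"

definition diff_op :: "nat \<Rightarrow> nat \<Rightarrow> tensor \<Rightarrow> nat \<Rightarrow> apoly \<Rightarrow> apoly" where
  "diff_op k n T i p =
     (\<Sum>\<gamma>\<in>{\<gamma>. length \<gamma> = k - 1 \<and> set \<gamma> \<subseteq> {..<n}}. const (T (i # \<gamma>)) * pderiv_multi i \<gamma> p)"

definition indet_mat :: "nat \<Rightarrow> apoly mat" where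
  "indet_mat n = mat n n indet"

definition mat_tr :: "'a::comm_monoid_add mat \<Rightarrow> 'a" where
  "mat_tr A = (\<Sum>i<dim_row A. A $$ (i, i))"

text \<open>The summand for \<open>(d\<^sub>1, \<dots>, d\<^sub>n)\<close> given as the list \<open>ds\<close>.  The operators for different
  \<open>i\<close> commute, so the order of composition is immaterial.  The resulting polynomial is a
  constant: operators of total order \<open>d (k - 1)\<close> act on a form of that degree.\<close>

definition trace_summand :: "nat \<Rightarrow> nat \<Rightarrow> tensor \<Rightarrow> nat \<Rightarrow> nat list \<Rightarrow> apoly" where
  "trace_summand k n T d ds =
     foldr (\<lambda>i p. const (1 / fact (ds ! i * (k - 1))) * (diff_op k n T i ^^ (ds ! i)) p) [0..<n]
       (mat_tr (indet_mat n ^\<^sub>m (d * (k - 1))))"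

text \<open>The \<open>d\<close>-th order trace (sum of the \<open>d\<close>-th powers of the \<open>n (k - 1)\<^sup>n\<^sup>-\<^sup>1\<close> eigenvalues of
  \<open>T\<close>), given by the formula of Morozov and Shakirov for \<open>d \<ge> 1\<close>.\<close>

definition tensor_trace :: "nat \<Rightarrow> nat \<Rightarrow> tensor \<Rightarrow> nat \<Rightarrow> real" where
  "tensor_trace k n T d =
     (if d = 0 then real (n * (k - 1) ^ (n - 1))
      else real ((k - 1) ^ (n - 1)) *
        (\<Sum>ds\<in>{ds. length ds = n \<and> sum_list ds = d}. Poly_Mapping.lookup (trace_summand k n T d ds) 0))"

section \<open>The order by traces\<close>

definition alpha_trace :: "real \<Rightarrow> nat \<Rightarrow> hypergraph \<Rightarrow> nat \<Rightarrow> real" where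
  "alpha_trace \<alpha> k H d = tensor_trace k (nverts H) (alpha_tensor \<alpha> k H) d"

definition S_less :: "real \<Rightarrow> nat \<Rightarrow> hypergraph \<Rightarrow> hypergraph \<Rightarrow> bool" where
  "S_less \<alpha> k H\<^sub>1 H\<^sub>2 \<longleftrightarrow>
     nverts H\<^sub>1 = nverts H\<^sub>2 \<and>
     (\<exists>d\<in>{1..nverts H\<^sub>1 * (k - 1) ^ (nverts H\<^sub>1 - 1) - 1}.
        (\<forall>t<d. alpha_trace \<alpha> k H\<^sub>1 t = alpha_trace \<alpha> k H\<^sub>2 t) \<and>
        alpha_trace \<alpha> k H\<^sub>1 d < alpha_trace \<alpha> k H\<^sub>2 d)"

definition first_in :: "real \<Rightarrow> nat \<Rightarrow> hypergraph set \<Rightarrow> hypergraph \<Rightarrow> bool" where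
  "first_in \<alpha> k C X \<longleftrightarrow> X \<in> C \<and> (\<forall>H\<in>C. \<not> isomorphic X H \<longrightarrow> S_less \<alpha> k X H)"

end

theory Submission
  imports Defs "HOL-Library.Multiset" "HOL-Combinatorics.Permutations"
begin

text \<open>
  Expanding the differential operators, \<open>Tr\<^sub>d\<close> is up to the factor \<open>(k - 1)\<^sup>n\<^sup>-\<^sup>1\<close> a sum over the ways of
  choosing \<open>d\<close> tensor entries, weighted by the number of closed walks that use the arcs from the first
  index of each chosen entry to its other indices.  Such arcs balance only if, for \<open>d \<le> k + 2\<close>, the
  choice consists of diagonal entries at one vertex, or of one entry of a single hyperedge \<open>e\<close> for
  each root in \<open>e\<close> together with diagonal entries at vertices of \<open>e\<close>.

  For \<open>d < k\<close> only the diagonal entries remain, and \<open>Tr\<^sub>d\<close> is proportional to the sum of the \<open>d\<close>-th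
  powers of the degrees: \<open>Tr\<^sub>1\<close> is constant and \<open>Tr\<^sub>2\<close> is minimal exactly when all degrees are at
  most 2.  For hypertrees with degrees 1 and 2, a hyperedge with \<open>t\<close> vertices of degree 2 contributes
  \<open>g\<^sub>d t\<close>, where by symmetry \<open>g\<^sub>d\<close> does not depend on the hypergraph.  Its second difference is a
  sum over choices with diagonal entries at two given vertices, so \<open>g\<^sub>d\<close> is affine for \<open>d \<le> k + 1\<close>
  and strictly convex for \<open>d = k + 2\<close>.  As the sum of all \<open>t\<close> is \<open>2 (m - 1)\<close>, the sum of the
  \<open>g\<^sub>k\<^sub>+\<^sub>2 t\<close> is, for \<open>m \<ge> 2\<close>, minimal exactly when every \<open>t\<close> is 1 or 2, i.e. for the hyperpath.
\<close>

section \<open>The trace as a sum over closed walks\<close>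

text \<open>The order \<open>k + 2\<close> is the first at which two different vertices of one
  hyperedge can both receive an extra diagonal entry. It is also small enough to control the
  contributing choices: balance makes every vertex of a used hyperedge a root, so two hyperedges of
  a hypertree need at least \<open>2 * k - 1\<close> roots. This exceeds \<open>k + 2\<close> unless
  \<open>k = 3\<close>, a borderline case that takes a separate count. Once all degrees are 1 or 2,
  the number of vertices of degree 2 is \<open>m - 1\<close>. The power sums of the degrees then no
  longer distinguish hypertrees, and only the hyperedge terms are left. These are compared with the
  chord of the profile through 1 and 2, because the sum of an affine function of the branching
  numbers is the same for all competitors. The number of closed walks for a choice on a hyperedge is
  never computed. It suffices that it is nonnegative, invariant under permutations of the vertices,
  and positive for one explicit choice. The bounds on \<alpha> enter through the signs:
  \<open>\<alpha> > 0\<close> for the diagonal entries and \<open>\<alpha> < 1\<close> for the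
  common factor of the hyperedge terms.\<close>

definition mon :: "(nat \<times> nat) list \<Rightarrow> (nat \<times> nat \<Rightarrow>\<^sub>0 nat)" where
  "mon xs = (\<Sum>x\<leftarrow>xs. Poly_Mapping.single x 1)"

lemma mon_simps [simp]: "mon [] = 0" "mon (x # xs) = Poly_Mapping.single x 1 + mon xs"
  "mon (xs @ ys) = mon xs + mon ys"
  by (simp_all add: mon_def)

lemma lookup_mon: "Poly_Mapping.lookup (mon xs) x = count (mset xs) x"
  by (induction xs) (auto simp: lookup_add lookup_single when_def)

lemma mon_eq_iff: "mon xs = mon ys \<longleftrightarrow> mset xs = mset ys"
  by (simp add: poly_mapping_eq_iff fun_eq_iff lookup_mon multiset_eq_iff)

lemma lookup_const_mult [simp]:
  "Poly_Mapping.lookup (const c * p) \<mu> = c * Poly_Mapping.lookup p \<mu>"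
  unfolding const_def mult_map_scale_conv_mult [symmetric]
  by (simp add: Poly_Mapping.map.rep_eq when_def)

text \<open>Only \<open>\<mu> + single v 1\<close> contributes at \<mu>: on monomials divisible by
  \<open>v\<close> the subtraction is injective, and where it truncates the coefficient
  \<open>lookup \<nu> v\<close> is 0.\<close>

lemma lookup_pderiv_wrt:
  "Poly_Mapping.lookup (pderiv_wrt v p) \<mu> =
     real (Poly_Mapping.lookup \<mu> v + 1) * Poly_Mapping.lookup p (\<mu> + Poly_Mapping.single v 1)"
proof -
  let ?\<nu> = "\<mu> + Poly_Mapping.single v 1"
  have *: "Poly_Mapping.lookup (Poly_Mapping.single (\<nu> - Poly_Mapping.single v 1)
        (real (Poly_Mapping.lookup \<nu> v) * Poly_Mapping.lookup p \<nu>)) \<mu> =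
      (if \<nu> = ?\<nu> then real (Poly_Mapping.lookup \<mu> v + 1) * Poly_Mapping.lookup p ?\<nu> else 0)"
    for \<nu>
  proof (cases "\<nu> = ?\<nu>")
    case True
    then show ?thesis by (simp add: lookup_single lookup_add)
  next
    case False
    have "Poly_Mapping.lookup \<nu> v = 0" if "\<nu> - Poly_Mapping.single v 1 = \<mu>"
    proof (rule ccontr)
      assume "Poly_Mapping.lookup \<nu> v \<noteq> 0"
      then have "\<nu> = ?\<nu>"
        unfolding that [symmetric]
        by (intro poly_mapping_eqI) (auto simp: lookup_add lookup_minus lookup_single when_def)
      with False show False by simp
    qed
    then show ?thesis using False by (auto simp: lookup_single when_def)
  qed
  show ?thesis
    unfolding pderiv_wrt_def lookup_sum *
    by (auto simp: sum.delta in_keys_iff)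
qed

text \<open>Iterating the previous rule gives a quotient of factorials; clearing the denominator
  keeps the induction free of division. A fixed \<open>S\<close> containing all indeterminates of
  \<open>xs\<close> lets \<mu> vary without changing the index set of the products.\<close>

lemma lookup_pderivs:
  assumes "finite S" "set xs \<subseteq> S"
  shows "Poly_Mapping.lookup (foldr pderiv_wrt xs p) \<mu> * (\<Prod>x\<in>S. fact (Poly_Mapping.lookup \<mu> x)) =
    (\<Prod>x\<in>S. fact (Poly_Mapping.lookup (\<mu> + mon xs) x)) * Poly_Mapping.lookup p (\<mu> + mon xs)"
  using assms(2)
proof (induction xs arbitrary: \<mu>)
  case (Cons x xs)
  let ?\<nu> = "\<mu> + Poly_Mapping.single x 1"
  have x: "x \<in> S" using Cons.prems by simp
  have "real (Poly_Mapping.lookup \<mu> x + 1) * (\<Prod>y\<in>S. fact (Poly_Mapping.lookup \<mu> y)) =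
      (\<Prod>y\<in>S. fact (Poly_Mapping.lookup ?\<nu> y))"
  proof -
    have "(\<Prod>y\<in>S-{x}. fact (Poly_Mapping.lookup \<mu> y)) =
        (\<Prod>y\<in>S-{x}. fact (Poly_Mapping.lookup ?\<nu> y) :: real)"
      by (rule prod.cong) (auto simp: lookup_add lookup_single when_def)
    then show ?thesis
      by (simp add: prod.remove [OF assms(1) x] lookup_add lookup_single)
  qed
  then have "Poly_Mapping.lookup (foldr pderiv_wrt (x # xs) p) \<mu> * (\<Prod>x\<in>S. fact (Poly_Mapping.lookup \<mu> x)) =
      Poly_Mapping.lookup (foldr pderiv_wrt xs p) ?\<nu> * (\<Prod>y\<in>S. fact (Poly_Mapping.lookup ?\<nu> y))"
    by (simp add: lookup_pderiv_wrt mult_ac)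
  then show ?case
    using Cons by (simp add: ac_simps)
qed simp

text \<open>The factor that appears when a monomial with these exponents is differentiated down to a
  constant. Multiplied by the number of closed walks with the arcs \<open>M\<close>, it counts them
  with parallel arcs told apart.\<close>

definition arcs_fact :: "(nat \<times> nat) multiset \<Rightarrow> real" where
  "arcs_fact M = (\<Prod>x\<in>set_mset M. fact (count M x))"

lemma lookup_pderivs_0:
  "Poly_Mapping.lookup (foldr pderiv_wrt xs p) 0 = arcs_fact (mset xs) * Poly_Mapping.lookup p (mon xs)"
  using lookup_pderivs [of "set xs" xs p 0] by (simp add: arcs_fact_def lookup_mon)

lemma pderivs_sum:
  "foldr pderiv_wrt xs (\<Sum>i\<in>I. const (c i) * f i) = (\<Sum>i\<in>I. const (c i) * foldr pderiv_wrt xs (f i))"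
proof (induction xs)
  case (Cons x xs)
  show ?case
    unfolding foldr.simps o_def Cons
    by (intro poly_mapping_eqI)
      (simp add: lookup_pderiv_wrt lookup_sum sum_distrib_left mult_ac)
qed simp

lemma const_mult_const: "const a * (const b * p) = const (a * b) * p"
  by (intro poly_mapping_eqI) simp

lemma const_1 [simp]: "const 1 * p = p"
  by (intro poly_mapping_eqI) simp

section \<open>Expansion of products of the differential operators\<close>

definition tails :: "nat \<Rightarrow> nat \<Rightarrow> nat list set" where
  "tails k n = {\<gamma>. set \<gamma> \<subseteq> {..<n} \<and> length \<gamma> = k - 1}"

lemma finite_tails [simp]: "finite (tails k n)"
  unfolding tails_def by (rule finite_lists_length_eq) simp

definition root_arcs :: "nat \<Rightarrow> nat list list \<Rightarrow> (nat \<times> nat) list" where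
  "root_arcs i \<Gamma> = concat (map (map (Pair i)) \<Gamma>)"

lemma pderiv_multi_eq: "pderiv_multi i \<gamma> p = foldr pderiv_wrt (map (Pair i) \<gamma>) p"
  by (simp add: pderiv_multi_def foldr_map o_def)

text \<open>The power is expanded over sequences of tails, not multisets, so no multinomial
  coefficients appear.\<close>

lemma diff_op_funpow:
  "(diff_op k n T i ^^ q) p =
     (\<Sum>\<Gamma>\<in>{\<Gamma>. set \<Gamma> \<subseteq> tails k n \<and> length \<Gamma> = q}.
        const (\<Prod>\<gamma>\<leftarrow>\<Gamma>. T (i # \<gamma>)) * foldr pderiv_wrt (root_arcs i \<Gamma>) p)"
proof (induction q)
  case 0
  have *: "{\<Gamma>. set \<Gamma> \<subseteq> tails k n \<and> length \<Gamma> = 0} = {[]}" by auto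
  show ?case unfolding * by (simp add: root_arcs_def)
next
  case (Suc q)
  let ?L = "\<lambda>q. {\<Gamma>. set \<Gamma> \<subseteq> tails k n \<and> length \<Gamma> = q}"
  have tl: "{\<gamma>. length \<gamma> = k - 1 \<and> set \<gamma> \<subseteq> {..<n}} = tails k n" by (auto simp: tails_def)
  have "(diff_op k n T i ^^ Suc q) p = (\<Sum>\<gamma>\<in>tails k n. const (T (i # \<gamma>)) *
      (\<Sum>\<Gamma>\<in>?L q. const (\<Prod>\<gamma>\<leftarrow>\<Gamma>. T (i # \<gamma>)) * foldr pderiv_wrt (root_arcs i (\<gamma> # \<Gamma>)) p))"
    by (simp add: diff_op_def tl [simplified] Suc pderiv_multi_eq pderivs_sum root_arcs_def)
  also have "\<dots> = (\<Sum>\<gamma>\<in>tails k n. \<Sum>\<Gamma>\<in>?L q. const (\<Prod>\<gamma>\<leftarrow>\<gamma>#\<Gamma>. T (i # \<gamma>)) * foldr pderiv_wrt (root_arcs i (\<gamma> # \<Gamma>)) p)"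
    by (simp add: sum_distrib_left const_mult_const)
  also have "\<dots> = (\<Sum>(\<Gamma>,\<gamma>)\<in>?L q \<times> tails k n. const (\<Prod>\<gamma>\<leftarrow>\<gamma>#\<Gamma>. T (i # \<gamma>)) * foldr pderiv_wrt (root_arcs i (\<gamma> # \<Gamma>)) p)"
    by (subst sum.swap) (simp add: sum.cartesian_product)
  also have "\<dots> = (\<Sum>\<Gamma>\<in>?L (Suc q). const (\<Prod>\<gamma>\<leftarrow>\<Gamma>. T (i # \<gamma>)) * foldr pderiv_wrt (root_arcs i \<Gamma>) p)"
    unfolding lists_length_Suc_eq
    by (subst sum.reindex) (auto simp: inj_on_def case_prod_unfold)
  finally show ?case .
qed

text \<open>The fixed value \<open>[]\<close> outside \<open>I\<close> makes a choice one total
  function, so that the choices for a larger index set arise from those for a smaller one by a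
  function update.\<close>

definition choices :: "nat \<Rightarrow> nat \<Rightarrow> nat set \<Rightarrow> (nat \<Rightarrow> nat) \<Rightarrow> (nat \<Rightarrow> nat list list) set" where
  "choices k n I q = {C. \<forall>i. (i \<in> I \<longrightarrow> set (C i) \<subseteq> tails k n \<and> length (C i) = q i) \<and> (i \<notin> I \<longrightarrow> C i = [])}"

lemma foldr_diff_op:
  assumes "distinct is"
  shows "foldr (\<lambda>i p. const (c i) * (diff_op k n T i ^^ q i) p) is p =
    (\<Sum>C\<in>choices k n (set is) q. const (\<Prod>i\<in>set is. c i * (\<Prod>\<gamma>\<leftarrow>C i. T (i # \<gamma>))) *
      foldr pderiv_wrt (concat (map (\<lambda>i. root_arcs i (C i)) is)) p)"
  using assms
proof (induction "is")
  case Nil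
  have *: "choices k n {} q = {\<lambda>_. []}" by (auto simp: choices_def)
  show ?case unfolding * set_simps by simp
next
  case (Cons i "is")
  then have i: "i \<notin> set is" "distinct is" by auto
  let ?L = "{\<Gamma>. set \<Gamma> \<subseteq> tails k n \<and> length \<Gamma> = q i}"
  let ?w = "\<lambda>i C. c i * (\<Prod>\<gamma>\<leftarrow>C i. T (i # \<gamma>))"
  let ?a = "\<lambda>is C. concat (map (\<lambda>i. root_arcs i (C i)) is)"
  let ?f = "\<lambda>C. const (\<Prod>i\<in>set (i # is). ?w i C) * foldr pderiv_wrt (?a (i # is) C) p"
  have 1: "(\<Prod>x\<in>set is. ?w x (C(i := \<Gamma>))) = (\<Prod>x\<in>set is. ?w x C)" for \<Gamma> C
    using i by (intro prod.cong) auto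
  have 2: "?a is (C(i := \<Gamma>)) = ?a is C" for \<Gamma> C
    using i by (intro arg_cong [where f=concat] map_cong) auto
  have 3: "?f (C(i := \<Gamma>)) = const (c i * ((\<Prod>\<gamma>\<leftarrow>\<Gamma>. T (i # \<gamma>)) * (\<Prod>x\<in>set is. ?w x C))) *
       foldr pderiv_wrt (root_arcs i \<Gamma>) (foldr pderiv_wrt (?a is C) p)" for \<Gamma> C
    using i by (simp add: 1 2 mult.assoc del: fun_upd_apply) simp
  have "foldr (\<lambda>i p. const (c i) * (diff_op k n T i ^^ q i) p) (i # is) p =
     (\<Sum>\<Gamma>\<in>?L. \<Sum>C\<in>choices k n (set is) q. ?f (C(i := \<Gamma>)))"
    unfolding 3 foldr.simps o_def Cons.IH [OF i(2)]
    by (simp add: diff_op_funpow pderivs_sum sum_distrib_left const_mult_const)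
  also have "\<dots> = (\<Sum>(\<Gamma>,C)\<in>?L \<times> choices k n (set is) q. ?f (C(i := \<Gamma>)))"
    by (simp add: sum.cartesian_product)
  also have "\<dots> = (\<Sum>C\<in>choices k n (set (i # is)) q. ?f C)"
  proof (rule sum.reindex_bij_witness [where j = "\<lambda>(\<Gamma>,C). C(i := \<Gamma>)" and i = "\<lambda>C. (C i, C(i := []))"])
    fix a assume "a \<in> ?L \<times> choices k n (set is) q"
    then obtain \<Gamma> C where a: "a = (\<Gamma>, C)" "\<Gamma> \<in> ?L" "C \<in> choices k n (set is) q" by auto
    have "C i = []" using a i by (auto simp: choices_def)
    then show "((case a of (\<Gamma>, C) \<Rightarrow> C(i := \<Gamma>)) i, (case a of (\<Gamma>, C) \<Rightarrow> C(i := \<Gamma>))(i := [])) = a"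
      using a by auto
    show "(case a of (\<Gamma>, C) \<Rightarrow> C(i := \<Gamma>)) \<in> choices k n (set (i # is)) q"
      using a i by (auto simp: choices_def)
    show "?f (case a of (\<Gamma>, C) \<Rightarrow> C(i := \<Gamma>)) = (case a of (\<Gamma>, C) \<Rightarrow> ?f (C(i := \<Gamma>)))"
      using a by simp
  qed (use i in \<open>auto simp: choices_def\<close>)
  finally show ?case .
qed

section \<open>Closed walks and powers of the matrix of indeterminates\<close>

definition cyc_arcs :: "'a list \<Rightarrow> ('a \<times> 'a) multiset" where
  "cyc_arcs ws = mset (zip ws (rotate1 ws))"

text \<open>A list fixes the starting point, so different rotations of one closed walk count
  separately, just as in the trace of a power. Parallel arcs are not told apart.\<close>

definition walks :: "nat \<Rightarrow> (nat \<times> nat) multiset \<Rightarrow> nat list set" where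
  "walks n M = {ws. set ws \<subseteq> {..<n} \<and> cyc_arcs ws = M}"

lemma single_mult_single_mon:
  "(Poly_Mapping.single (mon xs) 1 :: apoly) * indet v = Poly_Mapping.single (mon (xs @ [v])) 1"
  by (simp add: indet_def mult_single)

lemma indet_mat_pow:
  assumes "i < n" "j < n"
  shows "(indet_mat n ^\<^sub>m Suc N) $$ (i, j) =
    (\<Sum>us\<in>{us. set us \<subseteq> {..<n} \<and> length us = N}. Poly_Mapping.single (mon (zip (i # us) (us @ [j]))) 1)"
  using assms(2)
proof (induction N arbitrary: j)
  case 0
  have *: "{us. set us \<subseteq> {..<n} \<and> length us = 0} = {[]}" by auto
  have "indet_mat n ^\<^sub>m Suc 0 = indet_mat n"
    by (simp add: indet_mat_def)
  then show ?case using 0 assms unfolding * by (simp add: indet_mat_def indet_def)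
next
  case (Suc N)
  let ?L = "\<lambda>N. {us. set us \<subseteq> {..<n} \<and> length us = N}"
  have "(indet_mat n ^\<^sub>m Suc (Suc N)) $$ (i, j) = (\<Sum>l\<in>{0..<n}. (indet_mat n ^\<^sub>m Suc N) $$ (i, l) * indet (l, j))"
    using assms Suc.prems
    by (subst pow_mat.simps(2)) (simp add: scalar_prod_def indet_mat_def del: pow_mat.simps)
  also have "\<dots> = (\<Sum>l\<in>{0..<n}. \<Sum>us\<in>?L N. Poly_Mapping.single (mon (zip (i # us @ [l]) ((us @ [l]) @ [j]))) 1)"
  proof (intro sum.cong refl)
    fix l assume "l \<in> {0..<n}"
    then show "(indet_mat n ^\<^sub>m Suc N) $$ (i, l) * indet (l, j) =
        (\<Sum>us\<in>?L N. Poly_Mapping.single (mon (zip (i # us @ [l]) ((us @ [l]) @ [j]))) 1)"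
      by (simp only: Suc.IH atLeastLessThan_iff sum_distrib_right single_mult_single_mon)
        (intro sum.cong refl, use zip_append [of "i # x" "x @ [l]" "[l]" "[j]" for x] in simp)
  qed
  also have "\<dots> = (\<Sum>(l,us)\<in>{0..<n} \<times> ?L N. Poly_Mapping.single (mon (zip (i # us @ [l]) ((us @ [l]) @ [j]))) 1)"
    by (simp add: sum.cartesian_product)
  also have "\<dots> = (\<Sum>us\<in>?L (Suc N). Poly_Mapping.single (mon (zip (i # us) (us @ [j]))) 1)"
    by (rule sum.reindex_bij_witness [where j = "\<lambda>(l,us). us @ [l]" and i = "\<lambda>us. (last us, butlast us)"])
      (auto simp: in_set_butlastD length_Suc_conv_rev)
  finally show ?case .
qed

text \<open>A closed walk is a diagonal entry's path with its start included.
  \<open>N \<ge> 1\<close> matters: for \<open>N = 0\<close> the trace is \<open>n\<close>, whereas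
  the empty list would be the only walk.\<close>

lemma lookup_trace_pow:
  assumes "N \<ge> 1" "length xs = N"
  shows "Poly_Mapping.lookup (mat_tr (indet_mat n ^\<^sub>m N)) (mon xs) = real (card (walks n (mset xs)))"
proof -
  let ?L = "\<lambda>N. {us. set us \<subseteq> {..<n} \<and> length us = N}"
  obtain N' where N: "N = Suc N'" using assms by (cases N) auto
  have len: "length ws = N" if "cyc_arcs ws = mset xs" for ws
    using arg_cong [OF that, of size] assms by (simp add: cyc_arcs_def)
  have "mat_tr (indet_mat n ^\<^sub>m N) =
      (\<Sum>i\<in>{..<n}. \<Sum>us\<in>?L N'. Poly_Mapping.single (mon (zip (i # us) (us @ [i]))) 1)"
    unfolding mat_tr_def N
    by (rule sum.cong) (auto simp: indet_mat_pow simp del: pow_mat.simps, simp add: indet_mat_def)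
  also have "\<dots> = (\<Sum>(i,us)\<in>{..<n} \<times> ?L N'. Poly_Mapping.single (mon (zip (i # us) (us @ [i]))) 1)"
    by (simp add: sum.cartesian_product)
  also have "\<dots> = (\<Sum>ws\<in>?L N. Poly_Mapping.single (mon (zip ws (rotate1 ws))) 1)"
    by (rule sum.reindex_bij_witness [where j = "\<lambda>(i,us). i # us" and i = "\<lambda>us. (hd us, tl us)"])
      (auto simp: N length_Suc_conv)
  finally have "Poly_Mapping.lookup (mat_tr (indet_mat n ^\<^sub>m N)) (mon xs) =
      (\<Sum>ws\<in>?L N. if cyc_arcs ws = mset xs then 1 else 0)"
    by (simp add: lookup_sum lookup_single when_def mon_eq_iff cyc_arcs_def)
  also have "\<dots> = (\<Sum>ws\<in>walks n (mset xs). 1)"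
  proof -
    have "?L N \<inter> {ws. cyc_arcs ws = mset xs} = walks n (mset xs)"
      using len by (auto simp: walks_def)
    moreover have "finite (?L N)" by (rule finite_lists_length_eq) simp
    ultimately show ?thesis by (simp add: sum.If_cases del: sum_constant)
  qed
  finally show ?thesis by simp
qed

text \<open>A configuration assigns to every vertex \<open>i\<close> the list of the tails \<open>\<gamma>\<close> picked from the
  factors of \<open>(\<Sum>\<gamma>. T\<^sub>i\<^sub>\<gamma> \<partial>/\<partial>a\<^sub>i\<^sub>\<gamma>)^d\<^sub>i\<close>; \<open>d\<close> is the total number of tails.\<close>

definition configs :: "nat \<Rightarrow> nat \<Rightarrow> nat \<Rightarrow> (nat \<Rightarrow> nat list list) set" where
  "configs k n d = {C. (\<forall>i. set (C i) \<subseteq> tails k n) \<and> (\<forall>i\<ge>n. C i = []) \<and> (\<Sum>i<n. length (C i)) = d}"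

definition config_arcs :: "nat \<Rightarrow> (nat \<Rightarrow> nat list list) \<Rightarrow> (nat \<times> nat) multiset" where
  "config_arcs n C = (\<Sum>i<n. mset (root_arcs i (C i)))"

text \<open>Everything in the coefficient of a configuration that does not involve the tensor.
  Hypergraphs with equally many vertices share it and differ only in
  \<open>config_weight\<close>.\<close>

definition config_count :: "nat \<Rightarrow> nat \<Rightarrow> (nat \<Rightarrow> nat list list) \<Rightarrow> real" where
  "config_count k n C = (\<Prod>i<n. 1 / fact (length (C i) * (k - 1))) *
     (arcs_fact (config_arcs n C) * real (card (walks n (config_arcs n C))))"

definition config_weight :: "nat \<Rightarrow> tensor \<Rightarrow> (nat \<Rightarrow> nat list list) \<Rightarrow> real" where
  "config_weight n T C = (\<Prod>i<n. \<Prod>\<gamma>\<leftarrow>C i. T (i # \<gamma>))"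

lemma mset_concat_upt: "mset (concat (map f [0..<n])) = (\<Sum>i<n. mset (f i))"
  by (induction n) (auto simp: add.commute)

lemma length_root_arcs:
  assumes "set \<Gamma> \<subseteq> tails k n"
  shows "length (root_arcs i \<Gamma>) = length \<Gamma> * (k - 1)"
  using assms by (induction \<Gamma>) (auto simp: root_arcs_def tails_def)

lemma size_config_arcs:
  assumes "C \<in> configs k n d"
  shows "size (config_arcs n C) = d * (k - 1)"
proof -
  have "size (\<Sum>i<n. mset (root_arcs i (C i))) = (\<Sum>i<n. length (root_arcs i (C i)))" for n
    by (induction n) auto
  then have "size (config_arcs n C) = (\<Sum>i<n. length (C i) * (k - 1))"
    using assms by (simp add: config_arcs_def configs_def length_root_arcs [of _ k n])
  also have "\<dots> = d * (k - 1)"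
    using assms by (simp add: configs_def flip: sum_distrib_right)
  finally show ?thesis .
qed

lemma finite_configs [simp]: "finite (configs k n d)"
proof -
  have "finite {\<Gamma>. set \<Gamma> \<subseteq> tails k n \<and> length \<Gamma> \<le> d}"
    by (rule finite_lists_length_le) simp
  then have "finite {C. \<forall>i. (i \<in> {..<n} \<longrightarrow> C i \<in> {\<Gamma>. set \<Gamma> \<subseteq> tails k n \<and> length \<Gamma> \<le> d}) \<and>
      (i \<notin> {..<n} \<longrightarrow> C i = [])}" (is "finite ?X")
    by (intro finite_set_of_finite_funs) simp_all
  moreover have "length (C i) \<le> (\<Sum>i<n. length (C i))" if "i < n" for C :: "nat \<Rightarrow> nat list list" and i
    using that by (intro member_le_sum) auto
  then have "configs k n d \<subseteq> ?X"
    by (auto simp: configs_def)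
  ultimately show ?thesis
    by (rule rev_finite_subset)
qed

lemma lookup_trace_summand:
  assumes "k \<ge> 2" "d \<ge> 1" "length ds = n" "sum_list ds = d"
  shows "Poly_Mapping.lookup (trace_summand k n T d ds) 0 =
    (\<Sum>C\<in>choices k n {..<n} (\<lambda>i. ds ! i). config_weight n T C * config_count k n C)"
proof -
  have "Poly_Mapping.lookup (trace_summand k n T d ds) 0 =
     (\<Sum>C\<in>choices k n {..<n} (\<lambda>i. ds ! i). (\<Prod>i<n. 1 / fact (ds ! i * (k - 1)) * (\<Prod>\<gamma>\<leftarrow>C i. T (i # \<gamma>))) *
       (arcs_fact (config_arcs n C) *
         Poly_Mapping.lookup (mat_tr (indet_mat n ^\<^sub>m (d * (k - 1)))) (mon (concat (map (\<lambda>i. root_arcs i (C i)) [0..<n])))))"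
    unfolding trace_summand_def
    by (subst foldr_diff_op)
      (simp_all add: lookup_sum lookup_pderivs_0 config_arcs_def mset_concat_upt atLeast0LessThan)
  also have "\<dots> = (\<Sum>C\<in>choices k n {..<n} (\<lambda>i. ds ! i). config_weight n T C * config_count k n C)"
  proof (intro sum.cong refl)
    fix C assume C: "C \<in> choices k n {..<n} (\<lambda>i. ds ! i)"
    let ?xs = "concat (map (\<lambda>i. root_arcs i (C i)) [0..<n])"
    have "(\<Sum>i<n. ds ! i) = d"
      using assms by (simp add: sum_list_sum_nth atLeast0LessThan)
    then have "C \<in> configs k n d"
      using C by (auto simp: choices_def configs_def) (metis empty_iff list.set(1) not_le subsetD)
    then have "length ?xs = d * (k - 1)"
      using size_config_arcs [of C k n d] by (simp add: config_arcs_def flip: mset_concat_upt)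
    moreover have "d * (k - 1) \<ge> 1" using assms by simp
    ultimately have "Poly_Mapping.lookup (mat_tr (indet_mat n ^\<^sub>m (d * (k - 1)))) (mon ?xs) =
        real (card (walks n (config_arcs n C)))"
      by (simp add: lookup_trace_pow config_arcs_def mset_concat_upt)
    moreover have "(\<Prod>i<n. 1 / fact (ds ! i * (k - 1)) * (\<Prod>\<gamma>\<leftarrow>C i. T (i # \<gamma>))) =
        config_weight n T C * (\<Prod>i<n. 1 / fact (length (C i) * (k - 1)))"
      using C by (simp add: choices_def config_weight_def prod_dividef)
    ultimately show "(\<Prod>i<n. 1 / fact (ds ! i * (k - 1)) * (\<Prod>\<gamma>\<leftarrow>C i. T (i # \<gamma>))) *
       (arcs_fact (config_arcs n C) * Poly_Mapping.lookup (mat_tr (indet_mat n ^\<^sub>m (d * (k - 1)))) (mon ?xs)) =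
       config_weight n T C * config_count k n C"
      by (simp only: config_count_def mult_ac)
  qed
  finally show ?thesis .
qed

text \<open>The exponents \<open>ds\<close> can be read off as the lengths of the lists
  \<open>C i\<close>, so the choices for the different \<open>ds\<close> partition the
  configurations.\<close>

lemma tensor_trace_eq:
  assumes "k \<ge> 2" "d \<ge> 1"
  shows "tensor_trace k n T d =
    real ((k - 1) ^ (n - 1)) * (\<Sum>C\<in>configs k n d. config_weight n T C * config_count k n C)"
proof -
  let ?D = "{ds. length ds = n \<and> sum_list ds = d}"
  let ?ch = "\<lambda>ds. choices k n {..<n} (\<lambda>i. ds ! i)"
  let ?f = "\<lambda>C. config_weight n T C * config_count k n C"
  have fin: "finite ?D"
  proof (rule finite_subset)
    show "?D \<subseteq> {ds. set ds \<subseteq> {..d} \<and> length ds = n}"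
      using member_le_sum_list by fastforce
    show "finite {ds. set ds \<subseteq> {..d} \<and> length ds = n}" by (rule finite_lists_length_eq) simp
  qed
  have sub: "?ch ds \<subseteq> configs k n d" if "ds \<in> ?D" for ds
  proof
    fix C assume C: "C \<in> ?ch ds"
    have "(\<Sum>i<n. ds ! i) = d"
      using that by (auto simp: sum_list_sum_nth atLeast0LessThan)
    then show "C \<in> configs k n d"
      using C by (auto simp: choices_def configs_def) (metis empty_iff list.set(1) not_le subsetD)
  qed
  have "(\<Sum>ds\<in>?D. Poly_Mapping.lookup (trace_summand k n T d ds) 0) = (\<Sum>ds\<in>?D. \<Sum>C\<in>?ch ds. ?f C)"
    using assms by (intro sum.cong) (auto simp: lookup_trace_summand)
  also have "\<dots> = (\<Sum>C\<in>(\<Union>ds\<in>?D. ?ch ds). ?f C)"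
  proof (rule sum.UNION_disjoint [symmetric])
    show "\<forall>ds\<in>?D. finite (?ch ds)"
      using finite_subset [OF sub finite_configs] by auto
    show "\<forall>ds\<in>?D. \<forall>ds'\<in>?D. ds \<noteq> ds' \<longrightarrow> ?ch ds \<inter> ?ch ds' = {}"
    proof (intro ballI impI)
      fix ds ds' assume ds: "ds \<in> ?D" "ds' \<in> ?D" "ds \<noteq> ds'"
      then obtain i where "i < n" "ds ! i \<noteq> ds' ! i"
        by (auto simp: list_eq_iff_nth_eq)
      then show "?ch ds \<inter> ?ch ds' = {}"
        by (auto simp: choices_def)
    qed
  qed (fact fin)
  also have "(\<Union>ds\<in>?D. ?ch ds) = configs k n d"
  proof
    show "configs k n d \<subseteq> (\<Union>ds\<in>?D. ?ch ds)"
    proof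
      fix C assume C: "C \<in> configs k n d"
      then have "map (\<lambda>i. length (C i)) [0..<n] \<in> ?D"
        by (simp add: configs_def interv_sum_list_conv_sum_set_nat atLeast0LessThan)
      moreover have "C \<in> ?ch (map (\<lambda>i. length (C i)) [0..<n])"
        using C by (auto simp: choices_def configs_def)
      ultimately show "C \<in> (\<Union>ds\<in>?D. ?ch ds)" by blast
    qed
  qed (use sub in blast)
  finally show ?thesis using assms by (simp add: tensor_trace_def)
qed

section \<open>Hypertrees\<close>

lemma finite_hyperedges: "uniform k H \<Longrightarrow> finite (hyperedges H)"
  by (rule finite_subset [of _ "Pow (verts H)"]) (auto simp: uniform_def verts_def)

lemma finite_hyperedge: "\<lbrakk>uniform k H; e \<in> hyperedges H\<rbrakk> \<Longrightarrow> finite e"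
  by (rule finite_subset [of _ "verts H"]) (auto simp: uniform_def verts_def)

text \<open>The union of \<open>F\<close> is closed under adjacency and hence contains everything
  reachable. The lemma is mostly used contrapositively: a nonempty proper subset of the hyperedges
  is met by a hyperedge outside of it.\<close>

lemma connected_hg_closed:
  assumes "uniform k H" "k \<ge> 1" "connected_hg H" "F \<subseteq> hyperedges H" "F \<noteq> {}"
    and closed: "\<And>f. \<lbrakk>f \<in> hyperedges H; f \<inter> \<Union>F \<noteq> {}\<rbrakk> \<Longrightarrow> f \<in> F"
  shows "F = hyperedges H" "\<Union>F = verts H"
proof -
  have ne: "f \<noteq> {}" "f \<subseteq> verts H" if "f \<in> hyperedges H" for f
    using that assms by (auto simp: uniform_def)
  obtain u where u: "u \<in> \<Union>F" "u \<in> verts H"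
    using assms(4,5) ne by blast
  have "v \<in> \<Union>F" if "(u, v) \<in> (adj H)\<^sup>*" for v
    using that
  proof induction
    case (step y z)
    then obtain f where "f \<in> hyperedges H" "y \<in> f" "z \<in> f" by (auto simp: adj_def)
    with step.IH closed [of f] show ?case by blast
  qed (use u in simp)
  then have "verts H \<subseteq> \<Union>F"
    using assms(3) u by (auto simp: connected_hg_def)
  moreover have "\<Union>F \<subseteq> verts H" using assms(4) ne by blast
  ultimately show U: "\<Union>F = verts H" by blast
  show "F = hyperedges H"
  proof (intro subset_antisym assms(4) subsetI)
    fix f assume f: "f \<in> hyperedges H"
    then have "f \<inter> \<Union>F \<noteq> {}" using ne [of f] U by blast
    then show "f \<in> F" using closed f by blast
  qed
qed

section \<open>Berge paths and the number of vertices of a hypertree\<close>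

definition berge_path :: "nat set set \<Rightarrow> nat list \<Rightarrow> nat set list \<Rightarrow> bool" where
  "berge_path F vs es \<longleftrightarrow> length vs = Suc (length es) \<and> distinct vs \<and> distinct es \<and> set es \<subseteq> F \<and>
     (\<forall>i<length es. vs ! i \<in> es ! i \<and> vs ! Suc i \<in> es ! i)"

definition berge_joined :: "nat set set \<Rightarrow> nat \<Rightarrow> nat \<Rightarrow> bool" where
  "berge_joined F u w \<longleftrightarrow> (\<exists>vs es. berge_path F vs es \<and> hd vs = u \<and> last vs = w)"

lemma berge_joined_refl: "berge_joined F u u"
  unfolding berge_joined_def berge_path_def
  by (intro exI [of _ "[u]"] exI [of _ "[]"]) simp

lemma berge_joined_sym: "berge_joined F u w \<Longrightarrow> berge_joined F w u"
proof -
  assume "berge_joined F u w"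
  then obtain vs es where p: "berge_path F vs es" "hd vs = u" "last vs = w"
    by (auto simp: berge_joined_def)
  have "berge_path F (rev vs) (rev es)"
    using p(1) by (auto simp: berge_path_def rev_nth Suc_diff_Suc) (metis Suc_diff_Suc diff_less_Suc less_SucE diff_Suc_less Suc_lessD diff_less_mono2 lessI zero_less_Suc not_less_eq)+
  then show ?thesis
    using p by (auto simp: berge_joined_def hd_rev last_rev intro!: exI [of _ "rev vs"])
qed

lemma berge_path_verts:
  assumes "berge_path F vs es" "last vs \<in> \<Union>F"
  shows "set vs \<subseteq> \<Union>F"
proof
  fix v assume "v \<in> set vs"
  then obtain i where i: "i < length vs" "v = vs ! i" by (auto simp: in_set_conv_nth)
  show "v \<in> \<Union>F"
  proof (cases "i < length es")
    case True
    then show ?thesis using assms i by (auto simp: berge_path_def) (metis nth_mem subsetD)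
  next
    case False
    then have "i = length vs - 1" "vs \<noteq> []" using assms i by (auto simp: berge_path_def)
    then show ?thesis using assms i by (simp add: last_conv_nth)
  qed
qed

lemma berge_joined_extend:
  assumes "berge_joined F u x" "f \<notin> F" "x \<in> \<Union>F" "x \<in> f" "w \<in> f" "w \<notin> \<Union>F"
  shows "berge_joined (insert f F) u w"
proof -
  obtain vs es where p: "berge_path F vs es" "hd vs = u" "last vs = x"
    using assms by (auto simp: berge_joined_def)
  have ne: "vs \<noteq> []" using p by (auto simp: berge_path_def)
  have "w \<notin> set vs" using berge_path_verts [OF p(1)] p assms by auto
  moreover have "vs ! length es = x" using p ne by (simp add: berge_path_def last_conv_nth)
  ultimately have "berge_path (insert f F) (vs @ [w]) (es @ [f])"
    using p(1) assms by (auto simp: berge_path_def nth_append less_Suc_eq)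
  then show ?thesis
    using p ne by (auto simp: berge_joined_def intro!: exI [of _ "vs @ [w]"])
qed

text \<open>The new hyperedge \<open>f\<close> leads from \<open>w\<close> back to \<open>u\<close>.
  The distinctness in a Berge path is what \<open>is_cycle\<close> asks for, and
  \<open>u \<noteq> w\<close> guarantees a hyperedge besides \<open>f\<close>, hence length at least
  2.\<close>

lemma berge_joined_cycle:
  assumes "berge_joined F u w" "u \<noteq> w" "f \<notin> F" "u \<in> f" "w \<in> f" "insert f F \<subseteq> hyperedges H"
  shows "\<exists>vs es. is_cycle H vs es"
proof -
  obtain vs es where p: "berge_path F vs es" "hd vs = u" "last vs = w"
    using assms by (auto simp: berge_joined_def)
  have ne: "vs \<noteq> []" using p by (auto simp: berge_path_def)
  then have l: "vs ! 0 = u" "vs ! length es = w"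
    using p by (auto simp: berge_path_def hd_conv_nth last_conv_nth)
  then have "es \<noteq> []" using assms by auto
  moreover have "Suc i mod Suc (length es) = Suc i" if "i < length es" for i
    using that by simp
  ultimately have "is_cycle H vs (es @ [f])"
    using p(1) assms l
    by (auto simp: is_cycle_def berge_path_def nth_append less_Suc_eq Suc_le_eq)
  then show ?thesis by blast
qed

lemma hypertree_linear:
  assumes "hypertree H" "e \<in> hyperedges H" "f \<in> hyperedges H" "e \<noteq> f" "u \<in> e \<inter> f" "w \<in> e \<inter> f"
  shows "u = w"
proof (rule ccontr)
  assume "u \<noteq> w"
  then have "is_cycle H [u, w] [e, f]"
    using assms by (auto simp: is_cycle_def nth_Cons' less_Suc_eq)
  then show False using assms by (auto simp: hypertree_def)
qed

text \<open>Hyperedges are added one at a time. By connectedness one of the remaining ones meets the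
  union, and it does so in one vertex only, since a second common vertex would close a Berge path
  into a cycle; so each step adds \<open>k - 1\<close> vertices. Joinedness is part of the induction
  for the sake of this argument.\<close>

lemma hypertree_grow:
  assumes H: "H \<in> hypertrees k m" and k: "k \<ge> 2" and j: "j \<ge> 1" "j \<le> m"
  shows "\<exists>F\<subseteq>hyperedges H. card F = j \<and> card (\<Union>F) = j * (k - 1) + 1 \<and>
    (\<forall>u\<in>\<Union>F. \<forall>w\<in>\<Union>F. berge_joined F u w)"
  using j
proof (induction j rule: nat_induct_at_least)
  case base
  from H k have u: "uniform k H" "hypertree H" "card (hyperedges H) = m" by (auto simp: hypertrees_def)
  then obtain e where e: "e \<in> hyperedges H" using base by fastforce
  have "berge_joined {e} u w" if "u \<in> e" "w \<in> e" for u w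
  proof (cases "u = w")
    case False
    then have "berge_path {e} [u, w] [e]" using that by (auto simp: berge_path_def)
    then show ?thesis by (auto simp: berge_joined_def intro!: exI [of _ "[u, w]"])
  qed (simp add: berge_joined_refl)
  moreover have "card e = 1 * (k - 1) + 1" using e u k by (auto simp: uniform_def)
  ultimately show ?case using e by (intro exI [of _ "{e}"]) auto
next
  case (Suc j)
  obtain F where F: "F \<subseteq> hyperedges H" "card F = j" "card (\<Union>F) = j * (k - 1) + 1"
    and joined: "\<And>u w. u \<in> \<Union>F \<Longrightarrow> w \<in> \<Union>F \<Longrightarrow> berge_joined F u w"
    using Suc.IH Suc_leD [OF Suc.prems] by blast
  from H k have u: "uniform k H" "hypertree H" "card (hyperedges H) = m" by (auto simp: hypertrees_def)
  have "F \<noteq> {}" using F Suc by auto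
  moreover have "F \<noteq> hyperedges H" using F u Suc by auto
  ultimately obtain f where f: "f \<in> hyperedges H" "f \<inter> \<Union>F \<noteq> {}" "f \<notin> F"
    using connected_hg_closed(1) [of k H F] u k F by (auto simp: hypertree_def)
  then obtain x where x: "x \<in> f" "x \<in> \<Union>F" by auto
  have fx: "f \<inter> \<Union>F = {x}"
  proof (rule ccontr)
    assume "f \<inter> \<Union>F \<noteq> {x}"
    then obtain y where "y \<in> f" "y \<in> \<Union>F" "x \<noteq> y" using x by auto
    then have "\<exists>vs es. is_cycle H vs es"
      using joined x f F by (intro berge_joined_cycle [of F x y f]) auto
    then show False using u by (auto simp: hypertree_def)
  qed
  have fin: "finite f" "finite (\<Union>F)" "finite F"
    using f F u finite_hyperedge [of k H] finite_subset [OF F(1) finite_hyperedges [OF u(1)]] by auto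
  have "card (f \<union> \<Union>F) + 1 = card f + card (\<Union>F)"
    using card_Un_Int [OF fin(1,2)] fx by simp
  moreover have "card f = k" using f u by (auto simp: uniform_def)
  ultimately have card: "card (\<Union>(insert f F)) = Suc j * (k - 1) + 1"
    using F k by simp
  have ext: "berge_joined (insert f F) u w" if "u \<in> \<Union>F" "w \<in> f" "w \<notin> \<Union>F" for u w
    using berge_joined_extend [OF joined [OF that(1) x(2)]] f x that by blast
  have mono: "berge_joined F u w \<Longrightarrow> berge_joined (insert f F) u w" for u w
    by (auto simp: berge_joined_def berge_path_def)
  have "berge_joined (insert f F) u w" if uw: "u \<in> \<Union>(insert f F)" "w \<in> \<Union>(insert f F)" for u w
  proof -
    consider "u \<in> \<Union>F" "w \<in> \<Union>F" | "u \<in> \<Union>F" "w \<in> f - \<Union>F" | "w \<in> \<Union>F" "u \<in> f - \<Union>F"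
      | "u \<in> f" "w \<in> f" using uw by blast
    then show ?thesis
    proof cases
      case 4
      show ?thesis
      proof (cases "u = w")
        case False
        then have "berge_path {f} [u, w] [f]" using 4 by (auto simp: berge_path_def)
        then have "berge_path (insert f F) [u, w] [f]" by (auto simp: berge_path_def)
        then show ?thesis by (auto simp: berge_joined_def intro!: exI [of _ "[u, w]"])
      qed (simp add: berge_joined_refl)
    qed (use joined mono ext berge_joined_sym in auto)
  qed
  moreover have "card (insert f F) = Suc j" using F fin f by simp
  ultimately show ?case
    using card F f by (intro exI [of _ "insert f F"]) blast
qed

lemma hypertree_nverts:
  assumes "H \<in> hypertrees k m" "k \<ge> 2" "m \<ge> 1"
  shows "\<Union>(hyperedges H) = verts H" "nverts H = m * (k - 1) + 1"
proof -
  from assms have u: "uniform k H" "hypertree H" "card (hyperedges H) = m" by (auto simp: hypertrees_def)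
  have "hyperedges H \<noteq> {}" using u assms by auto
  then show *: "\<Union>(hyperedges H) = verts H"
    using u assms connected_hg_closed(2) [of k H "hyperedges H"] by (auto simp: hypertree_def)
  obtain F where F: "F \<subseteq> hyperedges H" "card F = m" "card (\<Union>F) = m * (k - 1) + 1"
    using hypertree_grow [OF assms order_refl] by auto
  then have "F = hyperedges H"
    using u finite_hyperedges by (intro card_subset_eq) auto
  with F * show "nverts H = m * (k - 1) + 1" by (simp add: verts_def)
qed

section \<open>Double counting of degrees\<close>

lemma sum_degree:
  fixes g :: "nat \<Rightarrow> 'a::comm_semiring_1"
  assumes "uniform k H"
  shows "(\<Sum>v<nverts H. of_nat (degree H v) * g v) = (\<Sum>e\<in>hyperedges H. \<Sum>v\<in>e. g v)"
proof -
  have fin: "finite (hyperedges H)" by (rule finite_hyperedges [OF assms])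
  have "(\<Sum>v<nverts H. of_nat (degree H v) * g v) =
      (\<Sum>v<nverts H. \<Sum>e\<in>hyperedges H. if v \<in> e then g v else 0)"
    by (rule sum.cong) (auto simp: degree_def fin simp flip: sum.inter_filter)
  also have "\<dots> = (\<Sum>e\<in>hyperedges H. \<Sum>v<nverts H. if v \<in> e then g v else 0)"
    by (rule sum.swap)
  also have "\<dots> = (\<Sum>e\<in>hyperedges H. \<Sum>v\<in>e. g v)"
  proof (rule sum.cong)
    fix e assume "e \<in> hyperedges H"
    then have "{v \<in> {..<nverts H}. v \<in> e} = e" using assms by (auto simp: uniform_def verts_def)
    then show "(\<Sum>v<nverts H. if v \<in> e then g v else 0) = (\<Sum>v\<in>e. g v)"
      by (simp flip: sum.inter_filter)
  qed simp
  finally show ?thesis .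
qed

lemma sum_degree_hypertree:
  assumes "H \<in> hypertrees k m"
  shows "(\<Sum>v<nverts H. degree H v) = m * k"
  using sum_degree [of k H "\<lambda>_. 1::nat"] assms
  by (simp add: hypertrees_def uniform_def)

lemma degree_pos:
  assumes "H \<in> hypertrees k m" "k \<ge> 2" "m \<ge> 1" "v < nverts H"
  shows "degree H v \<ge> 1"
proof -
  have "v \<in> \<Union>(hyperedges H)" using hypertree_nverts(1) [OF assms(1-3)] assms(4) by (simp add: verts_def)
  then have "{e \<in> hyperedges H. v \<in> e} \<noteq> {}" by auto
  moreover have "finite (hyperedges H)" using assms finite_hyperedges by (auto simp: hypertrees_def)
  ultimately show ?thesis by (simp add: degree_def Suc_le_eq card_gt_0_iff)
qed

definition branching :: "hypergraph \<Rightarrow> nat set \<Rightarrow> nat" where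
  "branching H e = card {v \<in> e. degree H v = 2}"

text \<open>The degrees sum to \<open>m * k\<close>, which exceeds the number
  \<open>m * (k - 1) + 1\<close> of vertices by \<open>m - 1\<close>; with degrees 1 and 2 this
  excess counts the vertices of degree 2.\<close>

lemma degree_two_count:
  assumes "H \<in> hypertrees k m" "k \<ge> 2" "m \<ge> 1" "\<And>v. v < nverts H \<Longrightarrow> degree H v \<le> 2"
  shows "card {v \<in> {..<nverts H}. degree H v = 2} + 1 = m"
proof -
  have d: "degree H v = 1 \<or> degree H v = 2" if "v < nverts H" for v
    using degree_pos [OF assms(1-3) that] assms(4) [OF that] by linarith
  have "m * k = (\<Sum>v<nverts H. 1 + (if degree H v = 2 then 1 else 0))"
    unfolding sum_degree_hypertree [OF assms(1), symmetric]
    by (rule sum.cong) (use d in auto)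
  also have "\<dots> = nverts H + card {v \<in> {..<nverts H}. degree H v = 2}"
    by (simp only: sum.distrib sum.inter_filter [symmetric] finite_lessThan) simp
  finally have "m * k = m * (k - 1) + 1 + card {v \<in> {..<nverts H}. degree H v = 2}"
    using hypertree_nverts(2) [OF assms(1-3)] by linarith
  moreover have "m * k = m * (k - 1) + m" using assms(2) by (cases k) auto
  ultimately show ?thesis by simp
qed

text \<open>Each of the \<open>m - 1\<close> vertices of degree 2 is counted in both of its
  hyperedges.\<close>

lemma sum_branching:
  assumes "H \<in> hypertrees k m" "k \<ge> 2" "m \<ge> 1" "\<And>v. v < nverts H \<Longrightarrow> degree H v \<le> 2"
  shows "(\<Sum>e\<in>hyperedges H. branching H e) + 2 = 2 * m"
proof -
  have u: "uniform k H" using assms by (simp add: hypertrees_def)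
  have "(\<Sum>e\<in>hyperedges H. branching H e) = (\<Sum>e\<in>hyperedges H. \<Sum>v\<in>e. if degree H v = 2 then 1 else 0)"
    by (rule sum.cong) (auto simp: branching_def finite_hyperedge [OF u] simp flip: sum.inter_filter)
  also have "\<dots> = (\<Sum>v<nverts H. degree H v * (if degree H v = 2 then 1 else 0))"
    using sum_degree [OF u, of "\<lambda>v. if degree H v = 2 then 1 else (0::nat)"] by simp
  also have "\<dots> = (\<Sum>v<nverts H. if degree H v = 2 then 2 else 0)"
    by (rule sum.cong) auto
  also have "\<dots> = 2 * card {v \<in> {..<nverts H}. degree H v = 2}"
    by (simp flip: sum.inter_filter)
  finally show ?thesis using degree_two_count [OF assms] by simp
qed

subsection \<open>The hyperpath\<close>

text \<open>The second alternative is the common vertex of two consecutive blocks, seen from the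
  earlier one. Writing it as \<open>j + 1 = v div (k - 1)\<close> instead of subtracting keeps
  vertex 0 from getting a spurious predecessor.\<close>

lemma in_path_edge:
  fixes j k v :: nat
  assumes "k \<ge> 2"
  shows "v \<in> {j * (k - 1)..(j + 1) * (k - 1)} \<longleftrightarrow> j = v div (k - 1) \<or> (v mod (k - 1) = 0 \<and> j + 1 = v div (k - 1))"
proof -
  define q r where "q = v div (k - 1)" and "r = v mod (k - 1)"
  have v: "v = q * (k - 1) + r" unfolding q_def r_def by (rule div_mult_mod_eq [symmetric])
  have r: "r < k - 1" using assms by (simp add: r_def)
  have "q * (k - 1) + r \<in> {j * (k - 1)..(j + 1) * (k - 1)} \<longleftrightarrow> j = q \<or> (r = 0 \<and> j + 1 = q)"
  proof
    assume *: "q * (k - 1) + r \<in> {j * (k - 1)..(j + 1) * (k - 1)}"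
    then have "j * (k - 1) \<le> q * (k - 1) + r" by simp
    also have "\<dots> < q * (k - 1) + (k - 1)" using r by simp
    finally have "j * (k - 1) < (q + 1) * (k - 1)" by (simp add: add.commute)
    then have "j < q + 1" by (metis mult_less_cancel2)
    moreover have "q * (k - 1) \<le> (j + 1) * (k - 1)" using * by simp
    then have "q \<le> j + 1" using r by (subst (asm) mult_le_cancel2) auto
    ultimately consider "q = j" | "q = j + 1" by linarith
    then show "j = q \<or> (r = 0 \<and> j + 1 = q)"
      using * by cases auto
  next
    assume "j = q \<or> (r = 0 \<and> j + 1 = q)"
    then show "q * (k - 1) + r \<in> {j * (k - 1)..(j + 1) * (k - 1)}"
      using r by auto
  qed
  from this [folded v] show ?thesis by (simp only: q_def r_def)
qed

lemma path_edge_inj: "k \<ge> 2 \<Longrightarrow> inj (\<lambda>j. {j * (k - 1)..(j + 1) * (k - 1)})" for k :: nat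
proof (rule injI)
  fix i j :: nat
  assume k: "k \<ge> 2" and "{i * (k - 1)..(i + 1) * (k - 1)} = {j * (k - 1)..(j + 1) * (k - 1)}"
  then have "i * (k - 1) = j * (k - 1)" by (subst (asm) Icc_eq_Icc) auto
  then show "i = j" using k by simp
qed

lemma path_edge_common:
  fixes i j k v :: nat
  assumes "k \<ge> 2" "v \<in> {i * (k - 1)..(i + 1) * (k - 1)}" "v \<in> {j * (k - 1)..(j + 1) * (k - 1)}" "i < j"
  shows "v = j * (k - 1)" "j = i + 1"
proof -
  have "j * (k - 1) \<le> (i + 1) * (k - 1)" using assms(2,3) by auto
  then have "j \<le> i + 1" using assms(1) by (subst (asm) mult_le_cancel2) auto
  then show "j = i + 1" using assms(4) by simp
  then show "v = j * (k - 1)" using assms(2,3) by auto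
qed

text \<open>In a cycle, consider the hyperedge with the largest index. Both cyclic neighbours come
  earlier on the path, so they can meet it only in its first vertex; but a cycle passes through two
  different vertices of each of its hyperedges.\<close>

lemma hyperpath_acyclic:
  assumes "k \<ge> 2"
  shows "\<not> is_cycle (hyperpath k m) vs es"
proof
  let ?e = "\<lambda>j::nat. {j * (k - 1)..(j + 1) * (k - 1)}"
  assume c: "is_cycle (hyperpath k m) vs es"
  define l where "l = length es"
  have l: "length vs = l" "length es = l" "l \<ge> 2" "distinct vs" "distinct es"
    using c by (auto simp: is_cycle_def l_def)
  have "\<exists>j. es ! i = ?e j" if "i < l" for i
  proof -
    have "es ! i \<in> hyperedges (hyperpath k m)"
      using c l that nth_mem [of i es] by (auto simp: is_cycle_def)
    then show ?thesis by (auto simp: hyperpath_def)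
  qed
  then obtain J where J: "\<And>i. i < l \<Longrightarrow> es ! i = ?e (J i)" by metis
  have vert: "vs ! i \<in> ?e (J i)" "vs ! (Suc i mod l) \<in> ?e (J i)" if "i < l" for i
    using c J that by (auto simp: is_cycle_def l_def)
  have neq: "J i \<noteq> J i'" if "i < l" "i' < l" "i \<noteq> i'" for i i'
    using J [OF that(1)] J [OF that(2)] that l by (metis nth_eq_iff_index_eq)
  have "Max (J ` {..<l}) \<in> J ` {..<l}" using l(3) by (intro Max_in) (auto simp: lessThan_empty_iff)
  then obtain p where p: "p < l" "J p = Max (J ` {..<l})" by auto
  have less: "J i < J p" if "i < l" "i \<noteq> p" for i
  proof -
    have "J i \<le> J p" unfolding p(2) using that by (intro Max_ge) auto
    then show ?thesis using neq [OF that(1) p(1) that(2)] by simp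
  qed
  \<comment> \<open>The cyclic predecessor of \<open>p\<close>, whose hyperedge also contains
    \<open>vs ! p\<close>.\<close>
  define q where "q = (if p = 0 then l - 1 else p - 1)"
  have q: "q < l" "q \<noteq> p" "Suc q mod l = p" using p l by (auto simp: q_def)
  have "vs ! p = J p * (k - 1)"
    using path_edge_common(1) [OF assms vert(2) [OF q(1)] _ less [OF q(1,2)]] vert(1) [OF p(1)] q by simp
  \<comment> \<open>The cyclic successor of \<open>p\<close>; for \<open>l = 2\<close> it coincides
    with \<open>q\<close>, which does no harm.\<close>
  moreover define s where "s = Suc p mod l"
  have s: "s < l" "s \<noteq> p"
    using p l by (auto simp: s_def mod_Suc)
  have "vs ! s = J p * (k - 1)"
    using path_edge_common(1) [OF assms vert(1) [OF s(1)] _ less [OF s]] vert(2) [OF p(1)] by (simp add: s_def)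
  ultimately show False
    using s p l by (metis nth_eq_iff_index_eq)
qed

lemma hyperpath_connected:
  assumes "k \<ge> 2" "m \<ge> 1"
  shows "connected_hg (hyperpath k m)"
proof -
  let ?H = "hyperpath k m"
  have sym: "sym ((adj ?H)\<^sup>*)"
    by (intro sym_rtrancl) (auto simp: sym_def adj_def)
  have base: "(0, j * (k - 1)) \<in> (adj ?H)\<^sup>*" if "j \<le> m" for j
    using that
  proof (induction j)
    case (Suc j)
    have "(j * (k - 1), Suc j * (k - 1)) \<in> adj ?H"
      using Suc.prems by (auto simp: adj_def hyperpath_def intro!: bexI [of _ j])
    with Suc show ?case by (meson Suc_leD rtrancl.rtrancl_into_rtrancl)
  qed simp
  have zero: "(0, v) \<in> (adj ?H)\<^sup>*" if v: "v \<in> verts ?H" for v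
  \<comment> \<open>The last vertex has quotient \<open>m\<close>, which is not the index of a
    hyperedge.\<close>
  proof (cases "v = m * (k - 1)")
    case False
    then have "v < m * (k - 1)" using v by (simp add: verts_def hyperpath_def)
    then have q: "v div (k - 1) < m" by (simp add: less_mult_imp_div_less)
    have "v \<in> {v div (k - 1) * (k - 1)..(v div (k - 1) + 1) * (k - 1)}"
      using in_path_edge [OF assms(1), of v "v div (k - 1)"] by blast
    then have "(v div (k - 1) * (k - 1), v) \<in> adj ?H"
      using q by (auto simp: adj_def hyperpath_def intro!: bexI [of _ "v div (k - 1)"])
    with base [of "v div (k - 1)"] q show ?thesis by (meson less_imp_le rtrancl.rtrancl_into_rtrancl)
  qed (use base in simp)
  show ?thesis
    unfolding connected_hg_def using zero sym by (meson rtrancl_trans symD)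
qed

lemma hyperpath_in_hypertrees:
  assumes "k \<ge> 2" "m \<ge> 1"
  shows "hyperpath k m \<in> hypertrees k m"
proof -
  have "uniform k (hyperpath k m)"
    unfolding uniform_def
  proof
    fix e assume "e \<in> hyperedges (hyperpath k m)"
    then obtain j where j: "j < m" "e = {j * (k - 1)..(j + 1) * (k - 1)}" by (auto simp: hyperpath_def)
    have "(j + 1) * (k - 1) \<le> m * (k - 1)" using j by (intro mult_le_mono1) simp
    then show "e \<subseteq> verts (hyperpath k m) \<and> card e = k"
      using j assms by (auto simp: verts_def hyperpath_def)
  qed
  moreover have "card (hyperedges (hyperpath k m)) = m"
    using path_edge_inj [OF assms(1)] by (simp add: hyperpath_def card_image inj_on_subset)
  ultimately show ?thesis
    using hyperpath_connected [OF assms] hyperpath_acyclic [OF assms(1)]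
    by (simp add: hypertrees_def hypertree_def)
qed

lemma hyperpath_degree_le:
  assumes "k \<ge> 2"
  shows "degree (hyperpath k m) v \<le> 2"
proof -
  let ?e = "\<lambda>j::nat. {j * (k - 1)..(j + 1) * (k - 1)}"
  have "{e \<in> hyperedges (hyperpath k m). v \<in> e} \<subseteq> ?e ` {v div (k - 1), v div (k - 1) - 1}"
  proof
    fix e assume "e \<in> {e \<in> hyperedges (hyperpath k m). v \<in> e}"
    moreover from this obtain j where j: "e = ?e j" by (auto simp: hyperpath_def)
    ultimately have "j = v div (k - 1) \<or> j = v div (k - 1) - 1"
      using in_path_edge [OF assms, of v j] by auto
    with j show "e \<in> ?e ` {v div (k - 1), v div (k - 1) - 1}" by blast
  qed
  then have "degree (hyperpath k m) v \<le> card (?e ` {v div (k - 1), v div (k - 1) - 1})"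
    unfolding degree_def by (rule card_mono [rotated]) simp
  also have "\<dots> \<le> card {v div (k - 1), v div (k - 1) - 1}" by (rule card_image_le) simp
  also have "\<dots> \<le> 2" by (simp add: card_insert_if)
  finally show ?thesis .
qed

lemma degree_geI:
  assumes "uniform k H" "e \<in> hyperedges H" "f \<in> hyperedges H" "e \<noteq> f" "v \<in> e" "v \<in> f"
  shows "degree H v \<ge> 2"
proof -
  have "card {e, f} \<le> degree H v"
    unfolding degree_def using assms finite_hyperedges [OF assms(1)] by (intro card_mono) auto
  then show ?thesis using assms by simp
qed

lemma hyperpath_branching:
  assumes "k \<ge> 2" "m \<ge> 2" "e \<in> hyperedges (hyperpath k m)"
  shows "branching (hyperpath k m) e \<in> {1, 2}"
proof -
  let ?e = "\<lambda>j::nat. {j * (k - 1)..(j + 1) * (k - 1)}"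
  let ?H = "hyperpath k m"
  have u: "uniform k ?H" using hyperpath_in_hypertrees [of k m] assms by (simp add: hypertrees_def)
  obtain j where j: "j < m" "e = ?e j" using assms by (auto simp: hyperpath_def)
  have fin: "finite {v \<in> e. degree ?H v = 2}" using j by simp
  have "{v \<in> e. degree ?H v = 2} \<subseteq> {j * (k - 1), (j + 1) * (k - 1)}"
  proof
    fix v assume v: "v \<in> {v \<in> e. degree ?H v = 2}"
    have "\<not> {f \<in> hyperedges ?H. v \<in> f} \<subseteq> {e}"
    proof
      assume "{f \<in> hyperedges ?H. v \<in> f} \<subseteq> {e}"
      then have "degree ?H v \<le> card {e}" unfolding degree_def by (intro card_mono) auto
      with v show False by simp
    qed
    then obtain f where f: "f \<in> hyperedges ?H" "v \<in> f" "f \<noteq> e" by blast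
    then obtain i where "i < m" "f = ?e i" by (auto simp: hyperpath_def)
    with f j have i: "i < m" "v \<in> ?e i" "i \<noteq> j" by auto
    then show "v \<in> {j * (k - 1), (j + 1) * (k - 1)}"
      using path_edge_common [OF assms(1), of v i j] path_edge_common [OF assms(1), of v j i] v j
      by (cases "i < j") auto
  qed
  then have "card {v \<in> e. degree ?H v = 2} \<le> card {j * (k - 1), (j + 1) * (k - 1)}"
    by (intro card_mono) auto
  also have "\<dots> \<le> 2" by (simp add: card_insert_if)
  finally have 1: "branching ?H e \<le> 2" by (simp add: branching_def)
  \<comment> \<open>A neighbouring hyperedge exists since \<open>m \<ge> 2\<close>: the preceding
    one or, for the first hyperedge, the second. The two share the first vertex of the later
    one.\<close>
  define i where "i = (if j = 0 then 1 else j - 1)"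
  define v where "v = max i j * (k - 1)"
  have i: "i < m" "i \<noteq> j" using assms j by (auto simp: i_def)
  have v: "v \<in> ?e i" "v \<in> ?e j" by (cases j; auto simp: v_def i_def)+
  have "degree ?H v \<ge> 2"
  proof (rule degree_geI [OF u])
    show "?e i \<in> hyperedges ?H" "?e j \<in> hyperedges ?H" using i j by (auto simp: hyperpath_def)
    show "?e i \<noteq> ?e j" using path_edge_inj [OF assms(1)] i(2) by (auto dest: injD)
  qed (use v in auto)
  then have "degree ?H v = 2" using hyperpath_degree_le [OF assms(1), of m v] by simp
  then have "{v \<in> e. degree ?H v = 2} \<noteq> {}" using v j by blast
  then have "branching ?H e \<noteq> 0" using fin by (simp add: branching_def)
  with 1 show ?thesis by auto
qed

section \<open>Recognising the hyperpath by degrees and branching numbers\<close>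

lemma card_le_1_singleton:
  assumes "finite A" "card A \<le> 1" "A \<noteq> {}"
  shows "\<exists>y. A = {y}"
proof -
  have "card A = 1" using assms by (simp add: le_Suc_eq)
  then show ?thesis by (rule card_1_singletonE) blast
qed

text \<open>\<open>f\<close> lays out the first \<open>j\<close> hyperedges of the path in
  \<open>H\<close>. The last conjunct is the invariant that drives the induction: further hyperedges
  can pass only through the final vertex \<open>f (j * (k - 1))\<close>, so the next one has to
  continue the path there. Because of \<open>branching H e \<le> 2\<close>, a new hyperedge has at
  most one vertex of degree 2 besides its entry vertex; placing it last restores the
  invariant.\<close>

lemma isomorphic_hyperpath_aux:
  assumes H: "H \<in> hypertrees k m" and k: "k \<ge> 2" and deg: "\<And>v. v < nverts H \<Longrightarrow> degree H v \<le> 2"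
    and br: "\<And>e. e \<in> hyperedges H \<Longrightarrow> branching H e \<le> 2"
    and j: "j \<ge> 1" "j \<le> m"
  shows "\<exists>f. inj_on f {0..j * (k - 1)} \<and>
    (\<forall>i<j. f ` {i * (k - 1)..(i + 1) * (k - 1)} \<in> hyperedges H) \<and>
    (\<forall>x<j * (k - 1). \<forall>e\<in>hyperedges H. f x \<in> e \<longrightarrow> (\<exists>i<j. e = f ` {i * (k - 1)..(i + 1) * (k - 1)}))"
proof -
  from H have u: "uniform k H" "hypertree H" "card (hyperedges H) = m" by (auto simp: hypertrees_def)
  have m: "m \<ge> 1" using j by simp
  have fin: "finite e" if "e \<in> hyperedges H" for e using finite_hyperedge [OF u(1) that] .
  have fE: "finite (hyperedges H)" by (rule finite_hyperedges [OF u(1)])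
  have card: "card e = k" if "e \<in> hyperedges H" for e using u that by (auto simp: uniform_def)
  have vert: "v < nverts H" if "v \<in> e" "e \<in> hyperedges H" for v e
    using u that by (auto simp: uniform_def verts_def)
  have unique: "f = e" if "v \<in> e" "e \<in> hyperedges H" "degree H v \<noteq> 2" "v \<in> f" "f \<in> hyperedges H" for v e f
  proof (rule ccontr)
    assume "f \<noteq> e"
    then have "degree H v \<ge> 2" using that by (intro degree_geI [OF u(1), of f e]) auto
    then show False using deg [OF vert [OF that(1,2)]] that(3) by simp
  qed
  show ?thesis
    using j
  proof (induction j rule: nat_induct_at_least)
    case base
    \<comment> \<open>The branching numbers sum to \<open>2 * m - 2\<close>, so they cannot all be
      at least 2, and the path can start at an end hyperedge.\<close>
    have "\<exists>e\<in>hyperedges H. branching H e \<le> 1"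
    proof (rule ccontr)
      assume "\<not> ?thesis"
      then have "(\<Sum>e\<in>hyperedges H. 2) \<le> (\<Sum>e\<in>hyperedges H. branching H e)"
        by (intro sum_mono) auto
      then show False using sum_branching [OF H k m deg] u by simp
    qed
    then obtain e where e: "e \<in> hyperedges H" "branching H e \<le> 1" by auto
    \<comment> \<open>\<open>y\<close> is the vertex of degree 2 if there is one and arbitrary
      otherwise. It becomes the final vertex, the only one through which other hyperedges may
      pass.\<close>
    have "\<exists>y\<in>e. {v \<in> e. degree H v = 2} \<subseteq> {y}"
    proof (cases "{v \<in> e. degree H v = 2} = {}")
      case True
      have "e \<noteq> {}" using card [OF e(1)] k by auto
      then show ?thesis using True by auto
    next
      case False
      moreover have "finite {v \<in> e. degree H v = 2}" using fin [OF e(1)] by simp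
      ultimately obtain y where "{v \<in> e. degree H v = 2} = {y}"
        using e(2) card_le_1_singleton unfolding branching_def by metis
      then show ?thesis by blast
    qed
    then obtain y where y: "y \<in> e" "\<And>v. \<lbrakk>v \<in> e; v \<noteq> y\<rbrakk> \<Longrightarrow> degree H v \<noteq> 2" by blast
    have "card {0..<k - 1} = card (e - {y})" using card [OF e(1)] y fin [OF e(1)] by simp
    then obtain g where g: "bij_betw g {0..<k - 1} (e - {y})"
      using fin [OF e(1)] by (metis finite_Diff finite_atLeastLessThan finite_same_card_bij)
    define f where "f = g(k - 1 := y)"
    have img: "f ` {0..k - 1} = e"
    proof -
      have "{0..k - 1} = insert (k - 1) {0..<k - 1}" by auto
      moreover have "f ` {0..<k - 1} = g ` {0..<k - 1}" by (intro image_cong) (auto simp: f_def)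
      ultimately have "f ` {0..k - 1} = insert (f (k - 1)) (g ` {0..<k - 1})" by (metis image_insert)
      then show ?thesis using g y(1) by (auto simp: f_def bij_betw_def)
    qed
    have inj: "inj_on f {0..k - 1}"
      using card [OF e(1)] k img by (intro eq_card_imp_inj_on) auto
    have closed: "e' = e" if "x < k - 1" "e' \<in> hyperedges H" "f x \<in> e'" for x e'
    proof -
      have "f x = g x" "g x \<in> e - {y}" using that(1) g by (auto simp: f_def bij_betw_def)
      then show ?thesis using unique [of "f x" e e'] y that e by auto
    qed
    have img': "f ` {i * (k - 1)..(i + 1) * (k - 1)} = e" if "i < 1" for i
      using img that by simp
    show ?case
    proof (intro exI [of _ f] conjI allI impI ballI)
      show "inj_on f {0..1 * (k - 1)}" using inj by simp
      show "f ` {i * (k - 1)..(i + 1) * (k - 1)} \<in> hyperedges H" if "i < 1" for i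
        unfolding img' [OF that] by (rule e)
      show "\<exists>i<1. e' = f ` {i * (k - 1)..(i + 1) * (k - 1)}"
        if "x < 1 * (k - 1)" "e' \<in> hyperedges H" "f x \<in> e'" for x e'
        using closed [of x e'] that img' [of 0] by (intro exI [of _ 0]) simp
    qed
  next
    case (Suc j)
    let ?e = "\<lambda>j. {j * (k - 1)..(j + 1) * (k - 1)}"
    obtain f where IH: "inj_on f {0..j * (k - 1)} \<and> (\<forall>i<j. f ` ?e i \<in> hyperedges H) \<and>
        (\<forall>x<j * (k - 1). \<forall>e\<in>hyperedges H. f x \<in> e \<longrightarrow> (\<exists>i<j. e = f ` ?e i))"
      by (rule exE [OF Suc.IH [OF Suc_leD [OF Suc.prems]]])
    then have f: "inj_on f {0..j * (k - 1)}" "\<And>i. i < j \<Longrightarrow> f ` ?e i \<in> hyperedges H"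
      by simp_all
    have closed: "\<exists>i<j. e = f ` ?e i" if "x < j * (k - 1)" "e \<in> hyperedges H" "f x \<in> e" for x e
      using IH that by simp
    define F where "F = (\<lambda>i. f ` ?e i) ` {..<j}"
    have F: "F \<subseteq> hyperedges H" "F \<noteq> {}" using f(2) Suc.hyps by (auto simp: F_def lessThan_empty_iff)
    have "card F \<le> j" unfolding F_def using card_image_le [of "{..<j}"] by simp
    then have "F \<noteq> hyperedges H" using u Suc.prems by auto
    then obtain e where e: "e \<in> hyperedges H" "e \<notin> F" "e \<inter> \<Union>F \<noteq> {}"
      using connected_hg_closed(1) [of k H F] u F k by (auto simp: hypertree_def)
    have sub: "?e i \<subseteq> {0..j * (k - 1)}" if "i < j" for i
    proof -
      have "(i + 1) * (k - 1) \<le> j * (k - 1)" using that by (intro mult_le_mono1) simp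
      then show ?thesis by auto
    qed
    \<comment> \<open>By the invariant, a hyperedge outside \<open>F\<close> can meet the part laid
      out so far only in its final vertex \<open>z\<close>.\<close>
    define z where "z = f (j * (k - 1))"
    have common: "v = z" if v: "v \<in> e" "v \<in> f ` {0..j * (k - 1)}" for v
    proof -
      obtain x where x: "x \<le> j * (k - 1)" "v = f x" using v by auto
      have "\<not> x < j * (k - 1)" using closed [of x e] e x v by (auto simp: F_def)
      then show ?thesis using x by (simp add: z_def)
    qed
    obtain v where "v \<in> e" "v \<in> \<Union>F" using e by blast
    moreover have "\<Union>F \<subseteq> f ` {0..j * (k - 1)}" using sub by (fastforce simp: F_def)
    ultimately have z: "z \<in> e" using common by blast
    have e': "f ` ?e (j - 1) \<in> hyperedges H" "f ` ?e (j - 1) \<noteq> e" "z \<in> f ` ?e (j - 1)"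
    proof -
      have "j - 1 < j" using Suc.hyps by simp
      then show "f ` ?e (j - 1) \<in> hyperedges H" by (rule f(2))
      have "f ` ?e (j - 1) \<in> F" unfolding F_def using \<open>j - 1 < j\<close> by (intro imageI) simp
      then show "f ` ?e (j - 1) \<noteq> e" using e by blast
      show "z \<in> f ` ?e (j - 1)" unfolding z_def using Suc.hyps by (intro imageI) simp
    qed
    have "degree H z \<ge> 2" using e' e z by (intro degree_geI [OF u(1), of "f ` ?e (j - 1)" e]) auto
    then have degz: "degree H z = 2" using deg [OF vert [OF z e(1)]] by simp
    \<comment> \<open>\<open>z\<close> lies on the last hyperedge laid out and on \<open>e\<close>,
      and degree 2 leaves no room for a third. This extends the invariant to \<open>z\<close>, which
      is no longer final.\<close>
    have z_edges: "e'' = e \<or> e'' = f ` ?e (j - 1)" if "e'' \<in> hyperedges H" "z \<in> e''" for e''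
    proof (rule ccontr)
      assume *: "\<not> ?thesis"
      have "card {e'', e, f ` ?e (j - 1)} \<le> degree H z"
        unfolding degree_def using that e e' z fE by (intro card_mono) auto
      moreover have "card {e'', e, f ` ?e (j - 1)} = 3" using * e' by auto
      ultimately show False using degz by simp
    qed
    have "\<exists>y\<in>e - {z}. {v \<in> e. degree H v = 2} \<subseteq> {z, y}"
    proof (cases "{v \<in> e. degree H v = 2} - {z} = {}")
      case True
      have "card (e - {z}) = k - 1" using card [OF e(1)] z fin [OF e(1)] by simp
      then have "e - {z} \<noteq> {}" using k by (metis card.empty diff_is_0_eq not_less_eq_eq numeral_2_eq_2 One_nat_def)
      then show ?thesis using True by auto
    next
      case False
      have "finite {v \<in> e. degree H v = 2}" "z \<in> {v \<in> e. degree H v = 2}" using fin [OF e(1)] z degz by auto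
      then have "card ({v \<in> e. degree H v = 2} - {z}) \<le> 1"
        using br [OF e(1)] by (simp add: branching_def card_Diff_singleton)
      moreover have "finite ({v \<in> e. degree H v = 2} - {z})" using fin [OF e(1)] by simp
      ultimately obtain y where "{v \<in> e. degree H v = 2} - {z} = {y}"
        using False card_le_1_singleton by metis
      then show ?thesis by blast
    qed
    then obtain y where y: "y \<in> e" "y \<noteq> z" "\<And>v. \<lbrakk>v \<in> e; v \<noteq> z; v \<noteq> y\<rbrakk> \<Longrightarrow> degree H v \<noteq> 2" by blast
    have "card {j * (k - 1)<..<(j + 1) * (k - 1)} = k - 2" by simp
    moreover have "card (e - {z, y}) = k - 2" using card [OF e(1)] y z fin [OF e(1)] by (simp add: card_Diff_subset)
    ultimately obtain g where g: "bij_betw g {j * (k - 1)<..<(j + 1) * (k - 1)} (e - {z, y})"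
      using fin [OF e(1)] by (metis finite_Diff finite_greaterThanLessThan finite_same_card_bij)
    define h where "h x = (if x \<le> j * (k - 1) then f x else if x = (j + 1) * (k - 1) then y else g x)" for x
    have hf: "h ` S = f ` S" if "S \<subseteq> {0..j * (k - 1)}" for S
      using that by (intro image_cong) (auto simp: h_def)
    have "?e j = {j * (k - 1), (j + 1) * (k - 1)} \<union> {j * (k - 1)<..<(j + 1) * (k - 1)}" by auto
    moreover have "h ` {j * (k - 1)<..<(j + 1) * (k - 1)} = e - {z, y}"
      using g by (auto simp: h_def bij_betw_def)
    moreover have "\<not> (j + 1) * (k - 1) \<le> j * (k - 1)" using k by auto
    then have "h (j * (k - 1)) = z" "h ((j + 1) * (k - 1)) = y" by (simp_all only: h_def z_def order_refl simp_thms if_True if_False)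
    ultimately have img: "h ` ?e j = e" using z y by auto
    have inj_e: "inj_on h (?e j)" using card [OF e(1)] k img by (intro eq_card_imp_inj_on) auto
    have inj_f: "inj_on h {0..j * (k - 1)}" using f(1) by (auto simp: inj_on_def h_def)
    have "inj_on h ({0..j * (k - 1)} \<union> ?e j)"
    proof (rule inj_onI)
      \<comment> \<open>The old and the new part can share a value only at \<open>z\<close>, whose
        position \<open>j * (k - 1)\<close> belongs to both ranges.\<close>
      have sep: "x = x'" if "x \<in> {0..j * (k - 1)}" "x' \<in> ?e j" "h x = h x'" for x x'
      proof -
        have "h x \<in> e" using that img by auto
        moreover have "h x \<in> f ` {0..j * (k - 1)}"
          using imageI [OF that(1), of h] unfolding hf [OF order_refl] .
        ultimately have "h x = z" using common by blast
        then have "h x = h (j * (k - 1))" by (simp add: h_def z_def)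
        moreover have "j * (k - 1) \<in> {0..j * (k - 1)}" "j * (k - 1) \<in> ?e j" by auto
        ultimately have "x = j * (k - 1)" "x' = j * (k - 1)"
          using that inj_onD [OF inj_f, of x "j * (k - 1)"] inj_onD [OF inj_e, of x' "j * (k - 1)"] by metis+
        then show ?thesis by simp
      qed
      fix x x' assume "x \<in> {0..j * (k - 1)} \<union> ?e j" "x' \<in> {0..j * (k - 1)} \<union> ?e j" "h x = h x'"
      then show "x = x'"
        using sep [of x x'] sep [of x' x] inj_onD [OF inj_f, of x x'] inj_onD [OF inj_e, of x x']
        by (metis UnE)
    qed
    moreover have "{0..j * (k - 1)} \<union> ?e j = {0..Suc j * (k - 1)}" by auto
    ultimately have inj: "inj_on h {0..Suc j * (k - 1)}" by simp
    have edges: "h ` ?e i = f ` ?e i" if "i < j" for i using hf [OF sub [OF that]] .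
    have "\<exists>i<Suc j. e'' = h ` ?e i" if x: "x < Suc j * (k - 1)" and e'': "e'' \<in> hyperedges H" "h x \<in> e''" for x e''
    proof -
      consider "x < j * (k - 1)" | "x = j * (k - 1)" | "x \<in> {j * (k - 1)<..<(j + 1) * (k - 1)}"
        using x by fastforce
      then show ?thesis
      proof cases
        case 1
        then have "f x \<in> e''" using e'' by (simp add: h_def)
        with closed [OF 1 e''(1)] edges show ?thesis by (metis less_SucI)
      next
        case 2
        then have "z \<in> e''" using e'' by (simp add: h_def z_def)
        with z_edges [OF e''(1)] edges [of "j - 1"] img Suc.hyps show ?thesis
          by (metis Suc_le_lessD diff_less lessI less_SucI zero_less_one One_nat_def)
      next
        case 3
        then have "h x = g x" by (simp add: h_def)
        moreover have "g x \<in> e - {z, y}" using 3 g by (auto simp: bij_betw_def)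
        ultimately have "e'' = e" using unique [of "h x" e e''] y e e'' by auto
        then show ?thesis using img by blast
      qed
    qed
    moreover have "h ` ?e i \<in> hyperedges H" if "i < Suc j" for i
      using that edges [of i] f(2) [of i] img e by (cases "i = j") auto
    ultimately show ?case using inj by blast
  qed
qed

text \<open>With all \<open>m\<close> hyperedges laid out, injectivity of \<open>f\<close> yields
  \<open>m\<close> distinct hyperedges of \<open>H\<close>, hence all of them.\<close>

lemma isomorphic_hyperpath:
  assumes H: "H \<in> hypertrees k m" and k: "k \<ge> 2" and m: "m \<ge> 1"
    and deg: "\<And>v. v < nverts H \<Longrightarrow> degree H v \<le> 2"
    and br: "\<And>e. e \<in> hyperedges H \<Longrightarrow> branching H e \<le> 2"
  shows "isomorphic (hyperpath k m) H"
proof -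
  let ?P = "hyperpath k m"
  obtain f where f: "inj_on f {0..m * (k - 1)}"
      "\<And>i. i < m \<Longrightarrow> f ` {i * (k - 1)..(i + 1) * (k - 1)} \<in> hyperedges H"
    using isomorphic_hyperpath_aux [OF H k deg br m order_refl] by blast
  have P: "?P \<in> hypertrees k m" by (rule hyperpath_in_hypertrees [OF k m])
  have vP: "verts ?P = {0..m * (k - 1)}" by (auto simp: verts_def hyperpath_def)
  have fE: "finite (hyperedges H)" using H finite_hyperedges by (auto simp: hypertrees_def)
  have sub: "(\<lambda>e. f ` e) ` hyperedges ?P \<subseteq> hyperedges H"
    using f(2) by (auto simp: hyperpath_def)
  have "inj_on (\<lambda>e. f ` e) (hyperedges ?P)"
  proof (rule inj_on_subset [OF inj_on_image_Pow])
    show "inj_on f (verts ?P)" using f vP by simp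
    show "hyperedges ?P \<subseteq> Pow (verts ?P)" using P by (auto simp: hypertrees_def uniform_def)
  qed
  then have "card ((\<lambda>e. f ` e) ` hyperedges ?P) = card (hyperedges H)"
    using P H by (simp add: card_image hypertrees_def)
  then have edges: "(\<lambda>e. f ` e) ` hyperedges ?P = hyperedges H"
    using sub fE by (intro card_subset_eq) auto
  have "f ` verts ?P = \<Union>(hyperedges H)"
    unfolding edges [symmetric] hypertree_nverts(1) [OF P k m, symmetric] by blast
  then have "bij_betw f (verts ?P) (verts H)"
    using f(1) vP hypertree_nverts(1) [OF H k m] by (simp add: bij_betw_def)
  then show ?thesis using edges by (auto simp: isomorphic_def)
qed

section \<open>Configurations contributing to the traces of a hypertree\<close>

lemma image_mset_sum_lessThan: "image_mset f (\<Sum>i<n. g i) = (\<Sum>i<(n::nat). image_mset f (g i))"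
  by (induction n) auto

lemma size_filter_mset_sum_lessThan:
  "size (filter_mset P (\<Sum>i<n. g i)) = (\<Sum>i<(n::nat). size (filter_mset P (g i)))"
  by (induction n) auto

lemma mset_rotate1: "mset (rotate1 xs) = mset xs"
  by (cases xs) auto

lemma image_mset_fst_cyc_arcs: "image_mset fst (cyc_arcs ws) = mset ws"
  by (simp add: cyc_arcs_def map_fst_zip flip: mset_map)

lemma image_mset_snd_cyc_arcs: "image_mset snd (cyc_arcs ws) = mset ws"
  by (simp add: cyc_arcs_def map_snd_zip mset_rotate1 flip: mset_map)

text \<open>Used with membership in a set as \<open>P\<close>: if no arc crosses the border of the
  set, a closed walk that meets the set stays inside.\<close>

lemma cyc_arcs_invariant:
  assumes inv: "\<And>x y. (x, y) \<in># cyc_arcs ws \<Longrightarrow> P x = P y" and xy: "x \<in> set ws" "y \<in> set ws"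
  shows "P x = P y"
proof -
  have step: "P (ws ! i) = P (ws ! (Suc i mod length ws))" if "i < length ws" for i
  proof (rule inv)
    have "zip ws (rotate1 ws) ! i \<in> set (zip ws (rotate1 ws))" using that by (intro nth_mem) simp
    then show "(ws ! i, ws ! (Suc i mod length ws)) \<in># cyc_arcs ws"
      using that by (simp add: cyc_arcs_def nth_rotate1)
  qed
  have "P (ws ! i) = P (ws ! 0)" if "i < length ws" for i
    using that
  proof (induction i)
    case (Suc i)
    then show ?case using step [of i] by simp
  qed simp
  then show ?thesis using xy by (metis in_set_conv_nth)
qed

lemma sum_size_filter_fst:
  assumes "finite X"
  shows "(\<Sum>v\<in>X. size {#b \<in># B. fst b = v#}) = size {#b \<in># B. fst b \<in> X#}"
  using assms
proof (induction X)
  case (insert x X)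
  have "{#b \<in># B. fst b \<in> insert x X#} = {#b \<in># B. fst b = x#} + {#b \<in># B. fst b \<in> X#}"
    using insert.hyps by (intro multiset_eqI) auto
  then show ?case using insert by simp
qed simp

text \<open>The multiset \<open>B\<close> records the pairs (root, hyperedge); the hypothesis \<open>balance\<close> says that
  the arcs from the roots to the other vertices of their hyperedges have equal in- and outdegrees.\<close>

lemma balanced_roots_single_edge:
  fixes B :: "(nat \<times> nat set) multiset"
  assumes k: "k \<ge> 3" and E: "\<And>v e. (v, e) \<in># B \<Longrightarrow> v \<in> e \<and> finite e \<and> card e = k"
    and linear: "\<And>v w e f u x. \<lbrakk>(v, e) \<in># B; (w, f) \<in># B; e \<noteq> f; u \<in> e \<inter> f; x \<in> e \<inter> f\<rbrakk> \<Longrightarrow> u = x"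
    and balance: "\<And>v. k * size {#b \<in># B. fst b = v#} = size {#b \<in># B. v \<in> snd b#}"
    and size: "size B \<le> k + 2" and v0: "(v0, e) \<in># B"
  shows "count B (v, f) = (if f = e \<and> v \<in> e then 1 else 0)"
proof -
  let ?r = "\<lambda>v. size {#b \<in># B. fst b = v#}"
  \<comment> \<open>At a vertex of a used hyperedge the right-hand side of \<open>balance\<close> is
    positive, so the vertex is itself a root.\<close>
  have pos: "?r x \<ge> 1" if "(w, f) \<in># B" "x \<in> f" for w f x
  proof -
    have "(w, f) \<in># {#b \<in># B. x \<in> snd b#}" using that by simp
    then have "size {#b \<in># B. x \<in> snd b#} \<noteq> 0" by (metis empty_iff set_mset_empty size_eq_0_iff_empty)
    then show ?thesis using balance [of x] by (cases "?r x") auto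
  qed
  have le: "(\<Sum>x\<in>X. ?r x) \<le> size B" if "finite X" for X
    unfolding sum_size_filter_fst [OF that] by (rule size_filter_mset_lesseq)
  have e: "finite e" "card e = k" using E [OF v0] by auto
  have only: "f = e" if f: "(w, f) \<in># B" for w f
  proof (rule ccontr)
    assume "f \<noteq> e"
    have fin: "finite f" "card f = k" using E [OF f] by auto
    \<comment> \<open>Two hyperedges have at least \<open>2 * k - 1\<close> vertices together, all
      of them roots. With at most \<open>k + 2\<close> pairs this leaves only \<open>k = 3\<close>,
      with exactly five vertices and five pairs.\<close>
    have "card (e \<inter> f) \<le> 1"
      using linear [OF v0 f \<open>f \<noteq> e\<close> [symmetric]] e(1) by (intro card_le_Suc0_iff_eq [THEN iffD2, simplified One_nat_def [symmetric]]) auto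
    then have card: "card (e \<union> f) \<ge> 2 * k - 1"
      using card_Un_Int [OF e(1) fin(1)] e fin by simp
    have r1: "?r x \<ge> 1" if "x \<in> e \<union> f" for x using that pos [OF v0] pos [OF f] by blast
    have "card (e \<union> f) \<le> (\<Sum>x\<in>e \<union> f. ?r x)"
      using sum_mono [of "e \<union> f" "\<lambda>_. 1" ?r] r1 by simp
    then have *: "2 * k - 1 \<le> k + 2" using card le [of "e \<union> f"] size e fin by simp
    then have k3: "k = 3" using k by simp
    have eq: "card (e \<union> f) = 5" "size B = 5"
      using card le [of "e \<union> f"] size e fin k3 \<open>card (e \<union> f) \<le> (\<Sum>x\<in>e \<union> f. ?r x)\<close> by simp_all
    have out: "?r x = 0" if "x \<notin> e \<union> f" for x
    proof -
      have "(\<Sum>y\<in>insert x (e \<union> f). ?r y) \<le> 5" using le [of "insert x (e \<union> f)"] eq e fin by simp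
      moreover have "(\<Sum>y\<in>insert x (e \<union> f). ?r y) = ?r x + (\<Sum>y\<in>e \<union> f. ?r y)"
        using that e fin by simp
      ultimately show ?thesis using \<open>card (e \<union> f) \<le> (\<Sum>x\<in>e \<union> f. ?r x)\<close> eq by linarith
    qed
    have one: "?r x = 1" if "x \<in> e \<union> f" for x
    proof -
      have "(\<Sum>y\<in>e \<union> f. ?r y) = ?r x + (\<Sum>y\<in>e \<union> f - {x}. ?r y)"
        using that e fin by (intro sum.remove) auto
      moreover have "(\<Sum>y\<in>e \<union> f - {x}. 1) \<le> (\<Sum>y\<in>e \<union> f - {x}. ?r y)"
        by (intro sum_mono) (use r1 in auto)
      moreover have "card (e \<union> f - {x}) = 4" using that eq e fin by simp
      moreover have "(\<Sum>y\<in>e \<union> f. ?r y) \<le> 5" using le [of "e \<union> f"] eq e fin by simp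
      ultimately show ?thesis using r1 [OF that] by simp
    qed
    \<comment> \<open>A third hyperedge would lie within \<open>e \<union> f\<close>, but by
      linearity it shares at most one vertex with each of the two, and it has three.\<close>
    have two: "g = e \<or> g = f" if g: "(u, g) \<in># B" for u g
    proof (rule ccontr)
      assume *: "\<not> ?thesis"
      have gk: "finite g" "card g = 3" using E [OF g] k3 by auto
      have "g \<subseteq> e \<union> f" using pos [OF g] out by fastforce
      then have "card g \<le> card ((g \<inter> e) \<union> (g \<inter> f))" using gk by (intro card_mono) auto
      also have "\<dots> \<le> card (g \<inter> e) + card (g \<inter> f)" by (rule card_Un_le)
      also have "card (g \<inter> e) \<le> 1"
        using linear [OF g v0] * gk(1) by (intro card_le_Suc0_iff_eq [THEN iffD2, simplified One_nat_def [symmetric]]) auto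
      also have "card (g \<inter> f) \<le> 1"
        using linear [OF g f] * gk(1) by (intro card_le_Suc0_iff_eq [THEN iffD2, simplified One_nat_def [symmetric]]) auto
      finally show False using gk by simp
    qed
    \<comment> \<open>A vertex of \<open>g\<close> outside \<open>h\<close> is a root exactly once,
      so balance there counts three pairs with hyperedge \<open>g\<close>. The same holds with
      \<open>g\<close> and \<open>h\<close> exchanged, which makes six pairs instead of
      five.\<close>
    have three: "size {#b \<in># B. snd b = g#} = 3" if "g = e \<and> h = f \<or> g = f \<and> h = e" for g h
    proof -
      have "card (g \<union> h) = 5" "card h = 3" using that eq e fin k3 by (auto simp: Un_commute)
      then have "\<not> g \<subseteq> h" by (auto simp: Un_absorb1)
      then obtain x where x: "x \<in> g" "x \<notin> h" by blast
      have "{#b \<in># B. x \<in> snd b#} = {#b \<in># B. snd b = g#}"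
        using two x that by (intro filter_mset_cong refl) (metis prod.collapse)
      then show ?thesis using balance [of x] one [of x] x that k3 by auto
    qed
    have "{#b \<in># B. snd b \<noteq> e#} = {#b \<in># B. snd b = f#}"
      using two \<open>f \<noteq> e\<close> by (intro filter_mset_cong refl) (metis prod.collapse)
    then have "B = {#b \<in># B. snd b = e#} + {#b \<in># B. snd b = f#}"
      using multiset_partition [of B "\<lambda>b. snd b = e"] by simp
    then have "size B = size {#b \<in># B. snd b = e#} + size {#b \<in># B. snd b = f#}"
      by (metis size_union)
    then show False using three [of e f] three [of f e] eq by simp
  qed
  have cnt: "count B (v, e) = ?r v" for v
  proof -
    have "{#b \<in># B. fst b = v#} = {#b \<in># B. b = (v, e)#}"
      using only by (intro filter_mset_cong refl) (metis prod.collapse fst_conv)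
    then show ?thesis by (simp add: filter_eq_replicate_mset)
  qed
  show ?thesis
  proof (cases "f = e \<and> v \<in> e")
    case True
    \<comment> \<open>With a single hyperedge left, balance reads \<open>k * ?r v = size B\<close>,
      and \<open>k + 2 < 2 * k\<close> bounds the multiplicity by 1.\<close>
    have "{#b \<in># B. v \<in> snd b#} = B"
      using only True by (intro filter_mset_eq_conv [THEN iffD2]) auto
    then have *: "k * ?r v = size B" using balance [of v] by simp
    have "?r v < 2"
    proof (rule ccontr)
      assume "\<not> ?r v < 2"
      then have "k * 2 \<le> k * ?r v" by (intro mult_le_mono2) simp
      then show False using * size k by simp
    qed
    then show ?thesis using pos [OF v0, of v] True cnt [of v] by simp
  next
    case False
    then have "(v, f) \<notin># B" using only E by blast
    then show ?thesis using False by (simp add: not_in_iff)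
  qed
qed

text \<open>The two parts of the tensor never overlap: a diagonal index involves one vertex only, a
  hyperedge has \<open>k \<ge> 2\<close>.\<close>

lemma alpha_tensor_tail:
  assumes "uniform k H" "k \<ge> 2" "\<gamma> \<in> tails k n"
  shows "alpha_tensor \<alpha> k H (i # \<gamma>) =
    (if \<gamma> = replicate (k - 1) i then \<alpha> * real (degree H i)
     else if insert i (set \<gamma>) \<in> hyperedges H then (1 - \<alpha>) / fact (k - 1) else 0)"
proof -
  have len: "length \<gamma> = k - 1" using assms by (simp add: tails_def)
  have rep: "i # \<gamma> = replicate k i \<longleftrightarrow> \<gamma> = replicate (k - 1) i"
    using assms(2) by (cases k) auto
  have *: "insert i (set (replicate (k - 1) i)) = {i}" by auto
  have "{i} \<notin> hyperedges H" using assms by (auto simp: uniform_def)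
  then have "insert i (set \<gamma>) \<notin> hyperedges H" if "\<gamma> = replicate (k - 1) i" unfolding that * .
  then show ?thesis
    using len assms(2) by (auto simp: alpha_tensor_def degree_tensor_def adj_tensor_def rep)
qed

definition valid_tail :: "nat \<Rightarrow> hypergraph \<Rightarrow> nat \<Rightarrow> nat list \<Rightarrow> bool" where
  "valid_tail k H i \<gamma> \<longleftrightarrow> \<gamma> = replicate (k - 1) i \<or>
     (distinct (i # \<gamma>) \<and> length \<gamma> = k - 1 \<and> insert i (set \<gamma>) \<in> hyperedges H)"

text \<open>Diagonal tails are left out since their arcs are loops, which do not affect
  balance.\<close>

definition root_edges :: "nat \<Rightarrow> nat \<Rightarrow> (nat \<Rightarrow> nat list list) \<Rightarrow> (nat \<times> nat set) multiset" where
  "root_edges k n C = (\<Sum>i<n. mset (map (\<lambda>\<gamma>. (i, insert i (set \<gamma>))) (filter (\<lambda>\<gamma>. \<gamma> \<noteq> replicate (k - 1) i) (C i))))"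

lemma valid_tailI:
  assumes "uniform k H" "k \<ge> 2" "\<gamma> \<in> tails k n" "alpha_tensor \<alpha> k H (i # \<gamma>) \<noteq> 0"
  shows "valid_tail k H i \<gamma>"
proof -
  have len: "length \<gamma> = k - 1" using assms by (simp add: tails_def)
  show ?thesis
  proof (cases "\<gamma> = replicate (k - 1) i")
    case False
    then have e: "set (i # \<gamma>) \<in> hyperedges H"
      using assms(4) unfolding alpha_tensor_tail [OF assms(1-3)] by (simp split: if_splits)
    then have "card (set (i # \<gamma>)) = k" using assms(1) by (auto simp: uniform_def)
    then have "distinct (i # \<gamma>)" using len assms(2) by (intro card_distinct) simp
    then show ?thesis using e len by (simp add: valid_tail_def)
  qed (simp add: valid_tail_def)
qed

text \<open>A tail taken from a hyperedge lists all its vertices but the root. Adding the root's own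
  occurrence on the left turns occurrence of \<open>v\<close> in the tail into membership of
  \<open>v\<close> in the hyperedge, without any subtraction. A diagonal tail consists of
  \<open>k - 1\<close> copies of its root.\<close>

lemma count_concat_valid:
  assumes "\<And>\<gamma>. \<gamma> \<in> set \<Gamma> \<Longrightarrow> valid_tail k H i \<gamma>"
  shows "count (mset (concat \<Gamma>)) v + (if i = v then length (filter (\<lambda>\<gamma>. \<gamma> \<noteq> replicate (k - 1) i) \<Gamma>) else 0) =
    (if i = v then (k - 1) * length (filter (\<lambda>\<gamma>. \<gamma> = replicate (k - 1) i) \<Gamma>) else 0) +
    length (filter (\<lambda>\<gamma>. v \<in> insert i (set \<gamma>)) (filter (\<lambda>\<gamma>. \<gamma> \<noteq> replicate (k - 1) i) \<Gamma>))"
  using assms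
proof (induction \<Gamma>)
  case (Cons \<gamma> \<Gamma>)
  have "count (mset \<gamma>) v + (if i = v \<and> \<gamma> \<noteq> replicate (k - 1) i then 1 else 0) =
      (if i = v \<and> \<gamma> = replicate (k - 1) i then k - 1 else 0) +
      (if \<gamma> \<noteq> replicate (k - 1) i \<and> v \<in> insert i (set \<gamma>) then 1 else 0)"
  proof (cases "\<gamma> = replicate (k - 1) i")
    case False
    then have "distinct (i # \<gamma>)" using Cons.prems [of \<gamma>] by (auto simp: valid_tail_def)
    then have "count (mset \<gamma>) v = (if v \<in> set \<gamma> then 1 else 0)" "i \<notin> set \<gamma>"
      using distinct_count_atmost_1 [of \<gamma>] by auto
    then show ?thesis using False by auto
  qed simp
  with Cons show ?case by (auto split: if_splits)
qed simp

lemma configs_tails: "\<lbrakk>C \<in> configs k n d; \<gamma> \<in> set (C i)\<rbrakk> \<Longrightarrow> \<gamma> \<in> tails k n"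
  by (auto simp: configs_def)

lemma count_fst_config_arcs:
  assumes "C \<in> configs k n d" "v < n"
  shows "count (image_mset fst (config_arcs n C)) v = length (C v) * (k - 1)"
proof -
  have "image_mset fst (mset (root_arcs i (C i))) = replicate_mset (length (C i) * (k - 1)) i" for i
  proof -
    have "map fst (root_arcs i (C i)) = replicate (length (C i) * (k - 1)) i"
      using assms length_root_arcs [of "C i" k n i]
      by (intro replicate_eqI) (auto simp: configs_def root_arcs_def)
    then show ?thesis by (simp flip: mset_map)
  qed
  then show ?thesis
    using assms(2) by (simp add: config_arcs_def image_mset_sum_lessThan count_sum)
qed

lemma image_mset_snd_root_arcs: "image_mset snd (mset (root_arcs i \<Gamma>)) = mset (concat \<Gamma>)"
  by (induction \<Gamma>) (simp_all add: root_arcs_def o_def flip: mset_map)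

text \<open>A closed walk leaves \<open>v\<close> exactly \<open>k - 1\<close> times per tail rooted
  there and enters it as counted by \<open>count_concat_valid\<close>. The diagonal tails cancel. If
  \<open>r\<close> tails at \<open>v\<close> are not diagonal, adding \<open>r\<close> to both sides
  turns \<open>(k - 1) * r\<close> into \<open>k * r\<close>.\<close>

lemma root_edges_balance:
  assumes C: "C \<in> configs k n d" and valid: "\<And>i \<gamma>. \<gamma> \<in> set (C i) \<Longrightarrow> valid_tail k H i \<gamma>"
    and walk: "walks n (config_arcs n C) \<noteq> {}" and k: "k \<ge> 2" and uni: "uniform k H" and n: "n = nverts H"
  shows "k * size {#b \<in># root_edges k n C. fst b = v#} = size {#b \<in># root_edges k n C. v \<in> snd b#}"
proof -
  let ?R = "\<lambda>i. filter (\<lambda>\<gamma>. \<gamma> \<noteq> replicate (k - 1) i) (C i)"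
  let ?L = "\<lambda>i. filter (\<lambda>\<gamma>. \<gamma> = replicate (k - 1) i) (C i)"
  let ?N = "\<lambda>i. length (filter (\<lambda>\<gamma>. v \<in> insert i (set \<gamma>)) (?R i))"
  have N: "size {#b \<in># root_edges k n C. v \<in> snd b#} = (\<Sum>i<n. ?N i)"
    unfolding root_edges_def size_filter_mset_sum_lessThan
    by (rule sum.cong) (simp_all add: filter_map o_def mset_filter [symmetric] del: mset_map mset_filter)
  have "size {#b \<in># root_edges k n C. fst b = v#} = (\<Sum>i<n. if i = v then length (?R i) else 0)"
    unfolding root_edges_def size_filter_mset_sum_lessThan
    by (rule sum.cong) (auto simp: filter_map o_def mset_filter [symmetric] simp del: mset_map mset_filter)
  then have R: "size {#b \<in># root_edges k n C. fst b = v#} = (if v < n then length (?R v) else 0)"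
    by simp
  show ?thesis
  proof (cases "v < n")
    case True
    obtain ws where "cyc_arcs ws = config_arcs n C" using walk by (auto simp: walks_def)
    then have "image_mset fst (config_arcs n C) = image_mset snd (config_arcs n C)"
      by (metis image_mset_fst_cyc_arcs image_mset_snd_cyc_arcs)
    then have "length (C v) * (k - 1) = count (image_mset snd (config_arcs n C)) v"
      using count_fst_config_arcs [OF C True] by simp
    also have "\<dots> = (\<Sum>i<n. count (mset (concat (C i))) v)"
      by (simp add: config_arcs_def image_mset_sum_lessThan count_sum image_mset_snd_root_arcs del: mset_concat)
    finally have "length (C v) * (k - 1) + length (?R v) =
        (\<Sum>i<n. count (mset (concat (C i))) v + (if i = v then length (?R i) else 0))"
      using True by (simp add: sum.distrib del: mset_concat)
    also have "\<dots> = (\<Sum>i<n. (if i = v then (k - 1) * length (?L i) else 0) + ?N i)"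
      using count_concat_valid [of "C i" k H i v for i] valid by (intro sum.cong) auto
    also have "\<dots> = (k - 1) * length (?L v) + (\<Sum>i<n. ?N i)"
      using True by (simp add: sum.distrib)
    finally have "length (C v) * (k - 1) + length (?R v) = (k - 1) * length (?L v) + (\<Sum>i<n. ?N i)" .
    moreover have "length (C v) = length (?L v) + length (?R v)"
      using sum_length_filter_compl [of "\<lambda>\<gamma>. \<gamma> = replicate (k - 1) v" "C v"] by simp
    ultimately have "length (?R v) * (k - 1) + length (?R v) = (\<Sum>i<n. ?N i)"
      by (simp add: algebra_simps)
    moreover have "length (?R v) * (k - 1) + length (?R v) = k * length (?R v)"
      using k by (cases k) auto
    ultimately show ?thesis using N R True by simp
  next
    case False
    have "?N i = 0" if "i < n" for i
    proof -
      have "v \<notin> insert i (set \<gamma>)" if "\<gamma> \<in> set (C i)" for \<gamma>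
        using configs_tails [OF C that] \<open>i < n\<close> False by (auto simp: tails_def)
      then show ?thesis by (auto simp: filter_empty_conv)
    qed
    then have "(\<Sum>i<n. ?N i) = 0" by simp
    then show ?thesis unfolding N R using False by simp
  qed
qed

section \<open>The two kinds of contributing configurations\<close>

definition loop_config :: "nat \<Rightarrow> nat \<Rightarrow> nat \<Rightarrow> nat \<Rightarrow> nat list list" where
  "loop_config k d v = (\<lambda>i. if i = v then replicate d (replicate (k - 1) v) else [])"

definition edge_configs :: "nat \<Rightarrow> nat \<Rightarrow> nat set \<Rightarrow> nat \<Rightarrow> (nat \<Rightarrow> nat list list) set" where
  "edge_configs k n e d = {C \<in> configs k n d. (\<forall>i. i \<notin> e \<longrightarrow> C i = []) \<and>
     (\<forall>i\<in>e. length (filter (\<lambda>\<gamma>. insert i (set \<gamma>) = e) (C i)) = 1 \<and>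
        (\<forall>\<gamma>\<in>set (C i). insert i (set \<gamma>) = e \<or> \<gamma> = replicate (k - 1) i))}"

lemma in_config_arcs: "(x, y) \<in># config_arcs n C \<longleftrightarrow> x < n \<and> (\<exists>\<gamma>\<in>set (C x). y \<in> set \<gamma>)"
proof -
  have "(x, y) \<in># (\<Sum>i<n. mset (root_arcs i (C i))) \<longleftrightarrow> x < n \<and> (\<exists>\<gamma>\<in>set (C x). y \<in> set \<gamma>)"
    by (induction n) (auto simp: root_arcs_def less_Suc_eq)
  then show ?thesis by (simp add: config_arcs_def)
qed

lemma in_root_edges:
  "(x, f) \<in># root_edges k n C \<longleftrightarrow>
     x < n \<and> (\<exists>\<gamma>\<in>set (C x). \<gamma> \<noteq> replicate (k - 1) x \<and> f = insert x (set \<gamma>))"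
proof -
  have "(x, f) \<in># (\<Sum>i<n. mset (map (\<lambda>\<gamma>. (i, insert i (set \<gamma>))) (filter (\<lambda>\<gamma>. \<gamma> \<noteq> replicate (k - 1) i) (C i)))) \<longleftrightarrow>
     x < n \<and> (\<exists>\<gamma>\<in>set (C x). \<gamma> \<noteq> replicate (k - 1) x \<and> f = insert x (set \<gamma>))"
    by (induction n) (auto simp: less_Suc_eq)
  then show ?thesis by (simp add: root_edges_def)
qed

lemma count_root_edges:
  assumes "x < n"
  shows "count (root_edges k n C) (x, f) =
    length (filter (\<lambda>\<gamma>. insert x (set \<gamma>) = f) (filter (\<lambda>\<gamma>. \<gamma> \<noteq> replicate (k - 1) x) (C x)))"
proof -
  have "count (mset (map (\<lambda>\<gamma>. (i, insert i (set \<gamma>))) xs)) (x, f) =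
      (if i = x then length (filter (\<lambda>\<gamma>. insert x (set \<gamma>) = f) xs) else 0)" for i xs
    by (induction xs) auto
  then show ?thesis
    using assms by (simp add: root_edges_def count_sum del: mset_map mset_filter filter_filter)
qed

lemma size_root_edges:
  assumes "C \<in> configs k n d"
  shows "size (root_edges k n C) \<le> d"
proof -
  have "size (\<Sum>i<n. g i) = (\<Sum>i<n. size (g i))" for n :: nat and g :: "nat \<Rightarrow> (nat \<times> nat set) multiset"
    by (induction n) auto
  then have "size (root_edges k n C) \<le> (\<Sum>i<n. length (C i))"
    unfolding root_edges_def by (auto intro!: sum_mono simp del: mset_map mset_filter)
  then show ?thesis using assms by (simp add: configs_def)
qed

text \<open>Nonzero weight makes every tail valid, and nonzero count supplies a closed walk, which
  passes exactly through the vertices that have tails. If all tails are diagonal, the walk cannot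
  leave its vertex. Otherwise balance leaves a single hyperedge with each of its vertices a root
  once, and the walk cannot leave that hyperedge, which rules out diagonal tails elsewhere.\<close>

lemma config_support:
  assumes uni: "uniform k H" and H: "hypertree H" and k: "k \<ge> 3" and n: "n = nverts H"
    and C: "C \<in> configs k n d" and d: "1 \<le> d" "d \<le> k + 2"
    and weight: "config_weight n (alpha_tensor \<alpha> k H) C \<noteq> 0" and count: "config_count k n C \<noteq> 0"
  shows "(\<exists>v<n. C = loop_config k d v) \<or> (\<exists>e\<in>hyperedges H. C \<in> edge_configs k n e d)"
proof -
  have k2: "k \<ge> 2" using k by simp
  have Cn: "C i = []" if "i \<ge> n" for i using C that by (auto simp: configs_def)
  have valid: "valid_tail k H i \<gamma>" if \<gamma>: "\<gamma> \<in> set (C i)" for i \<gamma>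
  proof (rule valid_tailI [OF uni k2 configs_tails [OF C \<gamma>]])
    have "i < n" using \<gamma> Cn by (cases "i < n") auto
    then have "(\<Prod>\<gamma>\<leftarrow>C i. alpha_tensor \<alpha> k H (i # \<gamma>)) \<noteq> 0"
      using weight by (auto simp: config_weight_def)
    then show "alpha_tensor \<alpha> k H (i # \<gamma>) \<noteq> 0"
      using \<gamma> by (auto simp: prod_list_zero_iff)
  qed
  have walk: "walks n (config_arcs n C) \<noteq> {}"
    using count by (auto simp: config_count_def)
  then obtain ws where ws: "set ws \<subseteq> {..<n}" "cyc_arcs ws = config_arcs n C" by (auto simp: walks_def)
  have mem: "v \<in> set ws \<longleftrightarrow> C v \<noteq> []" for v
  proof (cases "v < n")
    case True
    have "count (mset ws) v = length (C v) * (k - 1)"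
      using count_fst_config_arcs [OF C True] unfolding ws(2) [symmetric] image_mset_fst_cyc_arcs .
    moreover have "v \<in> set ws \<longleftrightarrow> count (mset ws) v \<noteq> 0" by (simp add: count_eq_zero_iff)
    ultimately show ?thesis using k by simp
  qed (use ws Cn in auto)
  have sumC: "(\<Sum>i<n. length (C i)) = d" using C by (simp add: configs_def)
  show ?thesis
  proof (cases "root_edges k n C = {#}")
    case True
    have loop: "\<gamma> = replicate (k - 1) i" if \<gamma>: "\<gamma> \<in> set (C i)" for i \<gamma>
    proof (rule ccontr)
      assume "\<gamma> \<noteq> replicate (k - 1) i"
      moreover have "i < n" using \<gamma> Cn by (cases "i < n") auto
      ultimately have "(i, insert i (set \<gamma>)) \<in># root_edges k n C" using \<gamma> by (auto simp: in_root_edges)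
      then show False using True by simp
    qed
    have "\<exists>v<n. C v \<noteq> []"
    proof (rule ccontr)
      assume "\<not> ?thesis"
      then have "(\<Sum>i<n. length (C i)) = 0" by simp
      then show False using sumC d by simp
    qed
    then obtain v where v: "v < n" "C v \<noteq> []" by blast
    have step: "(x = v) = (y = v)" if "(x, y) \<in># cyc_arcs ws" for x y
      using that loop unfolding ws in_config_arcs by (metis in_set_replicate)
    have "C i = []" if "i \<noteq> v" for i
      using cyc_arcs_invariant [of ws "\<lambda>x. x = v" i v, OF step] that v mem by blast
    moreover from this have "length (C v) = d"
      using sumC v by (simp add: sum.remove [of "{..<n}" v])
    then have "C v = replicate d (replicate (k - 1) v)"
      using loop by (metis replicate_eqI)
    ultimately have "C = loop_config k d v" by (auto simp: loop_config_def)
    then show ?thesis using v by blast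
  next
    case False
    define B where "B = root_edges k n C"
    obtain v0 e where v0: "(v0, e) \<in># B" using False by (auto simp: B_def)
    have BE: "f \<in> hyperedges H" "v \<in> f" if "(v, f) \<in># B" for v f
      using that valid by (auto simp: B_def in_root_edges valid_tail_def)
    have e: "e \<in> hyperedges H" "card e = k" "v0 \<in> e"
      using BE [OF v0] uni by (auto simp: uniform_def)
    have cnt: "count B (v, f) = (if f = e \<and> v \<in> e then 1 else 0)" for v f
    proof (rule balanced_roots_single_edge [OF k _ _ _ _ v0])
      show "v \<in> f \<and> finite f \<and> card f = k" if "(v, f) \<in># B" for v f
        using BE [OF that] uni finite_hyperedge [OF uni] by (auto simp: uniform_def)
      show "u = x" if "(v, f) \<in># B" "(w, g) \<in># B" "f \<noteq> g" "u \<in> f \<inter> g" "x \<in> f \<inter> g" for v w f g u x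
        using hypertree_linear [OF H BE(1) [OF that(1)] BE(1) [OF that(2)] that(3-5)] .
      show "k * size {#b \<in># B. fst b = v#} = size {#b \<in># B. v \<in> snd b#}" for v
        unfolding B_def by (rule root_edges_balance [OF C valid walk k2 uni n])
      show "size B \<le> k + 2" using size_root_edges [OF C] d by (simp add: B_def)
    qed
    have B: "f = e" "v \<in> e" if "(v, f) \<in># B" for v f
      using that cnt [of v f] by (auto simp flip: count_greater_zero_iff split: if_splits)
    have en: "v < n" if "v \<in> e" for v using that e uni n by (auto simp: uniform_def verts_def)
    have tail: "insert i (set \<gamma>) = e \<and> i \<in> e \<or> \<gamma> = replicate (k - 1) i" if \<gamma>: "\<gamma> \<in> set (C i)" for i \<gamma>
    proof (rule disjCI)
      assume "\<gamma> \<noteq> replicate (k - 1) i"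
      moreover have "i < n" using \<gamma> Cn by (cases "i < n") auto
      ultimately have "(i, insert i (set \<gamma>)) \<in># B" using \<gamma> by (auto simp: in_root_edges B_def)
      then show "insert i (set \<gamma>) = e \<and> i \<in> e" using B by blast
    qed
    have "C v0 \<noteq> []" using v0 by (auto simp: B_def in_root_edges)
    have step: "(x \<in> e) = (y \<in> e)" if arc: "(x, y) \<in># cyc_arcs ws" for x y
    proof -
      obtain \<gamma> where \<gamma>: "\<gamma> \<in> set (C x)" "y \<in> set \<gamma>" using arc unfolding ws in_config_arcs by blast
      from tail [OF \<gamma>(1)] show ?thesis
      proof
        assume "insert x (set \<gamma>) = e \<and> x \<in> e"
        then show ?thesis using \<gamma> by blast
      next
        assume "\<gamma> = replicate (k - 1) x"
        then show ?thesis using \<gamma> by simp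
      qed
    qed
    have outside: "C i = []" if "i \<notin> e" for i
      using cyc_arcs_invariant [of ws "\<lambda>x. x \<in> e" i v0, OF step] that e \<open>C v0 \<noteq> []\<close> mem by blast
    have "length (filter (\<lambda>\<gamma>. insert i (set \<gamma>) = e) (C i)) = 1" if "i \<in> e" for i
    proof -
      have "\<gamma> \<noteq> replicate (k - 1) i" if "insert i (set \<gamma>) = e" for \<gamma>
      proof
        assume "\<gamma> = replicate (k - 1) i"
        then have "e = {i}" using that by auto
        then show False using e k by simp
      qed
      then have "filter (\<lambda>\<gamma>. insert i (set \<gamma>) = e) (C i) =
          filter (\<lambda>\<gamma>. insert i (set \<gamma>) = e) (filter (\<lambda>\<gamma>. \<gamma> \<noteq> replicate (k - 1) i) (C i))"
        unfolding filter_filter by (intro filter_cong refl) blast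
      then show ?thesis
        using cnt [of i e] that count_root_edges [OF en [OF that], of k C e] by (simp add: B_def)
    qed
    then have "C \<in> edge_configs k n e d"
      using C outside tail by (auto simp: edge_configs_def)
    then show ?thesis using e by blast
  qed
qed

lemma loop_config_in_configs:
  assumes "v < n"
  shows "loop_config k d v \<in> configs k n d"
proof -
  have "(\<Sum>i<n. length (loop_config k d v i)) = (\<Sum>i<n. if i = v then d else 0)"
    by (rule sum.cong) (auto simp: loop_config_def)
  then show ?thesis using assms by (auto simp: configs_def loop_config_def tails_def)
qed

text \<open>Staying at \<open>v\<close> is the only walk, and the factorial from
  \<open>arcs_fact\<close> cancels the one in the denominator.\<close>

lemma config_count_loop_config:
  assumes "v < n" "k \<ge> 2" "d \<ge> 1"
  shows "config_count k n (loop_config k d v) = 1"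
proof -
  define N where "N = d * (k - 1)"
  have N: "N \<ge> 1" using assms by (simp add: N_def)
  let ?C = "loop_config k d v"
  have arcs_v: "root_arcs v (replicate q (replicate (k - 1) v)) = replicate (q * (k - 1)) (v, v)" for q
    by (induction q) (simp_all add: root_arcs_def replicate_add)
  have "config_arcs n ?C = (\<Sum>i<n. if i = v then replicate_mset N (v, v) else {#})"
    unfolding config_arcs_def
    by (rule sum.cong) (auto simp: loop_config_def arcs_v N_def simp del: One_nat_def, simp add: root_arcs_def)
  then have arcs: "config_arcs n ?C = replicate_mset N (v, v)"
    using assms by simp
  have "(\<Prod>i<n. 1 / fact (length (?C i) * (k - 1))) = (\<Prod>i<n. if i = v then 1 / fact N else (1::real))"
    by (rule prod.cong) (auto simp: loop_config_def N_def)
  then have pr: "(\<Prod>i<n. 1 / fact (length (?C i) * (k - 1))) = 1 / (fact N :: real)"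
    using assms by simp
  have "walks n (replicate_mset N (v, v)) = {replicate N v}"
  proof (intro equalityI subsetI)
    fix ws assume "ws \<in> walks n (replicate_mset N (v, v))"
    then have "mset ws = image_mset fst (replicate_mset N (v, v))"
      by (metis (mono_tags, lifting) walks_def mem_Collect_eq image_mset_fst_cyc_arcs)
    then have "mset ws = replicate_mset N v" by simp
    then have "set ws \<subseteq> {v}" "length ws = N"
      by (metis set_mset_mset set_mset_replicate_mset_subset subset_refl empty_subsetI, metis size_mset size_replicate_mset)
    then show "ws \<in> {replicate N v}"
      by (auto intro: replicate_eqI)
  next
    fix ws assume "ws \<in> {replicate N v}"
    moreover have "rotate1 (replicate N v) = replicate N v"
      by (cases N) (simp_all add: replicate_append_same)
    ultimately show "ws \<in> walks n (replicate_mset N (v, v))"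
      using assms by (auto simp: walks_def cyc_arcs_def zip_replicate)
  qed
  then show ?thesis
    unfolding config_count_def pr arcs arcs_fact_def using N by simp
qed

lemma config_weight_loop_config:
  assumes "uniform k H" "k \<ge> 2" "v < n"
  shows "config_weight n (alpha_tensor \<alpha> k H) (loop_config k d v) = (\<alpha> * real (degree H v)) ^ d"
proof -
  have "replicate (k - 1) v \<in> tails k n" using assms by (auto simp: tails_def)
  from alpha_tensor_tail [OF assms(1,2) this, of \<alpha> v]
  have "config_weight n (alpha_tensor \<alpha> k H) (loop_config k d v) =
      (\<Prod>i<n. if i = v then (\<alpha> * real (degree H v)) ^ d else 1)"
    unfolding config_weight_def
    by (intro prod.cong) (auto simp: loop_config_def prod_list_replicate)
  then show ?thesis using assms by simp
qed

text \<open>\<open>x i\<close> stands for the diagonal entry at \<open>i\<close>. One tail at each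
  \<open>i\<close> comes from the hyperedge itself, hence the exponent
  \<open>length (C i) - 1\<close>. With \<open>x\<close> arbitrary, symmetry and differences can be
  studied without reference to a hypergraph.\<close>

definition edge_sum :: "nat \<Rightarrow> nat \<Rightarrow> nat set \<Rightarrow> nat \<Rightarrow> (nat \<Rightarrow> real) \<Rightarrow> real" where
  "edge_sum k n e d x = (\<Sum>C\<in>edge_configs k n e d. config_count k n C * (\<Prod>i\<in>e. x i ^ (length (C i) - 1)))"

lemma config_weight_edge_config:
  assumes uni: "uniform k H" and k: "k \<ge> 2" and e: "e \<in> hyperedges H" and n: "n = nverts H"
    and C: "C \<in> edge_configs k n e d"
  shows "config_weight n (alpha_tensor \<alpha> k H) C =
    ((1 - \<alpha>) / fact (k - 1)) ^ k * (\<Prod>i\<in>e. (\<alpha> * real (degree H i)) ^ (length (C i) - 1))"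
proof -
  let ?b = "(1 - \<alpha>) / fact (k - 1)"
  have sub: "e \<subseteq> {..<n}" and card: "card e = k" using uni e n by (auto simp: uniform_def verts_def)
  have list: "(\<Prod>\<gamma>\<leftarrow>\<Gamma>. alpha_tensor \<alpha> k H (i # \<gamma>)) =
      ?b ^ length (filter (\<lambda>\<gamma>. insert i (set \<gamma>) = e) \<Gamma>) *
      (\<alpha> * real (degree H i)) ^ (length (filter (\<lambda>\<gamma>. insert i (set \<gamma>) \<noteq> e) \<Gamma>))"
    if "set \<Gamma> \<subseteq> tails k n" "\<forall>\<gamma>\<in>set \<Gamma>. insert i (set \<gamma>) = e \<or> \<gamma> = replicate (k - 1) i" for i \<Gamma>
    using that
  proof (induction \<Gamma>)
    case (Cons \<gamma> \<Gamma>)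
    have tl: "\<gamma> \<in> tails k n" using Cons.prems by simp
    have "alpha_tensor \<alpha> k H (i # \<gamma>) = (if insert i (set \<gamma>) = e then ?b else \<alpha> * real (degree H i))"
    proof (cases "insert i (set \<gamma>) = e")
      case True
      have "\<gamma> \<noteq> replicate (k - 1) i"
      proof
        assume "\<gamma> = replicate (k - 1) i"
        then have "e = {i}" using True by auto
        then show False using card k by simp
      qed
      then show ?thesis unfolding alpha_tensor_tail [OF uni k tl] using True e by simp
    next
      case False
      then show ?thesis unfolding alpha_tensor_tail [OF uni k tl] using Cons.prems by auto
    qed
    with Cons show ?case by simp
  qed simp
  have one: "(\<Prod>\<gamma>\<leftarrow>C i. alpha_tensor \<alpha> k H (i # \<gamma>)) = ?b * (\<alpha> * real (degree H i)) ^ (length (C i) - 1)"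
    if "i \<in> e" for i
  proof -
    have "length (filter (\<lambda>\<gamma>. insert i (set \<gamma>) = e) (C i)) = 1"
      using C that by (simp add: edge_configs_def)
    moreover from this have "length (filter (\<lambda>\<gamma>. insert i (set \<gamma>) \<noteq> e) (C i)) = length (C i) - 1"
      using sum_length_filter_compl [of "\<lambda>\<gamma>. insert i (set \<gamma>) = e" "C i"] by simp
    moreover have "set (C i) \<subseteq> tails k n" using C by (auto simp: edge_configs_def configs_def)
    ultimately show ?thesis using C that by (subst list) (auto simp: edge_configs_def)
  qed
  have "config_weight n (alpha_tensor \<alpha> k H) C = (\<Prod>i\<in>e. \<Prod>\<gamma>\<leftarrow>C i. alpha_tensor \<alpha> k H (i # \<gamma>))"
    unfolding config_weight_def
    using sub C by (intro prod.mono_neutral_right) (auto simp: edge_configs_def)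
  also have "\<dots> = (\<Prod>i\<in>e. ?b * (\<alpha> * real (degree H i)) ^ (length (C i) - 1))"
    by (intro prod.cong refl one)
  finally show ?thesis by (simp only: prod.distrib prod_constant card)
qed

lemma edge_config_support:
  assumes "C \<in> edge_configs k n e d"
  shows "{i. C i \<noteq> []} = e"
  using assms by (fastforce simp: edge_configs_def)

text \<open>The families in the sum are disjoint because a configuration determines its support: a
  single vertex for loops, the hyperedge itself, with \<open>k \<ge> 3\<close> vertices,
  otherwise.\<close>

lemma alpha_trace_hypertree:
  assumes uni: "uniform k H" and H: "hypertree H" and k: "k \<ge> 3" and d: "1 \<le> d" "d \<le> k + 2"
  shows "alpha_trace \<alpha> k H d = real ((k - 1) ^ (nverts H - 1)) *
    ((\<Sum>v<nverts H. (\<alpha> * real (degree H v)) ^ d) +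
     ((1 - \<alpha>) / fact (k - 1)) ^ k * (\<Sum>e\<in>hyperedges H. edge_sum k (nverts H) e d (\<lambda>v. \<alpha> * real (degree H v))))"
proof -
  define n where "n = nverts H"
  let ?T = "alpha_tensor \<alpha> k H"
  let ?f = "\<lambda>C. config_weight n ?T C * config_count k n C"
  let ?L = "loop_config k d ` {..<n}"
  let ?E = "\<Union>e\<in>hyperedges H. edge_configs k n e d"
  have k2: "k \<ge> 2" using k by simp
  have fE: "finite (hyperedges H)" by (rule finite_hyperedges [OF uni])
  have sub: "edge_configs k n e d \<subseteq> configs k n d" for e by (auto simp: edge_configs_def)
  have fin: "finite (edge_configs k n e d)" for e
    by (rule finite_subset [OF sub finite_configs])
  have "(\<Sum>C\<in>configs k n d. ?f C) = (\<Sum>C\<in>?L \<union> ?E. ?f C)"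
  proof (rule sum.mono_neutral_right)
    show "?L \<union> ?E \<subseteq> configs k n d" using loop_config_in_configs [of _ n k d] sub by blast
    show "\<forall>C\<in>configs k n d - (?L \<union> ?E). ?f C = 0"
      using config_support [OF uni H k n_def _ d, of _ \<alpha>] by fastforce
  qed simp
  also have "\<dots> = (\<Sum>C\<in>?L. ?f C) + (\<Sum>C\<in>?E. ?f C)"
  proof (rule sum.union_disjoint)
    show "?L \<inter> ?E = {}"
    proof (rule ccontr)
      assume "?L \<inter> ?E \<noteq> {}"
      then obtain v e where e: "e \<in> hyperedges H" "loop_config k d v \<in> edge_configs k n e d" by blast
      have "{i. loop_config k d v i \<noteq> []} \<subseteq> {v}" by (auto simp: loop_config_def)
      then have "e \<subseteq> {v}" unfolding edge_config_support [OF e(2)] .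
      moreover have "card e = k" using e uni by (auto simp: uniform_def)
      ultimately show False using k card_mono [of "{v}" e] by simp
    qed
  qed (use fE fin in auto)
  also have "(\<Sum>C\<in>?L. ?f C) = (\<Sum>v<n. ?f (loop_config k d v))"
  proof (rule sum.reindex [unfolded o_def])
    show "inj_on (loop_config k d) {..<n}"
    proof (rule inj_onI)
      fix v w assume "loop_config k d v = loop_config k d w"
      then have "loop_config k d v v = loop_config k d w v" by simp
      then show "v = w" using d by (auto simp: loop_config_def split: if_splits)
    qed
  qed
  also have "\<dots> = (\<Sum>v<n. (\<alpha> * real (degree H v)) ^ d)"
    using config_count_loop_config [OF _ k2 d(1)] config_weight_loop_config [OF uni k2]
    by (intro sum.cong) auto
  also have "(\<Sum>C\<in>?E. ?f C) = (\<Sum>e\<in>hyperedges H. \<Sum>C\<in>edge_configs k n e d. ?f C)"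
  proof (rule sum.UNION_disjoint [OF fE])
    show "\<forall>e\<in>hyperedges H. \<forall>e'\<in>hyperedges H. e \<noteq> e' \<longrightarrow> edge_configs k n e d \<inter> edge_configs k n e' d = {}"
      using edge_config_support by blast
  qed (use fin in auto)
  also have "\<dots> = (\<Sum>e\<in>hyperedges H. ((1 - \<alpha>) / fact (k - 1)) ^ k * edge_sum k n e d (\<lambda>v. \<alpha> * real (degree H v)))"
    unfolding edge_sum_def sum_distrib_left
    by (intro sum.cong refl) (simp add: config_weight_edge_config [OF uni k2 _ n_def])
  finally show ?thesis
    unfolding alpha_trace_def using d(1) k2
    by (simp add: tensor_trace_eq n_def sum_distrib_left)
qed

section \<open>Symmetry and convexity of the contribution of a hyperedge\<close>

definition relabel :: "(nat \<Rightarrow> nat) \<Rightarrow> (nat \<Rightarrow> nat list list) \<Rightarrow> nat \<Rightarrow> nat list list" where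
  "relabel \<pi> C = (\<lambda>i. map (map \<pi>) (C (inv_into UNIV \<pi> i)))"

lemma cyc_arcs_map: "cyc_arcs (map f ws) = image_mset (map_prod f f) (cyc_arcs ws)"
  by (simp add: cyc_arcs_def rotate1_map zip_map_map map_prod_def flip: mset_map)

lemma config_arcs_relabel:
  assumes "\<pi> permutes {..<n}"
  shows "config_arcs n (relabel \<pi> C) = image_mset (map_prod \<pi> \<pi>) (config_arcs n C)"
proof -
  have arcs: "root_arcs (\<pi> i) (map (map \<pi>) \<Gamma>) = map (map_prod \<pi> \<pi>) (root_arcs i \<Gamma>)" for i \<Gamma>
    by (induction \<Gamma>) (auto simp: root_arcs_def)
  have "config_arcs n (relabel \<pi> C) = (\<Sum>i<n. mset (root_arcs (\<pi> i) (relabel \<pi> C (\<pi> i))))"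
    unfolding config_arcs_def by (subst sum.permute [OF assms]) (simp add: o_def)
  also have "\<dots> = (\<Sum>i<n. image_mset (map_prod \<pi> \<pi>) (mset (root_arcs i (C i))))"
    by (simp add: relabel_def permutes_inverses [OF assms] arcs)
  finally show ?thesis by (simp add: config_arcs_def image_mset_sum_lessThan)
qed

lemma arcs_fact_image:
  assumes "inj f"
  shows "arcs_fact (image_mset f M) = arcs_fact M"
proof -
  have "count (image_mset f M) (f x) = count M x" for x
    using assms by (induction M) (auto simp: inj_eq)
  then show ?thesis
    unfolding arcs_fact_def set_image_mset
    by (subst prod.reindex) (use assms in \<open>auto simp: inj_on_def inj_def\<close>)
qed

lemma walks_relabel:
  assumes "\<pi> permutes {..<n}"
  shows "walks n (image_mset (map_prod \<pi> \<pi>) M) = map \<pi> ` walks n M"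
proof (intro equalityI subsetI)
  fix ws assume ws: "ws \<in> walks n (image_mset (map_prod \<pi> \<pi>) M)"
  have "inv_into UNIV \<pi> permutes {..<n}" using assms by (rule permutes_inv)
  then have sub: "set (map (inv_into UNIV \<pi>) ws) \<subseteq> {..<n}"
    using ws permutes_in_image [of "inv_into UNIV \<pi>" "{..<n}"] by (auto simp: walks_def)
  have "map_prod (inv_into UNIV \<pi>) (inv_into UNIV \<pi>) \<circ> map_prod \<pi> \<pi> = id"
    by (auto simp: fun_eq_iff permutes_inverses [OF assms])
  then have "cyc_arcs (map (inv_into UNIV \<pi>) ws) = M"
    using ws by (simp add: cyc_arcs_map walks_def multiset.map_comp)
  moreover have "ws = map \<pi> (map (inv_into UNIV \<pi>) ws)"
    by (simp add: o_def permutes_inverses [OF assms])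
  ultimately show "ws \<in> map \<pi> ` walks n M"
    using sub unfolding walks_def by blast
next
  fix ws assume "ws \<in> map \<pi> ` walks n M"
  then show "ws \<in> walks n (image_mset (map_prod \<pi> \<pi>) M)"
    using permutes_in_image [OF assms] by (auto simp: walks_def cyc_arcs_map subset_iff)
qed

lemma config_count_relabel:
  assumes "\<pi> permutes {..<n}"
  shows "config_count k n (relabel \<pi> C) = config_count k n C"
proof -
  have inj: "inj \<pi>" using assms by (rule permutes_inj)
  have "(\<Prod>i<n. 1 / fact (length (relabel \<pi> C i) * (k - 1))) = (\<Prod>i<n. 1 / (fact (length (C i) * (k - 1)) :: real))"
    by (subst prod.permute [OF assms]) (simp add: o_def relabel_def permutes_inverses [OF assms])
  moreover have "inj (map_prod \<pi> \<pi>)" using inj by (auto simp: inj_def)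
  moreover have "card (map \<pi> ` walks n M) = card (walks n M)" for M
    using inj by (intro card_image) (auto simp: inj_on_def inj_map_eq_map)
  ultimately show ?thesis
    by (simp only: config_count_def config_arcs_relabel [OF assms] walks_relabel [OF assms] arcs_fact_image)
qed

lemma relabel_inv:
  assumes "\<pi> permutes {..<n}"
  shows "relabel (inv_into UNIV \<pi>) (relabel \<pi> C) = C"
  by (auto simp: relabel_def fun_eq_iff o_def permutes_inverses [OF assms] permutes_inv_inv [OF assms])

lemma relabel_edge_configs:
  assumes \<pi>: "\<pi> permutes {..<n}" and C: "C \<in> edge_configs k n e d"
  shows "relabel \<pi> C \<in> edge_configs k n (\<pi> ` e) d"
proof -
  have inj: "inj \<pi>" using \<pi> by (rule permutes_inj)
  have C': "C \<in> configs k n d" using C by (simp add: edge_configs_def)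
  have "set (relabel \<pi> C i) \<subseteq> tails k n" for i
  proof
    fix \<gamma> assume "\<gamma> \<in> set (relabel \<pi> C i)"
    then obtain \<delta> where "\<delta> \<in> set (C (inv_into UNIV \<pi> i))" "\<gamma> = map \<pi> \<delta>" by (auto simp: relabel_def)
    with configs_tails [OF C' this(1)] show "\<gamma> \<in> tails k n"
      using permutes_in_image [OF \<pi>] by (auto simp: tails_def)
  qed
  moreover have "relabel \<pi> C i = []" if "i \<ge> n" for i
  proof -
    have "inv_into UNIV \<pi> i = i" using that permutes_not_in [OF permutes_inv [OF \<pi>], of i] by simp
    then show ?thesis using C' that by (simp add: relabel_def configs_def)
  qed
  moreover have "(\<Sum>i<n. length (relabel \<pi> C i)) = (\<Sum>i<n. length (C i))"
    by (subst sum.permute [OF \<pi>]) (simp add: o_def relabel_def permutes_inverses [OF \<pi>])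
  ultimately have 1: "relabel \<pi> C \<in> configs k n d" using C' by (simp add: configs_def)
  have eq: "insert (\<pi> j) (set (map \<pi> \<gamma>)) = \<pi> ` e \<longleftrightarrow> insert j (set \<gamma>) = e" for j \<gamma>
    using inj_image_eq_iff [OF inj, of "insert j (set \<gamma>)" e] by simp
  have 2: "relabel \<pi> C i = []" if "i \<notin> \<pi> ` e" for i
  proof -
    have "inv_into UNIV \<pi> i \<notin> e" using that permutes_inverses(1) [OF \<pi>, of i] by (metis imageI)
    then show ?thesis using C by (simp add: relabel_def edge_configs_def)
  qed
  have 3: "length (filter (\<lambda>\<gamma>. insert (\<pi> j) (set \<gamma>) = \<pi> ` e) (relabel \<pi> C (\<pi> j))) = 1 \<and>
      (\<forall>\<gamma>\<in>set (relabel \<pi> C (\<pi> j)). insert (\<pi> j) (set \<gamma>) = \<pi> ` e \<or> \<gamma> = replicate (k - 1) (\<pi> j))"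
    if "j \<in> e" for j
  proof -
    have r: "relabel \<pi> C (\<pi> j) = map (map \<pi>) (C j)"
      by (simp add: relabel_def permutes_inverses [OF \<pi>])
    have j: "length (filter (\<lambda>\<gamma>. insert j (set \<gamma>) = e) (C j)) = 1"
        "\<forall>\<gamma>\<in>set (C j). insert j (set \<gamma>) = e \<or> \<gamma> = replicate (k - 1) j"
      using C that by (auto simp: edge_configs_def)
    have "length (filter (\<lambda>\<gamma>. insert (\<pi> j) (set \<gamma>) = \<pi> ` e) (map (map \<pi>) (C j))) = 1"
      unfolding filter_map o_def eq length_map by (rule j(1))
    moreover have "insert (\<pi> j) (set \<gamma>) = \<pi> ` e \<or> \<gamma> = replicate (k - 1) (\<pi> j)"
      if \<gamma>: "\<gamma> \<in> set (map (map \<pi>) (C j))" for \<gamma>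
    proof -
      obtain \<delta> where \<delta>: "\<delta> \<in> set (C j)" "\<gamma> = map \<pi> \<delta>" using \<gamma> by auto
      show ?thesis using j(2) \<delta>(1) unfolding \<delta>(2) eq by (metis map_replicate)
    qed
    ultimately show ?thesis unfolding r by blast
  qed
  show ?thesis using 1 2 3 by (auto simp: edge_configs_def)
qed

lemma edge_sum_relabel:
  assumes \<pi>: "\<pi> permutes {..<n}"
  shows "edge_sum k n (\<pi> ` e) d x = edge_sum k n e d (x \<circ> \<pi>)"
proof -
  have inj: "inj \<pi>" using \<pi> by (rule permutes_inj)
  have inv: "inv_into UNIV \<pi> permutes {..<n}" using \<pi> by (rule permutes_inv)
  have ii: "inv_into UNIV \<pi> ` \<pi> ` e = e" using inj by (simp add: image_image)
  show ?thesis
    unfolding edge_sum_def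
  proof (rule sum.reindex_bij_witness [where i = "relabel \<pi>" and j = "relabel (inv_into UNIV \<pi>)"])
    fix C assume C: "C \<in> edge_configs k n (\<pi> ` e) d"
    show "relabel (inv_into UNIV \<pi>) C \<in> edge_configs k n e d"
      using relabel_edge_configs [OF inv C] by (simp only: ii)
    show "relabel \<pi> (relabel (inv_into UNIV \<pi>) C) = C"
      using relabel_inv [OF inv, of C] by (simp add: permutes_inv_inv [OF \<pi>])
    have "(\<Prod>i\<in>\<pi> ` e. x i ^ (length (C i) - 1)) = (\<Prod>j\<in>e. x (\<pi> j) ^ (length (C (\<pi> j)) - 1))"
      using inj by (subst prod.reindex) (auto simp: inj_on_def inj_def)
    then show "config_count k n (relabel (inv_into UNIV \<pi>) C) * (\<Prod>i\<in>e. (x \<circ> \<pi>) i ^ (length (relabel (inv_into UNIV \<pi>) C i) - 1)) =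
        config_count k n C * (\<Prod>i\<in>\<pi> ` e. x i ^ (length (C i) - 1))"
      unfolding config_count_relabel [OF inv] by (simp add: relabel_def permutes_inv_inv [OF \<pi>])
  next
    fix C assume C: "C \<in> edge_configs k n e d"
    show "relabel (inv_into UNIV \<pi>) (relabel \<pi> C) = C" by (rule relabel_inv [OF \<pi>])
    show "relabel \<pi> C \<in> edge_configs k n (\<pi> ` e) d" by (rule relabel_edge_configs [OF \<pi> C])
  qed
qed

text \<open>Three bijections are glued: on \<open>S\<close>, on \<open>e - S\<close>, and on the
  complement of \<open>e\<close>. The permutation has to act on all of \<open>{..<n}\<close> because
  the configurations and their walks live there.\<close>

lemma ex_permutation_two_sets:
  fixes S S' e e' :: "nat set"
  assumes "e \<subseteq> {..<n}" "e' \<subseteq> {..<n}" "card e = card e'" "S \<subseteq> e" "S' \<subseteq> e'" "card S = card S'"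
  shows "\<exists>\<pi>. \<pi> permutes {..<n} \<and> \<pi> ` e = e' \<and> \<pi> ` S = S'"
proof -
  have fin: "finite e" "finite e'" "finite S" "finite S'"
    using assms finite_subset [OF _ finite_lessThan] finite_subset by (blast+)
  have "card (e - S) = card (e' - S')" "card ({..<n} - e) = card ({..<n} - e')"
    using assms fin by (simp_all add: card_Diff_subset)
  then obtain f g h where f: "bij_betw f S S'" and g: "bij_betw g (e - S) (e' - S')"
      and h: "bij_betw h ({..<n} - e) ({..<n} - e')"
    using assms(6) fin by (metis finite_same_card_bij finite_Diff finite_lessThan)
  define p where "p x = (if x \<in> S then f x else if x \<in> e then g x else if x < n then h x else x)" for x
  have im: "p ` S = S'" "p ` (e - S) = e' - S'" "p ` ({..<n} - e) = {..<n} - e'"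
  proof -
    have "p ` S = f ` S" "p ` (e - S) = g ` (e - S)" "p ` ({..<n} - e) = h ` ({..<n} - e)"
      using assms by (auto simp: p_def intro!: image_cong)
    then show "p ` S = S'" "p ` (e - S) = e' - S'" "p ` ({..<n} - e) = {..<n} - e'"
      using f g h by (auto simp: bij_betw_def)
  qed
  have e: "p ` e = e'"
    using im assms by (metis Diff_partition image_Un)
  have all: "p ` {..<n} = {..<n}"
    using im e assms by (metis Diff_partition image_Un)
  then have "bij_betw p {..<n} {..<n}"
    by (simp add: bij_betw_def eq_card_imp_inj_on)
  then have "p permutes {..<n}"
    using assms by (intro bij_imp_permutes) (auto simp: p_def)
  then show ?thesis using e im by blast
qed

lemma edge_sum_cong: "(\<And>i. i \<in> e \<Longrightarrow> x i = y i) \<Longrightarrow> edge_sum k n e d x = edge_sum k n e d y"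
  unfolding edge_sum_def by (intro sum.cong refl) (auto intro!: prod.cong)

lemma edge_sum_two_values:
  assumes "e \<subseteq> {..<n}" "e' \<subseteq> {..<n}" "card e = card e'" "S \<subseteq> e" "S' \<subseteq> e'" "card S = card S'"
  shows "edge_sum k n e d (\<lambda>i. if i \<in> S then b else a) = edge_sum k n e' d (\<lambda>i. if i \<in> S' then b else a)"
proof -
  obtain \<pi> where \<pi>: "\<pi> permutes {..<n}" "\<pi> ` e = e'" "\<pi> ` S = S'"
    using ex_permutation_two_sets [OF assms] by blast
  have "\<pi> i \<in> S' \<longleftrightarrow> i \<in> S" for i
    using permutes_inj [OF \<pi>(1)] \<pi>(3) by (auto simp: inj_def)
  then show ?thesis
    using edge_sum_relabel [OF \<pi>(1), of k e d "\<lambda>i. if i \<in> S' then b else a"] \<pi>(2) by (simp add: o_def)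
qed

text \<open>The function \<open>g\<^sub>d\<close> of the overview, evaluated on the model hyperedge
  \<open>{..<k}\<close>: degree 2 doubles the diagonal entry \<open>a\<close>, and by symmetry the
  doubled vertices may be the first \<open>t\<close>.\<close>

definition edge_profile :: "nat \<Rightarrow> nat \<Rightarrow> real \<Rightarrow> nat \<Rightarrow> nat \<Rightarrow> real" where
  "edge_profile k n a d t = edge_sum k n {..<k} d (\<lambda>i. if i < t then 2 * a else a)"

lemma edge_sum_eq_profile:
  assumes "H \<in> hypertrees k m" "k \<ge> 2" "m \<ge> 1" "\<And>v. v < nverts H \<Longrightarrow> degree H v \<le> 2" "e \<in> hyperedges H"
  shows "edge_sum k (nverts H) e d (\<lambda>v. \<alpha> * real (degree H v)) = edge_profile k (nverts H) \<alpha> d (branching H e)"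
proof -
  let ?S = "{v \<in> e. degree H v = 2}"
  have sub: "e \<subseteq> {..<nverts H}" and card: "card e = k"
    using assms(1,5) by (auto simp: hypertrees_def uniform_def verts_def)
  have fin: "finite e" using sub finite_subset by blast
  have deg: "degree H v = 1 \<or> degree H v = 2" if "v \<in> e" for v
    using degree_pos [OF assms(1-3), of v] assms(4) [of v] that sub by force
  have "branching H e \<le> k" unfolding branching_def card [symmetric] using fin by (intro card_mono) auto
  moreover have "k \<le> nverts H" using card_mono [OF _ sub] card by simp
  moreover have "edge_sum k (nverts H) e d (\<lambda>v. \<alpha> * real (degree H v)) =
      edge_sum k (nverts H) e d (\<lambda>v. if v \<in> ?S then 2 * \<alpha> else \<alpha>)"
    using deg by (intro edge_sum_cong) fastforce
  moreover have "{..<branching H e} \<subseteq> {..<k}" "{..<k} \<subseteq> {..<nverts H}" "card e = card {..<k}" "card ?S = card {..<branching H e}"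
    using calculation card by (auto simp: branching_def)
  ultimately show ?thesis
    unfolding edge_profile_def
    using edge_sum_two_values [OF sub, of "{..<k}" ?S "{..<branching H e}"] by simp
qed

lemma config_count_nonneg: "config_count k n C \<ge> 0"
  by (simp add: config_count_def arcs_fact_def prod_nonneg)

lemma edge_config_length:
  assumes "C \<in> edge_configs k n e d" "i \<in> e"
  shows "length (C i) \<ge> 1"
  using assms length_filter_le [of "\<lambda>\<gamma>. insert i (set \<gamma>) = e" "C i"] by (simp add: edge_configs_def)

lemma sum_length_edge_config:
  assumes "C \<in> edge_configs k n e d" "e \<subseteq> {..<n}"
  shows "(\<Sum>i\<in>e. length (C i)) = d"
proof -
  have "(\<Sum>i\<in>e. length (C i)) = (\<Sum>i<n. length (C i))"
    using assms by (intro sum.mono_neutral_left) (auto simp: edge_configs_def)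
  then show ?thesis using assms by (simp add: edge_configs_def configs_def)
qed

lemma edge_configs_empty:
  assumes "e \<subseteq> {..<n}" "d < card e"
  shows "edge_configs k n e d = {}"
proof (rule ccontr)
  assume "edge_configs k n e d \<noteq> {}"
  then obtain C where C: "C \<in> edge_configs k n e d" by blast
  have "(\<Sum>i\<in>e. 1) \<le> (\<Sum>i\<in>e. length (C i))"
    using edge_config_length [OF C] by (intro sum_mono) auto
  then show False using sum_length_edge_config [OF C assms(1)] assms(2) by simp
qed

text \<open>By symmetry, of the two copies of the value at \<open>t + 1\<close> one may double the
  entry at \<open>t\<close> and the other the entry at \<open>t + 1\<close>. This gives a mixed
  difference in the entries at these two vertices, which factorises because each configuration
  contributes a product over the vertices.\<close>

lemma edge_profile_second_difference:
  assumes "t + 2 \<le> k" "k \<le> n"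
  shows "edge_profile k n a d (t + 2) - 2 * edge_profile k n a d (t + 1) + edge_profile k n a d t =
    (\<Sum>C\<in>edge_configs k n {..<k} d. config_count k n C *
      ((\<Prod>i\<in>{..<k} - {t, t + 1}. (if i < t then 2 * a else a) ^ (length (C i) - 1)) *
       a ^ (length (C t) - 1) * a ^ (length (C (t + 1)) - 1) *
       ((2 ^ (length (C t) - 1) - 1) * (2 ^ (length (C (t + 1)) - 1) - 1))))"
    (is "_ = (\<Sum>C\<in>_. _ * ?D C)")
proof -
  let ?x = "\<lambda>S i. if i \<in> S then 2 * a else a"
  let ?p = "\<lambda>S C. \<Prod>i<k. ?x S i ^ (length (C i) - 1)"
  let ?es = "\<lambda>S. edge_sum k n {..<k} d (?x S)"
  have prof: "edge_profile k n a d s = ?es {..<s}" for s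
    unfolding edge_profile_def by (intro edge_sum_cong) simp
  have swap: "?es {..<t + 1} = ?es (insert (t + 1) {..<t})"
    using assms by (intro edge_sum_two_values) auto
  have "edge_profile k n a d (t + 2) - 2 * edge_profile k n a d (t + 1) + edge_profile k n a d t =
      ?es {..<t + 2} - ?es {..<t + 1} - ?es (insert (t + 1) {..<t}) + ?es {..<t}"
    unfolding prof using swap by simp
  also have "\<dots> = (\<Sum>C\<in>edge_configs k n {..<k} d. config_count k n C *
      (?p {..<t + 2} C - ?p {..<t + 1} C - ?p (insert (t + 1) {..<t}) C + ?p {..<t} C))"
    unfolding edge_sum_def by (simp add: sum_subtractf sum.distrib ring_distribs)
  also have "\<dots> = (\<Sum>C\<in>edge_configs k n {..<k} d. config_count k n C * ?D C)"
  proof (intro sum.cong refl)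
    fix C :: "nat \<Rightarrow> nat list list"
    let ?c = "\<Prod>i\<in>{..<k} - {t, t + 1}. (if i < t then 2 * a else a) ^ (length (C i) - 1)"
    let ?v = "length (C t) - 1" and ?w = "length (C (t + 1)) - 1"
    have split: "?p S C = ?c * (?x S t ^ ?v * ?x S (t + 1) ^ ?w)"
      if S: "\<And>i. i < k \<Longrightarrow> i \<noteq> t \<Longrightarrow> i \<noteq> t + 1 \<Longrightarrow> i \<in> S \<longleftrightarrow> i < t" for S
    proof -
      have "?p S C = (\<Prod>i\<in>{..<k} - {t, t + 1}. ?x S i ^ (length (C i) - 1)) * (\<Prod>i\<in>{t, t + 1}. ?x S i ^ (length (C i) - 1))"
        using assms by (intro prod.subset_diff) auto
      also have "(\<Prod>i\<in>{..<k} - {t, t + 1}. ?x S i ^ (length (C i) - 1)) = ?c"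
        using S by (intro prod.cong) auto
      finally show ?thesis by simp
    qed
    have 1: "?p {..<t + 2} C = ?c * ((2 * a) ^ ?v * (2 * a) ^ ?w)"
      by (subst split) auto
    have 2: "?p {..<t + 1} C = ?c * ((2 * a) ^ ?v * a ^ ?w)"
      by (subst split) auto
    have 3: "?p (insert (t + 1) {..<t}) C = ?c * (a ^ ?v * (2 * a) ^ ?w)"
      by (subst split) auto
    have 4: "?p {..<t} C = ?c * (a ^ ?v * a ^ ?w)"
      by (subst split) auto
    show "config_count k n C * (?p {..<t + 2} C - ?p {..<t + 1} C - ?p (insert (t + 1) {..<t}) C + ?p {..<t} C) =
        config_count k n C * ?D C"
      unfolding 1 2 3 4 power_mult_distrib by (simp only: ring_distribs mult_ac)
  qed
  finally show ?thesis .
qed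

text \<open>Each vertex already has its hyperedge tail, so at most one diagonal tail is left. Hence
  \<open>t\<close> or \<open>t + 1\<close> has none, and its factor is
  \<open>2 ^ 0 - 1 = 0\<close>.\<close>

lemma edge_profile_affine:
  assumes "t + 2 \<le> k" "k \<le> n" "d \<le> k + 1"
  shows "edge_profile k n a d (t + 2) - 2 * edge_profile k n a d (t + 1) + edge_profile k n a d t = 0"
  unfolding edge_profile_second_difference [OF assms(1,2)]
proof (intro sum.neutral ballI)
  fix C assume C: "C \<in> edge_configs k n {..<k} d"
  have "(\<Sum>i\<in>{..<k} - {t, t + 1}. 1) \<le> (\<Sum>i\<in>{..<k} - {t, t + 1}. length (C i))"
    using edge_config_length [OF C] by (intro sum_mono) auto
  moreover have "(\<Sum>i<k. length (C i)) = (\<Sum>i\<in>{..<k} - {t, t + 1}. length (C i)) + (\<Sum>i\<in>{t, t + 1}. length (C i))"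
    using assms by (intro sum.subset_diff) auto
  moreover have "card ({..<k} - {t, t + 1}) = k - 2"
    using assms by (subst card_Diff_subset) auto
  ultimately have "k - 2 + (length (C t) + length (C (t + 1))) \<le> d"
    using sum_length_edge_config [OF C] assms by simp
  then have "length (C t) = 1 \<or> length (C (t + 1)) = 1"
    using assms edge_config_length [OF C, of t] edge_config_length [OF C, of "t + 1"] by auto
  then show "config_count k n C *
      ((\<Prod>i\<in>{..<k} - {t, t + 1}. (if i < t then 2 * a else a) ^ (length (C i) - 1)) *
       a ^ (length (C t) - 1) * a ^ (length (C (t + 1)) - 1) *
       ((2 ^ (length (C t) - 1) - 1) * (2 ^ (length (C (t + 1)) - 1) - 1))) = 0"
    by auto
qed

section \<open>Closed walks through a complete digraph with loops\<close>

definition circuit :: "nat set \<Rightarrow> (nat \<times> nat) multiset \<Rightarrow> bool" where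
  "circuit V M \<longleftrightarrow> (\<exists>ws. cyc_arcs ws = M \<and> V \<subseteq> set ws)"

lemma cyc_arcs_rotate: "cyc_arcs (rotate q ws) = cyc_arcs ws"
proof -
  have "cyc_arcs (rotate1 ws) = cyc_arcs ws" for ws :: "'a list"
  proof (cases ws)
    case (Cons x xs)
    have *: "zip (xs @ [x]) (rotate1 (xs @ [x])) = rotate1 (zip (x # xs) (xs @ [x]))"
    proof (cases xs)
      case (Cons y ys)
      show ?thesis using zip_append [of "y # ys" "ys @ [x]" "[x]" "[y]"] by (simp add: Cons)
    qed simp
    show ?thesis unfolding cyc_arcs_def Cons rotate1.simps * mset_rotate1 ..
  qed simp
  then show ?thesis by (induction q) (simp_all add: rotate_def)
qed

text \<open>Both walks are rotated to start at the common vertex and then concatenated. This is why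
  \<open>circuit\<close> keeps track of visited vertices.\<close>

lemma circuit_join:
  assumes "circuit V M" "circuit W N" "v \<in> V" "v \<in> W"
  shows "circuit (V \<union> W) (M + N)"
proof -
  have start: "\<exists>xs. cyc_arcs (v # xs) = M \<and> V \<subseteq> set (v # xs)" if c: "circuit V M" "v \<in> V" for V M
  proof -
    obtain ws where ws: "cyc_arcs ws = M" "V \<subseteq> set ws" using c by (auto simp: circuit_def)
    then obtain i where i: "i < length ws" "ws ! i = v" using c by (metis in_set_conv_nth subsetD)
    have "rotate i ws = v # tl (rotate i ws)"
      using i hd_rotate_conv_nth [of ws i] by (cases "ws = []"; cases "rotate i ws") auto
    then show ?thesis using ws cyc_arcs_rotate [of i ws] by (metis set_rotate)
  qed
  obtain xs where xs: "cyc_arcs (v # xs) = M" "V \<subseteq> set (v # xs)" using start [OF assms(1,3)] by blast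
  obtain ys where ys: "cyc_arcs (v # ys) = N" "W \<subseteq> set (v # ys)" using start [OF assms(2,4)] by blast
  have "zip (v # xs @ v # ys) (xs @ v # ys @ [v]) =
      zip (v # xs) (xs @ [v]) @ zip (v # ys) (ys @ [v])"
    using zip_append [of "v # xs" "xs @ [v]" "v # ys" "ys @ [v]"] by simp
  then have "cyc_arcs (v # xs @ v # ys) = M + N"
    using xs ys by (simp add: cyc_arcs_def)
  then show ?thesis using xs ys unfolding circuit_def
    by (intro exI [of _ "v # xs @ v # ys"]) auto
qed

text \<open>For each \<open>a\<close> in \<open>A\<close> the detour from \<open>a\<close> to
  \<open>x\<close> and back is spliced in. For empty \<open>A\<close> the added arcs do not reach
  \<open>x\<close>, hence the case distinction.\<close>

lemma circuit_star:
  assumes "finite A" "circuit V M" "A \<subseteq> V"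
  shows "circuit (if A = {} then V else insert x V) (M + (\<Sum>a\<in>A. {#(a, x), (x, a)#}))"
  using assms(1,3)
proof (induction A)
  case (insert a A)
  have "circuit {a, x} {#(a, x), (x, a)#}"
    unfolding circuit_def by (intro exI [of _ "[a, x]"]) (simp add: cyc_arcs_def)
  then have "circuit ((if A = {} then V else insert x V) \<union> {a, x})
      (M + (\<Sum>a\<in>A. {#(a, x), (x, a)#}) + {#(a, x), (x, a)#})"
    using insert by (intro circuit_join [of _ _ _ _ a]) auto
  moreover have "(if A = {} then V else insert x V) \<union> {a, x} = insert x V"
    using insert by auto
  ultimately show ?case using insert by (simp add: ac_simps)
qed (use assms in simp)

text \<open>A new vertex is attached by a detour from each old one. The induction starts at 2, since
  a single vertex has no arcs and so no closed walk through it.\<close>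

lemma complete_digraph_circuit:
  assumes "k \<ge> 2"
  shows "circuit {..<k} (\<Sum>i<k. mset (map (Pair i) (filter (\<lambda>j. j \<noteq> i) [0..<k])))"
  using assms
proof (induction k rule: nat_induct_at_least)
  case base
  have "circuit {..<2} {#(1, 0), (0, 1)#}"
    unfolding circuit_def by (intro exI [of _ "[1, 0]"]) (auto simp: cyc_arcs_def)
  then show ?case by (simp add: numeral_2_eq_2 upt_rec)
next
  case (Suc k)
  have "filter (\<lambda>j. j \<noteq> k) [0..<k] = [0..<k]" by (rule filter_True) simp
  then have 1: "(\<Sum>i<Suc k. mset (map (Pair i) (filter (\<lambda>j. j \<noteq> i) [0..<Suc k]))) =
     (\<Sum>i<k. mset (map (Pair i) (filter (\<lambda>j. j \<noteq> i) [0..<k])) + {#(i, k)#}) + mset (map (Pair k) [0..<k])"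
    by (simp del: mset_map mset_filter)
  have 2: "mset (map (Pair k) [0..<j]) = (\<Sum>i<j. {#(k, i)#})" for j
    by (induction j) auto
  have 3: "(\<Sum>i<k. {#(i, k)#}) + (\<Sum>i<k. {#(k, i)#}) = (\<Sum>i<k. {#(i, k), (k, i)#})"
    by (simp add: add_mset_commute flip: sum.distrib)
  have "(\<Sum>i<Suc k. mset (map (Pair i) (filter (\<lambda>j. j \<noteq> i) [0..<Suc k]))) =
     (\<Sum>i<k. mset (map (Pair i) (filter (\<lambda>j. j \<noteq> i) [0..<k]))) + (\<Sum>i<k. {#(i, k), (k, i)#})"
    unfolding 1 2 sum.distrib 3 [symmetric] add.assoc ..
  moreover have "{..<k} \<noteq> {}" using Suc.hyps by (auto simp: lessThan_empty_iff)
  ultimately show ?case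
    using circuit_star [OF _ Suc.IH, of "{..<k}" k] by (simp add: lessThan_Suc del: mset_map mset_filter)
qed

lemma finite_walks [simp]: "finite (walks n M)"
proof (rule finite_subset)
  show "walks n M \<subseteq> {ws. set ws \<subseteq> {..<n} \<and> length ws = size M}"
    by (auto simp: walks_def cyc_arcs_def)
  show "finite {ws. set ws \<subseteq> {..<n} \<and> length ws = size M}"
    by (rule finite_lists_length_eq) simp
qed

text \<open>The witness for strict convexity. Each root takes the other vertices in increasing order
  as its tail, which yields the complete digraph; the loops at \<open>v\<close> and \<open>w\<close>
  are spliced into a closed walk through it, so the count is positive.\<close>

lemma edge_config_doubled_loops:
  assumes k: "k \<ge> 3" "k \<le> n" and vw: "v < k" "w < k" "v \<noteq> w"
  shows "\<exists>C\<in>edge_configs k n {..<k} (k + 2). config_count k n C > 0 \<and> length (C v) = 2 \<and> length (C w) = 2"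
proof -
  define C where "C i = (if i < k then filter (\<lambda>j. j \<noteq> i) [0..<k] #
      (if i \<in> {v, w} then [replicate (k - 1) i] else []) else [])" for i
  have len: "length (filter (\<lambda>j. j \<noteq> i) [0..<k]) = k - 1" if "i < k" for i
  proof -
    have "length (filter (\<lambda>j. j \<noteq> i) [0..<k]) = card ({..<k} - {i})"
      by (subst distinct_card [symmetric]) (auto intro!: arg_cong [where f = card])
    then show ?thesis using that by simp
  qed
  have "(\<Sum>i<n. length (C i)) = (\<Sum>i<k. length (C i))"
    using k by (intro sum.mono_neutral_right) (auto simp: C_def)
  also have "\<dots> = (\<Sum>i<k. 1 + (if i \<in> {v, w} then 1 else 0))"
    by (intro sum.cong) (auto simp: C_def)
  also have "\<dots> = k + card ({..<k} \<inter> {v, w})"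
    by (simp only: sum.distrib) (simp add: sum.If_cases del: insert_iff)
  also have "{..<k} \<inter> {v, w} = {v, w}" using vw by auto
  finally have "(\<Sum>i<n. length (C i)) = k + 2" using vw by simp
  moreover have "set (C i) \<subseteq> tails k n" for i
    using k len [of i] by (auto simp: C_def tails_def)
  ultimately have conf: "C \<in> configs k n (k + 2)"
    using k by (auto simp: configs_def C_def)
  have edge: "C \<in> edge_configs k n {..<k} (k + 2)"
  proof -
    have full: "insert i (set (filter (\<lambda>j. j \<noteq> i) [0..<k])) = {..<k}" if "i < k" for i
      using that by auto
    have loop: "insert i (set (replicate (k - 1) i)) \<noteq> {..<k}" for i
    proof
      assume "insert i (set (replicate (k - 1) i)) = {..<k}"
      moreover have "insert i (set (replicate (k - 1) i)) = {i}" by auto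
      ultimately have "card {..<k} = 1" by simp
      then show False using k by simp
    qed
    have "length (filter (\<lambda>\<gamma>. insert i (set \<gamma>) = {..<k}) (C i)) = 1" if "i < k" for i
      using full [OF that] loop [of i] that by (simp add: C_def del: set_filter set_replicate)
    moreover have "insert i (set \<gamma>) = {..<k} \<or> \<gamma> = replicate (k - 1) i" if "\<gamma> \<in> set (C i)" "i < k" for i \<gamma>
    proof -
      have "\<gamma> = filter (\<lambda>j. j \<noteq> i) [0..<k] \<or> \<gamma> = replicate (k - 1) i"
        using that by (cases "i \<in> {v, w}") (simp_all add: C_def)
      then show ?thesis using full [OF that(2)] by metis
    qed
    ultimately show ?thesis using conf by (auto simp: edge_configs_def C_def)
  qed
  let ?K = "\<Sum>i<k. mset (map (Pair i) (filter (\<lambda>j. j \<noteq> i) [0..<k]))"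
  have "config_arcs n C = (\<Sum>i<k. mset (root_arcs i (C i)))"
    unfolding config_arcs_def using k by (intro sum.mono_neutral_right) (auto simp: C_def root_arcs_def)
  also have "\<dots> = (\<Sum>i<k. mset (map (Pair i) (filter (\<lambda>j. j \<noteq> i) [0..<k])) +
      ((if i = v then replicate_mset (k - 1) (v, v) else {#}) + (if i = w then replicate_mset (k - 1) (w, w) else {#})))"
    using vw by (intro sum.cong) (auto simp: C_def root_arcs_def simp del: mset_map mset_filter)
  also have "\<dots> = ?K + replicate_mset (k - 1) (v, v) + replicate_mset (k - 1) (w, w)"
    using vw by (simp add: sum.distrib add.assoc del: mset_map mset_filter)
  finally have arcs: "config_arcs n C = ?K + replicate_mset (k - 1) (v, v) + replicate_mset (k - 1) (w, w)" .
  have loop: "circuit {x} (replicate_mset (k - 1) (x, x))" for x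
  proof -
    have "rotate1 (replicate N x) = replicate N x" for N
      by (cases N) (simp_all add: replicate_append_same)
    then show ?thesis
      unfolding circuit_def using k by (intro exI [of _ "replicate (k - 1) x"]) (auto simp: cyc_arcs_def zip_replicate)
  qed
  have "circuit ({..<k} \<union> {v} \<union> {w}) (config_arcs n C)"
    unfolding arcs using k vw
    by (intro circuit_join [OF circuit_join [OF complete_digraph_circuit loop] loop]) auto
  then obtain ws where ws: "cyc_arcs ws = config_arcs n C" by (auto simp: circuit_def)
  have "x < n" if "x \<in> set ws" for x
  proof -
    have "x \<in># image_mset fst (config_arcs n C)" using that by (simp add: image_mset_fst_cyc_arcs flip: ws)
    then show ?thesis by (auto simp: in_config_arcs)
  qed
  then have "walks n (config_arcs n C) \<noteq> {}" using ws by (auto simp: walks_def)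
  then have "card (walks n (config_arcs n C)) > 0" by (simp add: card_gt_0_iff)
  then have "config_count k n C > 0"
    unfolding config_count_def arcs_fact_def by (intro mult_pos_pos prod_pos) auto
  then show ?thesis using edge vw by (intro bexI [of _ C]) (auto simp: C_def)
qed

text \<open>For \<open>a > 0\<close> no term of the second difference is negative, and the
  configuration with one loop at each of \<open>t\<close> and \<open>t + 1\<close> gives a positive
  one.\<close>

lemma edge_profile_strictly_convex:
  assumes "t + 2 \<le> k" "k \<ge> 3" "k \<le> n" "a > 0"
  shows "edge_profile k n a (k + 2) (t + 2) - 2 * edge_profile k n a (k + 2) (t + 1) + edge_profile k n a (k + 2) t > 0"
  unfolding edge_profile_second_difference [OF assms(1,3)]
proof -
  have fin: "finite (edge_configs k n {..<k} (k + 2))"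
    by (rule finite_subset [OF _ finite_configs [of k n "k + 2"]]) (auto simp: edge_configs_def)
  have pos: "(\<Prod>i\<in>{..<k} - {t, t + 1}. (if i < t then 2 * a else a) ^ (length (C i) - 1)) *
       a ^ (length (C t) - 1) * a ^ (length (C (t + 1)) - 1) > 0" for C :: "nat \<Rightarrow> nat list list"
    using assms by (intro mult_pos_pos prod_pos) auto
  have ge: "(2 ^ q - 1 :: real) \<ge> 0" for q by simp
  obtain C where C: "C \<in> edge_configs k n {..<k} (k + 2)" "config_count k n C > 0"
      "length (C t) = 2" "length (C (t + 1)) = 2"
    using edge_config_doubled_loops [of k n t "t + 1"] assms by auto
  show "0 < (\<Sum>C\<in>edge_configs k n {..<k} (k + 2). config_count k n C *
      ((\<Prod>i\<in>{..<k} - {t, t + 1}. (if i < t then 2 * a else a) ^ (length (C i) - 1)) *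
       a ^ (length (C t) - 1) * a ^ (length (C (t + 1)) - 1) *
       ((2 ^ (length (C t) - 1) - 1) * (2 ^ (length (C (t + 1)) - 1) - 1))))"
  proof (rule sum_pos2 [OF fin C(1)])
    show "0 < config_count k n C *
      ((\<Prod>i\<in>{..<k} - {t, t + 1}. (if i < t then 2 * a else a) ^ (length (C i) - 1)) *
       a ^ (length (C t) - 1) * a ^ (length (C (t + 1)) - 1) *
       ((2 ^ (length (C t) - 1) - 1) * (2 ^ (length (C (t + 1)) - 1) - 1)))"
      by (rule mult_pos_pos [OF C(2) mult_pos_pos [OF pos]]) (use C(3,4) in simp)
    show "0 \<le> config_count k n C *
      ((\<Prod>i\<in>{..<k} - {t, t + 1}. (if i < t then 2 * a else a) ^ (length (C i) - 1)) *
       a ^ (length (C t) - 1) * a ^ (length (C (t + 1)) - 1) *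
       ((2 ^ (length (C t) - 1) - 1) * (2 ^ (length (C (t + 1)) - 1) - 1)))" for C
      by (intro mult_nonneg_nonneg [OF config_count_nonneg] mult_nonneg_nonneg [OF less_imp_le [OF pos]] mult_nonneg_nonneg ge)
  qed
qed

text \<open>No integer lies strictly between 1 and 2, so a convex sequence lies above its chord
  through these points on either side. They are the branching numbers that occur in the
  hyperpath.\<close>

lemma chord_le_of_convex:
  fixes f :: "nat \<Rightarrow> real"
  assumes convex: "\<And>t. t + 2 \<le> k \<Longrightarrow> f (t + 2) - 2 * f (t + 1) + f t \<ge> 0" and t: "t \<le> k" "k \<ge> 2"
  shows "f 1 + (real t - 1) * (f 2 - f 1) \<le> f t"
proof (cases "t = 0")
  case True
  then show ?thesis using convex [of 0] t by (simp add: numeral_2_eq_2)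
next
  case False
  have slope: "f 2 - f 1 \<le> f (t + 1) - f t" if "t + 1 \<le> k" "t \<ge> 1" for t
    using that(2,1)
  proof (induction t rule: nat_induct_at_least)
    case (Suc t)
    then show ?case using convex [of t] by simp
  qed (simp add: numeral_2_eq_2)
  have "t \<ge> 1" using False by simp
  then show ?thesis
    using t(1)
  proof (induction t rule: nat_induct_at_least)
    case (Suc t)
    then show ?case using slope [of t] by (simp add: ring_distribs)
  qed simp
qed

lemma chord_less_of_strictly_convex:
  fixes f :: "nat \<Rightarrow> real"
  assumes convex: "\<And>t. t + 2 \<le> k \<Longrightarrow> f (t + 2) - 2 * f (t + 1) + f t > 0" and t: "t \<le> k" "t \<ge> 3"
  shows "f 1 + (real t - 1) * (f 2 - f 1) < f t"
proof -
  have slope: "f 2 - f 1 < f (t + 1) - f t" if "t + 1 \<le> k" "t \<ge> 2" for t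
    using that(2,1)
  proof (induction t rule: nat_induct_at_least)
    case base
    then show ?case using convex [of 1] by (simp add: numeral_3_eq_3 numeral_2_eq_2)
  next
    case (Suc t)
    then show ?case using convex [of t] by simp
  qed
  show ?thesis
    using t(2,1)
  proof (induction t rule: nat_induct_at_least)
    case base
    then show ?case using slope [of 2] by simp
  next
    case (Suc t)
    then show ?case using slope [of t] by (simp add: ring_distribs)
  qed
qed

section \<open>Comparison of the traces\<close>

lemma branching_le:
  assumes "uniform k H" "e \<in> hyperedges H"
  shows "branching H e \<le> k"
proof -
  have "card e = k" "finite e" using assms finite_hyperedge by (auto simp: uniform_def)
  then show ?thesis using card_mono [of e "{v \<in> e. degree H v = 2}"] by (simp add: branching_def)
qed

lemma alpha_trace_small:
  assumes H: "H \<in> hypertrees k m" and k: "k \<ge> 3" and d: "1 \<le> d" "d < k"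
  shows "alpha_trace \<alpha> k H d = real ((k - 1) ^ (nverts H - 1)) * (\<Sum>v<nverts H. (\<alpha> * real (degree H v)) ^ d)"
proof -
  have u: "uniform k H" "hypertree H" using H by (auto simp: hypertrees_def)
  have "edge_sum k (nverts H) e d x = 0" if "e \<in> hyperedges H" for e x
  proof -
    have "e \<subseteq> {..<nverts H}" "card e = k" using u that by (auto simp: uniform_def verts_def)
    then show ?thesis using edge_configs_empty d by (simp add: edge_sum_def)
  qed
  then show ?thesis using d by (simp add: alpha_trace_hypertree [OF u k])
qed

text \<open>\<open>\<Sum> (deg - 1) (deg - 2) \<ge> 0\<close>, together with the fixed sum of the degrees, bounds \<open>\<Sum> deg\<^sup>2\<close>.\<close>

lemma sum_degree_squares:
  assumes H: "H \<in> hypertrees k m" and k: "k \<ge> 2" and m: "m \<ge> 1"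
  shows "(\<Sum>v<nverts H. real (degree H v) ^ 2) =
    (\<Sum>v<nverts H. (real (degree H v) - 1) * (real (degree H v) - 2)) + 3 * real (m * k) - 2 * real (m * (k - 1) + 1)"
proof -
  have "(\<Sum>v<nverts H. real (degree H v) ^ 2) =
      (\<Sum>v<nverts H. (real (degree H v) - 1) * (real (degree H v) - 2) + 3 * real (degree H v) - 2)"
    by (intro sum.cong) (simp_all add: algebra_simps power2_eq_square)
  also have "\<dots> = (\<Sum>v<nverts H. (real (degree H v) - 1) * (real (degree H v) - 2)) +
      3 * real (\<Sum>v<nverts H. degree H v) - 2 * real (nverts H)"
    by (simp add: sum.distrib sum_subtractf sum_distrib_left)
  finally show ?thesis
    unfolding sum_degree_hypertree [OF H] unfolding hypertree_nverts(2) [OF H k m] .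
qed

lemma sum_degree_powers:
  assumes H: "H \<in> hypertrees k m" and k: "k \<ge> 2" and m: "m \<ge> 1"
    and deg: "\<And>v. v < nverts H \<Longrightarrow> degree H v \<le> 2"
  shows "(\<Sum>v<nverts H. (\<alpha> * real (degree H v)) ^ d) =
    real (m * (k - 1) + 1) * \<alpha> ^ d + (real m - 1) * ((2 * \<alpha>) ^ d - \<alpha> ^ d)"
proof -
  have "(\<Sum>v<nverts H. (\<alpha> * real (degree H v)) ^ d) =
      (\<Sum>v<nverts H. \<alpha> ^ d + (if degree H v = 2 then (2 * \<alpha>) ^ d - \<alpha> ^ d else 0))"
  proof (intro sum.cong refl)
    fix v assume "v \<in> {..<nverts H}"
    then have "degree H v = 1 \<or> degree H v = 2" using degree_pos [OF H k m, of v] deg [of v] by auto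
    then show "(\<alpha> * real (degree H v)) ^ d = \<alpha> ^ d + (if degree H v = 2 then (2 * \<alpha>) ^ d - \<alpha> ^ d else 0)"
      by (auto simp: mult.commute)
  qed
  also have "\<dots> = real (nverts H) * \<alpha> ^ d + real (card {v \<in> {..<nverts H}. degree H v = 2}) * ((2 * \<alpha>) ^ d - \<alpha> ^ d)"
    by (simp only: sum.distrib sum.inter_filter [symmetric] finite_lessThan) simp
  also have "real (card {v \<in> {..<nverts H}. degree H v = 2}) = real m - 1"
    using degree_two_count [OF H k m deg] by linarith
  finally show ?thesis unfolding hypertree_nverts(2) [OF H k m] .
qed

text \<open>Among hypertrees with degrees at most 2, only the branching numbers still depend on
  \<open>H\<close>; the power sum of the degrees is determined by \<open>k\<close> and
  \<open>m\<close>.\<close>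

lemma alpha_trace_degree_le_2:
  assumes H: "H \<in> hypertrees k m" and k: "k \<ge> 3" and m: "m \<ge> 1"
    and deg: "\<And>v. v < nverts H \<Longrightarrow> degree H v \<le> 2" and d: "1 \<le> d" "d \<le> k + 2" and n: "nverts H = n"
  shows "alpha_trace \<alpha> k H d = real ((k - 1) ^ (n - 1)) *
    (real (m * (k - 1) + 1) * \<alpha> ^ d + (real m - 1) * ((2 * \<alpha>) ^ d - \<alpha> ^ d) +
     ((1 - \<alpha>) / fact (k - 1)) ^ k * (\<Sum>e\<in>hyperedges H. edge_profile k n \<alpha> d (branching H e)))"
proof -
  have u: "uniform k H" "hypertree H" and k2: "k \<ge> 2" using H k by (auto simp: hypertrees_def)
  have "(\<Sum>e\<in>hyperedges H. edge_sum k (nverts H) e d (\<lambda>v. \<alpha> * real (degree H v))) =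
      (\<Sum>e\<in>hyperedges H. edge_profile k n \<alpha> d (branching H e))"
    using edge_sum_eq_profile [OF H k2 m deg] n by (intro sum.cong) auto
  moreover have "(\<Sum>v<nverts H. (\<alpha> * real (degree H v)) ^ d) =
      real (m * (k - 1) + 1) * \<alpha> ^ d + (real m - 1) * ((2 * \<alpha>) ^ d - \<alpha> ^ d)"
    by (rule sum_degree_powers [OF H k2 m deg])
  ultimately show ?thesis
    unfolding alpha_trace_hypertree [OF u k d] by (simp only: n)
qed

text \<open>The sum of an affine function of the branching numbers depends only on their number and
  on their total \<open>2 * m - 2\<close>, so the hyperpath and its competitors get the same
  value.\<close>

lemma sum_chord:
  fixes f :: "nat \<Rightarrow> real"
  assumes H: "H \<in> hypertrees k m" and k: "k \<ge> 2" and m: "m \<ge> 1"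
    and deg: "\<And>v. v < nverts H \<Longrightarrow> degree H v \<le> 2"
  shows "(\<Sum>e\<in>hyperedges H. f 1 + (real (branching H e) - 1) * (f 2 - f 1)) = real m * f 1 + (real m - 2) * (f 2 - f 1)"
proof -
  have "(\<Sum>e\<in>hyperedges H. f 1 + (real (branching H e) - 1) * (f 2 - f 1)) =
      real m * f 1 + (real (\<Sum>e\<in>hyperedges H. branching H e) - real m) * (f 2 - f 1)"
    using H by (simp add: sum.distrib sum_subtractf hypertrees_def flip: sum_distrib_right)
  moreover have "real (\<Sum>e\<in>hyperedges H. branching H e) = 2 * real m - 2"
    using sum_branching [OF H k m deg] by linarith
  ultimately show ?thesis by simp
qed

lemma hypertree_trace_0:
  "G \<in> hypertrees k m \<Longrightarrow> H \<in> hypertrees k m \<Longrightarrow> k \<ge> 2 \<Longrightarrow> m \<ge> 1 \<Longrightarrow>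
     alpha_trace \<alpha> k G 0 = alpha_trace \<alpha> k H 0"
  by (simp add: alpha_trace_def tensor_trace_def hypertree_nverts(2))

text \<open>\<open>S_less\<close> requires the deciding order to be less than the number of
  eigenvalues. There are at least \<open>4 * k\<close> of them, as the number of vertices is at
  least \<open>k\<close> and the power of \<open>k - 1\<close> at least 4.\<close>

lemma trace_index_bound:
  fixes k m :: nat
  assumes "k \<ge> 3" "m \<ge> 1"
  shows "k + 2 \<le> (m * (k - 1) + 1) * (k - 1) ^ (m * (k - 1) + 1 - 1) - 1"
proof -
  have "1 * (k - 1) \<le> m * (k - 1)" using assms by (intro mult_le_mono1)
  then have a: "k \<le> m * (k - 1) + 1" "2 \<le> m * (k - 1)" using assms by linarith+
  have "2 ^ 2 \<le> (k - 1) ^ 2" using assms by (intro power_mono) auto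
  also have "\<dots> \<le> (k - 1) ^ (m * (k - 1))" using assms a by (intro power_increasing) auto
  finally have "k * 4 \<le> (m * (k - 1) + 1) * (k - 1) ^ (m * (k - 1))" using a by (intro mult_le_mono) auto
  moreover have "(m * (k - 1) + 1) * (k - 1) ^ (m * (k - 1) + 1 - 1) = (m * (k - 1) + 1) * (k - 1) ^ (m * (k - 1))" by simp
  ultimately show ?thesis using assms by linarith
qed

theorem theorem6p2:
  fixes k m :: nat and \<alpha> :: real
  assumes "k \<ge> 3" and "m \<ge> 1" and "0 < \<alpha>" and "\<alpha> < 1"
  shows "first_in \<alpha> k (hypertrees k m) (hyperpath k m)"
  unfolding first_in_def
proof (intro conjI ballI impI)
  let ?P = "hyperpath k m"
  define n where "n = m * (k - 1) + 1"
  have k2: "k \<ge> 2" using assms by simp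
  show P: "?P \<in> hypertrees k m" by (rule hyperpath_in_hypertrees [OF k2 assms(2)])
  fix H assume H: "H \<in> hypertrees k m" and iso: "\<not> isomorphic ?P H"
  have n: "nverts ?P = n" "nverts H = n"
    using hypertree_nverts(2) [OF _ k2 assms(2)] P H by (auto simp: n_def)
  have degP: "degree ?P v \<le> 2" for v by (rule hyperpath_degree_le [OF k2])
  have S_lessI: "S_less \<alpha> k ?P H"
    if d: "1 \<le> d" "d \<le> k + 2" and eq: "\<And>t. \<lbrakk>1 \<le> t; t < d\<rbrakk> \<Longrightarrow> alpha_trace \<alpha> k ?P t = alpha_trace \<alpha> k H t"
      and less: "alpha_trace \<alpha> k ?P d < alpha_trace \<alpha> k H d" for d
    unfolding S_less_def
  proof (intro conjI bexI [of _ d] allI impI)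
    show "d \<in> {1..nverts ?P * (k - 1) ^ (nverts ?P - 1) - 1}"
      using d trace_index_bound [OF assms(1,2)] by (simp add: n n_def)
    show "alpha_trace \<alpha> k ?P t = alpha_trace \<alpha> k H t" if "t < d" for t
      using eq [of t] that hypertree_trace_0 [OF P H k2 assms(2)] by (cases "t = 0") auto
  qed (use n less in auto)
  have factor: "real ((k - 1) ^ (n - 1)) > 0" using assms by simp
  show "S_less \<alpha> k ?P H"
  proof (cases "\<exists>v<n. degree H v > 2")
    case True
    then obtain v where v: "v < n" "degree H v > 2" by blast
    \<comment> \<open>The quadratic is negative only strictly between 1 and 2, where there is no
      natural number.\<close>
    have nonneg: "(real q - 1) * (real q - 2) \<ge> 0" for q
    proof (cases "q \<le> 1")
      case True
      then show ?thesis by (intro mult_nonpos_nonpos) auto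
    qed (intro mult_nonneg_nonneg, auto)
    have zero: "(\<Sum>v<n. (real (degree ?P v) - 1) * (real (degree ?P v) - 2)) = 0"
    proof (intro sum.neutral ballI)
      fix v assume "v \<in> {..<n}"
      then have "degree ?P v = 1 \<or> degree ?P v = 2"
        using degree_pos [OF P k2 assms(2), of v] degP [of v] n by auto
      then show "(real (degree ?P v) - 1) * (real (degree ?P v) - 2) = 0" by auto
    qed
    have "(\<Sum>v<n. (real (degree H v) - 1) * (real (degree H v) - 2)) > 0"
      using v nonneg by (intro sum_pos2 [of _ v]) auto
    then have sq: "(\<Sum>v<n. real (degree ?P v) ^ 2) < (\<Sum>v<n. real (degree H v) ^ 2)"
      using sum_degree_squares [OF P k2 assms(2)] sum_degree_squares [OF H k2 assms(2)] zero n by simp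
    have tr: "alpha_trace \<alpha> k G d = real ((k - 1) ^ (n - 1)) * (\<alpha> ^ d * (\<Sum>v<n. real (degree G v) ^ d))"
      if "G \<in> hypertrees k m" "nverts G = n" "1 \<le> d" "d \<le> 2" for G d
      using alpha_trace_small [OF that(1) assms(1) that(3), of \<alpha>] that assms
      by (simp add: power_mult_distrib sum_distrib_left)
    show ?thesis
    proof (rule S_lessI [of 2])
      fix t :: nat assume "1 \<le> t" "t < 2"
      then have "t = 1" by simp
      moreover have "(\<Sum>v<n. real (degree ?P v)) = (\<Sum>v<n. real (degree H v))"
        using sum_degree_hypertree [OF P] sum_degree_hypertree [OF H] n by (metis of_nat_sum)
      ultimately show "alpha_trace \<alpha> k ?P t = alpha_trace \<alpha> k H t"
        using tr [OF P n(1), of 1] tr [OF H n(2), of 1] by simp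
    next
      have "\<alpha> ^ 2 * (\<Sum>v<n. real (degree ?P v) ^ 2) < \<alpha> ^ 2 * (\<Sum>v<n. real (degree H v) ^ 2)"
        using sq assms by (intro mult_strict_left_mono) auto
      then show "alpha_trace \<alpha> k ?P 2 < alpha_trace \<alpha> k H 2"
        using tr [OF P n(1), of 2] tr [OF H n(2), of 2] factor by (simp add: mult_strict_left_mono)
    qed (use assms in auto)
  next
    case False
    then have degH: "degree H v \<le> 2" if "v < nverts H" for v using that n by force
    have "\<exists>e\<in>hyperedges H. branching H e \<ge> 3"
    proof (rule ccontr)
      assume "\<not> ?thesis"
      then have "branching H e \<le> 2" if "e \<in> hyperedges H" for e using that by force
      then show False using isomorphic_hyperpath [OF H k2 assms(2) degH] iso by blast
    qed
    then obtain e0 where e0: "e0 \<in> hyperedges H" "branching H e0 \<ge> 3" by blast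
    have uH: "uniform k H" and uP: "uniform k ?P" using H P by (auto simp: hypertrees_def)
    have fin: "finite (hyperedges H)" by (rule finite_hyperedges [OF uH])
    \<comment> \<open>A branching number of 3 forces \<open>2 * m - 2 \<ge> 3\<close>; thus
      \<open>m = 1\<close> needs no separate treatment.\<close>
    have "branching H e0 \<le> (\<Sum>e\<in>hyperedges H. branching H e)"
      using fin e0 by (intro member_le_sum) auto
    then have m2: "m \<ge> 2" using sum_branching [OF H k2 assms(2) degH] e0 by linarith
    have kn: "k \<le> n"
    proof -
      have "1 * (k - 1) \<le> m * (k - 1)" using assms by (intro mult_le_mono1)
      then show ?thesis unfolding n_def using assms by linarith
    qed
    let ?chord = "\<lambda>d G. \<Sum>e\<in>hyperedges G. edge_profile k n \<alpha> d 1 + (real (branching G e) - 1) * (edge_profile k n \<alpha> d 2 - edge_profile k n \<alpha> d 1)"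
    have chord: "?chord d ?P = ?chord d H" for d
      by (simp only: sum_chord [OF P k2 assms(2) degP] sum_chord [OF H k2 assms(2) degH])
    \<comment> \<open>The chord is exact at 1 and 2, hence on every hyperedge of the
      hyperpath.\<close>
    have path: "(\<Sum>e\<in>hyperedges ?P. edge_profile k n \<alpha> d (branching ?P e)) = ?chord d ?P" for d
      using hyperpath_branching [OF k2 m2] by (intro sum.cong) fastforce+
    let ?trace = "\<lambda>d G. real ((k - 1) ^ (n - 1)) *
      (real (m * (k - 1) + 1) * \<alpha> ^ d + (real m - 1) * ((2 * \<alpha>) ^ d - \<alpha> ^ d) +
       ((1 - \<alpha>) / fact (k - 1)) ^ k * (\<Sum>e\<in>hyperedges G. edge_profile k n \<alpha> d (branching G e)))"
    have trace: "alpha_trace \<alpha> k ?P d = ?trace d ?P" "alpha_trace \<alpha> k H d = ?trace d H" if "1 \<le> d" "d \<le> k + 2" for d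
      by (rule alpha_trace_degree_le_2 [OF P assms(1,2) degP that n(1)],
          rule alpha_trace_degree_le_2 [OF H assms(1,2) degH that n(2)])
    show ?thesis
    proof (rule S_lessI [of "k + 2"])
      fix t assume t: "1 \<le> t" "t < k + 2"
      have "edge_profile k n \<alpha> t s = edge_profile k n \<alpha> t 1 + (real s - 1) * (edge_profile k n \<alpha> t 2 - edge_profile k n \<alpha> t 1)"
        if "s \<le> k" for s
      \<comment> \<open>With second difference 0, both the profile and its negative are convex, so
        the chord bound applies in both directions.\<close>
      proof (rule antisym)
        have aff: "edge_profile k n \<alpha> t (s + 2) - 2 * edge_profile k n \<alpha> t (s + 1) + edge_profile k n \<alpha> t s = 0"
          if "s + 2 \<le> k" for s using edge_profile_affine [OF that kn] t by simp
        show "edge_profile k n \<alpha> t 1 + (real s - 1) * (edge_profile k n \<alpha> t 2 - edge_profile k n \<alpha> t 1) \<le> edge_profile k n \<alpha> t s"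
          by (rule chord_le_of_convex [OF _ that k2]) (use aff in simp)
        have "- edge_profile k n \<alpha> t 1 + (real s - 1) * (- edge_profile k n \<alpha> t 2 - - edge_profile k n \<alpha> t 1) \<le> - edge_profile k n \<alpha> t s"
        proof (rule chord_le_of_convex [where f = "\<lambda>s. - edge_profile k n \<alpha> t s", OF _ that k2])
          fix s assume "s + 2 \<le> k"
          from aff [OF this] show "0 \<le> - edge_profile k n \<alpha> t (s + 2) - 2 * - edge_profile k n \<alpha> t (s + 1) + - edge_profile k n \<alpha> t s"
            by linarith
        qed
        then show "edge_profile k n \<alpha> t s \<le> edge_profile k n \<alpha> t 1 + (real s - 1) * (edge_profile k n \<alpha> t 2 - edge_profile k n \<alpha> t 1)"
          by (simp add: algebra_simps)
      qed
      then have "(\<Sum>e\<in>hyperedges H. edge_profile k n \<alpha> t (branching H e)) = ?chord t H"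
        using branching_le [OF uH] by (intro sum.cong) blast+
      then show "alpha_trace \<alpha> k ?P t = alpha_trace \<alpha> k H t"
        using t chord [of t] path [of t] by (simp only: trace less_imp_le)
    next
      have convex: "edge_profile k n \<alpha> (k + 2) (s + 2) - 2 * edge_profile k n \<alpha> (k + 2) (s + 1) + edge_profile k n \<alpha> (k + 2) s > 0"
        if "s + 2 \<le> k" for s
        by (rule edge_profile_strictly_convex [OF that assms(1) kn assms(3)])
      have "?chord (k + 2) H < (\<Sum>e\<in>hyperedges H. edge_profile k n \<alpha> (k + 2) (branching H e))"
      proof (rule sum_strict_mono_ex1 [OF fin])
        show "\<forall>e\<in>hyperedges H. edge_profile k n \<alpha> (k + 2) 1 + (real (branching H e) - 1) * (edge_profile k n \<alpha> (k + 2) 2 - edge_profile k n \<alpha> (k + 2) 1)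
            \<le> edge_profile k n \<alpha> (k + 2) (branching H e)"
          using chord_le_of_convex [OF less_imp_le [OF convex] branching_le [OF uH] k2] by blast
        show "\<exists>e\<in>hyperedges H. edge_profile k n \<alpha> (k + 2) 1 + (real (branching H e) - 1) * (edge_profile k n \<alpha> (k + 2) 2 - edge_profile k n \<alpha> (k + 2) 1)
            < edge_profile k n \<alpha> (k + 2) (branching H e)"
          using chord_less_of_strictly_convex [OF convex branching_le [OF uH e0(1)] e0(2)] e0 by blast
      qed
      then have less: "(\<Sum>e\<in>hyperedges ?P. edge_profile k n \<alpha> (k + 2) (branching ?P e)) <
          (\<Sum>e\<in>hyperedges H. edge_profile k n \<alpha> (k + 2) (branching H e))"
        using path [of "k + 2"] chord [of "k + 2"] by simp
      have one: "1 \<le> k + 2" by simp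
      have "((1 - \<alpha>) / fact (k - 1)) ^ k > 0" using assms by simp
      from mult_strict_left_mono [OF less this]
      show "alpha_trace \<alpha> k ?P (k + 2) < alpha_trace \<alpha> k H (k + 2)"
        unfolding trace [OF one order_refl]
        by (intro mult_strict_left_mono [OF add_strict_left_mono factor])
    qed (use assms in auto)
  qed
qed

end
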